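(* Let $X_1,\dots,X_n,Y$ be Banach spaces over the same field $\mathbb K$. Then: (i) $\gamma$ is a norm on $X_1\otimes\dots\otimes X_n\otimes Y$. (ii) $\gamma((p-q)\otimes y)\le\pi(p-q)\,\|y\|$ for all $p,q\in\Sigma_{X_1\dots X_n}$ and $y\in Y$. (iii) Let $\varphi\in\mathcal L(X_1,\dots,X_n)$ and $y^*\in Y^*$. The linear functional $\varphi\otimes y^*:(X_1\otimes\dots\otimes X_n\otimes Y,\gamma)\to\mathbb K$ determined by $x^1\otimes\dots\otimes x^n\otimes y\mapsto\varphi(x^1,\dots,x^n)\,y^*(y)$ is bounded and $\|\varphi\otimes y^*\|\le\|\varphi\|\,\|y^*\|$. (iv) Let $Z_1,\dots,Z_m,W$ be Banach spaces. If $R:Z_1\times\dots\times Z_m\to X_1\widehat\otimes_\pi\dots\widehat\otimes_\pi X_n$ is a bounded multilinear operator such that $R(Z_1\times\dots\times Z_m)\subset\Sigma_{X_1\dots X_n}$ and $S:W\to Y$ is a bounded linear operator, then the linear map $R\otimes S:(Z_1\otimes\dots\otimes Z_m\otimes W,\gamma)\to(X_1\otimes\dots\otimes X_n\otimes Y,\gamma)$ determined by $z_1\otimes\dots\otimes z_m\otimes w\mapsto R(z_1,\dots,z_m)\otimes S(w)$ is bounded and $\|R\otimes S\|\le\|R\|\,\|S\|$. (v) For every $u\in X_1\otimes\dots\otimes X_n\otimes Y$, $\gamma(u;X_1\otimes\dots\otimes X_n\otimes Y)=\inf\gamma(u;E_1\otimes\dots\otimes E_n\otimes F)$, where the infimum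 is taken over all finite dimensional subspaces $E_i$ of $X_i$ and $F$ of $Y$ such that $u\in E_1\otimes\dots\otimes E_n\otimes F$.
   Context: $\mathbb K$ is $\mathbb R$ or $\mathbb C$; $n,m$ are positive integers. $\mathcal L(X_1,\dots,X_n)$ is the space of bounded multilinear forms with the norm $\|\varphi\|=\sup\{|\varphi(x^1,\dots,x^n)|:\|x^i\|\le1\}$ (and similarly for vector-valued multilinear operators). $\pi$ is the projective norm on $X_1\otimes\dots\otimes X_n$, $X_1\widehat\otimes_\pi\dots\widehat\otimes_\pi X_n$ its completion, and $\Sigma_{X_1\dots X_n}=\{x^1\otimes\dots\otimes x^n:x^i\in X_i\}$ the set of decomposable tensors. For $\varphi\in\mathcal L(X_1,\dots,X_n)$, $f_\varphi(x^1\otimes\dots\otimes x^n)=\varphi(x^1,\dots,x^n)$ on $\Sigma_{X_1\dots X_n}$. For finite sequences $(p_i)_{i=1}^m,(q_i)_{i=1}^m,(a_j)_{j=1}^l,(b_j)_{j=1}^l$ in $\Sigma_{X_1\dots X_n}$ write $(p_i,q_i)\le_\pi(a_j,b_j)$ if $\sum_{i=1}^m|f_\varphi(p_i)-f_\varphi(q_i)|^2\le\sum_{j=1}^l|f_\varphi(a_j)-f_\varphi(b_j)|^2$ for all $\varphi\in\mathcal L(X_1,\dots,X_n)$ (by adding zeros one may always take $m=l$). $X_1\otimes\dots\otimes X_n\otimes Y$ is identified with $(X_1\otimes\dots\otimes X_n)\otimes Y$. For $u$ in it, $$\gamma(u)=\gamma(u;X_1\otimes\dots\otimes X_n\otimes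 Y)=\inf\Big(\sum_{i=1}^m\pi(a_i-b_i)^2\Big)^{1/2}\Big(\sum_{i=1}^m\|y_i\|^2\Big)^{1/2},$$ the infimum over all representations $u=\sum_{i=1}^m(p_i-q_i)\otimes y_i$ with $p_i,q_i\in\Sigma_{X_1\dots X_n}$, $y_i\in Y$, and all $a_i,b_i\in\Sigma_{X_1\dots X_n}$ with $(p_i,q_i)\le_\pi(a_i,b_i)$. For subspaces $E_i\subset X_i$, $F\subset Y$, $\gamma(\cdot;E_1\otimes\dots\otimes E_n\otimes F)$ is the same quantity computed with $E_i$, $F$ (with induced norms) in place of $X_i$, $Y$. *)

theory Defs
  imports
    "HOL-Analysis.Abstract_Metric_Spaces"
    "HOL-Library.Function_Algebras"
    "Jordan_Normal_Form.Missing_VectorSpace"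
begin

section \<open>Normed spaces over the real or complex field\<close>

text \<open>
  The scalar field is a subset \<open>K\<close> of the complex numbers, either \<open>\<real>\<close> or \<open>UNIV\<close>; real scalars are
  complex numbers with vanishing imaginary part. A normed space is a carrier-based vector space (so
  different members of a family can be entirely unrelated spaces) together with a norm.
\<close>

definition scalar_ring :: "complex set \<Rightarrow> complex ring"
  where "scalar_ring K = \<lparr>carrier = K, mult = (*), one = 1, zero = 0, add = (+)\<rparr>"

record 'a nspace = "(complex, 'a) module" +
  nrm :: "'a \<Rightarrow> real"

locale normed_space = vectorspace "scalar_ring K" X
  for K :: "complex set" and X :: "'a nspace" (structure) +
  assumes nrm_nonneg: "x \<in> carrier X \<Longrightarrow> 0 \<le> nrm X x"
    and nrm_eq_0_iff: "x \<in> carrier X \<Longrightarrow> nrm X x = 0 \<longleftrightarrow> x = \<zero>"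
    and nrm_smult: "c \<in> K \<Longrightarrow> x \<in> carrier X \<Longrightarrow> nrm X (c \<odot> x) = cmod c * nrm X x"
    and nrm_triangle: "x \<in> carrier X \<Longrightarrow> y \<in> carrier X \<Longrightarrow> nrm X (x \<oplus> y) \<le> nrm X x + nrm X y"

text \<open>\<open>Metric_space\<close> constrains the distance also off the carrier, hence the case distinction.\<close>

definition ndist :: "'a nspace \<Rightarrow> 'a \<Rightarrow> 'a \<Rightarrow> real"
  where "ndist X x y =
    (if x \<in> carrier X \<and> y \<in> carrier X then nrm X (x \<ominus>\<^bsub>X\<^esub> y) else 0)"

locale banach_space = normed_space +
  assumes complete: "Metric_space.mcomplete (carrier X) (ndist X)"

definition scalar_space :: "complex set \<Rightarrow> complex nspace"
  where "scalar_space K =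
    \<lparr>carrier = K, mult = (*), one = 1, zero = 0, add = (+), smult = (*), nrm = cmod\<rparr>"


section \<open>Bounded linear and multilinear maps\<close>

text \<open>The factors are indexed by an arbitrary finite type \<open>'i\<close>, so their number is \<open>CARD('i)\<close>.\<close>

definition tuples :: "('i::finite \<Rightarrow> 'a nspace) \<Rightarrow> ('i \<Rightarrow> 'a) set"
  where "tuples X = {x. \<forall>i. x i \<in> carrier (X i)}"

definition multilinear ::
    "complex set \<Rightarrow> ('i::finite \<Rightarrow> 'a nspace) \<Rightarrow> 'v nspace \<Rightarrow> (('i \<Rightarrow> 'a) \<Rightarrow> 'v) \<Rightarrow> bool"
  where "multilinear K X V R \<longleftrightarrow>
    (\<forall>x \<in> tuples X. \<forall>i. linear_map (scalar_ring K) (X i) V (\<lambda>t. R (x(i := t))))"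

definition unit_image :: "('i::finite \<Rightarrow> 'a nspace) \<Rightarrow> 'v nspace \<Rightarrow> (('i \<Rightarrow> 'a) \<Rightarrow> 'v) \<Rightarrow> real set"
  where "unit_image X V R = {nrm V (R x) | x. x \<in> tuples X \<and> (\<forall>i. nrm (X i) (x i) \<le> 1)}"

definition bounded_multilinear ::
    "complex set \<Rightarrow> ('i::finite \<Rightarrow> 'a nspace) \<Rightarrow> 'v nspace \<Rightarrow> (('i \<Rightarrow> 'a) \<Rightarrow> 'v) \<Rightarrow> bool"
  where "bounded_multilinear K X V R \<longleftrightarrow> multilinear K X V R \<and> bdd_above (unit_image X V R)"

definition multi_norm :: "('i::finite \<Rightarrow> 'a nspace) \<Rightarrow> 'v nspace \<Rightarrow> (('i \<Rightarrow> 'a) \<Rightarrow> 'v) \<Rightarrow> real"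
  where "multi_norm X V R = Sup (unit_image X V R)"

definition bounded_op :: "complex set \<Rightarrow> 'v nspace \<Rightarrow> 'w nspace \<Rightarrow> ('v \<Rightarrow> 'w) \<Rightarrow> bool"
  where "bounded_op K V W T \<longleftrightarrow>
    linear_map (scalar_ring K) V W T \<and>
    bdd_above {nrm W (T v) | v. v \<in> carrier V \<and> nrm V v \<le> 1}"

definition op_norm :: "'v nspace \<Rightarrow> 'w nspace \<Rightarrow> ('v \<Rightarrow> 'w) \<Rightarrow> real"
  where "op_norm V W T = Sup {nrm W (T v) | v. v \<in> carrier V \<and> nrm V v \<le> 1}"

text \<open>
  \<open>C\<close> together with the embedding \<open>\<iota>\<close> is a completion of \<open>V\<close>. Completions are unique up to isometric
  isomorphism; results are stated for every completion rather than for a chosen one.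
\<close>

definition is_completion :: "complex set \<Rightarrow> 'v nspace \<Rightarrow> 'c nspace \<Rightarrow> ('v \<Rightarrow> 'c) \<Rightarrow> bool"
  where "is_completion K V C \<iota> \<longleftrightarrow>
    banach_space K C \<and>
    linear_map (scalar_ring K) V C \<iota> \<and>
    (\<forall>v \<in> carrier V. nrm C (\<iota> v) = nrm V v) \<and>
    Metric_space.mtopology (carrier C) (ndist C) closure_of (\<iota> ` carrier V) = carrier C"


section \<open>Algebraic tensor products\<close>

text \<open>
  Tensor products are realised inside the algebraic dual of the space of all (not necessarily
  bounded) scalar multilinear forms: with \<open>F\<close> the set of these forms, the elementary tensor given by a
  tuple \<open>t\<close> is the evaluation \<open>\<phi> \<mapsto> \<phi> t\<close> on \<open>F\<close> (extended by \<open>0\<close> off \<open>F\<close>), and the tensor product is the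
  linear span of the elementary tensors. Since linear functionals separate the points of a vector
  space, this is the algebraic tensor product. Sums, differences and zero of tensors are pointwise.
\<close>

definition ev :: "('t \<Rightarrow> complex) set \<Rightarrow> 't \<Rightarrow> ('t \<Rightarrow> complex) \<Rightarrow> complex"
  where "ev F t = (\<lambda>\<phi>. if \<phi> \<in> F then \<phi> t else 0)"

definition lin_hull :: "complex set \<Rightarrow> ('f \<Rightarrow> complex) set \<Rightarrow> ('f \<Rightarrow> complex) set"
  where "lin_hull K A =
    {(\<Sum>k<m. (\<lambda>\<phi>. c k * a k \<phi>)) | (m :: nat) c a. \<forall>k<m. c k \<in> K \<and> a k \<in> A}"

definition fun_nspace ::
    "('f \<Rightarrow> complex) set \<Rightarrow> (('f \<Rightarrow> complex) \<Rightarrow> real) \<Rightarrow> ('f \<Rightarrow> complex) nspace"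
  where "fun_nspace S N =
    \<lparr>carrier = S, mult = (\<lambda>_ _. undefined), one = undefined, zero = 0, add = (+),
     smult = (\<lambda>c u \<phi>. c * u \<phi>), nrm = N\<rparr>"

text \<open>The linear map between tensor products that is induced by a map \<open>g\<close> of tuples.\<close>

definition push ::
    "('s \<Rightarrow> complex) set \<Rightarrow> ('t \<Rightarrow> 's) \<Rightarrow> (('t \<Rightarrow> complex) \<Rightarrow> complex) \<Rightarrow> ('s \<Rightarrow> complex) \<Rightarrow> complex"
  where "push G g u = (\<lambda>\<phi>. if \<phi> \<in> G then u (\<phi> \<circ> g) else 0)"

lemma push_ev:
  assumes "\<And>\<phi>. \<phi> \<in> G \<Longrightarrow> \<phi> \<circ> g \<in> F"
  shows "push G g (ev F t) = ev G (g t)"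
  using assms by (auto simp: push_def ev_def)


subsection \<open>The projective tensor product of the family\<close>

type_synonym ('i, 'a) tensor = "(('i \<Rightarrow> 'a) \<Rightarrow> complex) \<Rightarrow> complex"

definition mforms :: "complex set \<Rightarrow> ('i::finite \<Rightarrow> 'a nspace) \<Rightarrow> (('i \<Rightarrow> 'a) \<Rightarrow> complex) set"
  where "mforms K X = {\<phi>. multilinear K X (scalar_space K) \<phi>}"

definition etens :: "complex set \<Rightarrow> ('i::finite \<Rightarrow> 'a nspace) \<Rightarrow> ('i \<Rightarrow> 'a) \<Rightarrow> ('i, 'a) tensor"
  where "etens K X x = ev (mforms K X) x"

definition decomp :: "complex set \<Rightarrow> ('i::finite \<Rightarrow> 'a nspace) \<Rightarrow> ('i, 'a) tensor set"
  where "decomp K X = etens K X ` tuples X"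

definition proj_norm :: "complex set \<Rightarrow> ('i::finite \<Rightarrow> 'a nspace) \<Rightarrow> ('i, 'a) tensor \<Rightarrow> real"
  where "proj_norm K X u =
    Inf {(\<Sum>k<m. \<Prod>i\<in>UNIV. nrm (X i) (x k i)) | (m :: nat) x.
      (\<forall>k<m. x k \<in> tuples X) \<and> u = (\<Sum>k<m. etens K X (x k))}"

definition ptensor :: "complex set \<Rightarrow> ('i::finite \<Rightarrow> 'a nspace) \<Rightarrow> ('i, 'a) tensor nspace"
  where "ptensor K X = fun_nspace (lin_hull K (decomp K X)) (proj_norm K X)"

definition f_form :: "(('i \<Rightarrow> 'a) \<Rightarrow> complex) \<Rightarrow> ('i, 'a) tensor \<Rightarrow> complex"
  where "f_form \<phi> p = p \<phi>"

lemma f_form_etens: "\<phi> \<in> mforms K X \<Longrightarrow> f_form \<phi> (etens K X x) = \<phi> x"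
  by (simp add: f_form_def etens_def ev_def)

definition le_pi ::
    "complex set \<Rightarrow> ('i::finite \<Rightarrow> 'a nspace) \<Rightarrow>
     nat \<Rightarrow> (nat \<Rightarrow> ('i, 'a) tensor) \<Rightarrow> (nat \<Rightarrow> ('i, 'a) tensor) \<Rightarrow>
     nat \<Rightarrow> (nat \<Rightarrow> ('i, 'a) tensor) \<Rightarrow> (nat \<Rightarrow> ('i, 'a) tensor) \<Rightarrow> bool"
  where "le_pi K X m p q l a b \<longleftrightarrow>
    (\<forall>\<phi>. bounded_multilinear K X (scalar_space K) \<phi> \<longrightarrow>
      (\<Sum>k<m. (cmod (f_form \<phi> (p k) - f_form \<phi> (q k)))\<^sup>2)
        \<le> (\<Sum>k<l. (cmod (f_form \<phi> (a k) - f_form \<phi> (b k)))\<^sup>2))"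


subsection \<open>The tensor product with one further factor, and the norm gamma\<close>

type_synonym ('v, 'b) tensor2 = "('v \<times> 'b \<Rightarrow> complex) \<Rightarrow> complex"

definition bforms :: "complex set \<Rightarrow> 'v nspace \<Rightarrow> 'b nspace \<Rightarrow> ('v \<times> 'b \<Rightarrow> complex) set"
  where "bforms K V Y =
    {\<beta>. (\<forall>y \<in> carrier Y. linear_map (scalar_ring K) V (scalar_space K) (\<lambda>v. \<beta> (v, y))) \<and>
        (\<forall>v \<in> carrier V. linear_map (scalar_ring K) Y (scalar_space K) (\<lambda>y. \<beta> (v, y)))}"

definition etens2 :: "complex set \<Rightarrow> 'v nspace \<Rightarrow> 'b nspace \<Rightarrow> 'v \<Rightarrow> 'b \<Rightarrow> ('v, 'b) tensor2"
  where "etens2 K V Y v y = ev (bforms K V Y) (v, y)"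

text \<open>
  The two sequences compared by \<open>le_pi\<close> may be taken of equal length, padding with zero tensors.
\<close>

definition gamma ::
    "complex set \<Rightarrow> ('i::finite \<Rightarrow> 'a nspace) \<Rightarrow> 'b nspace \<Rightarrow> (('i, 'a) tensor, 'b) tensor2 \<Rightarrow> real"
  where "gamma K X Y u =
    Inf {sqrt (\<Sum>k<m. (proj_norm K X (a k - b k))\<^sup>2) * sqrt (\<Sum>k<m. (nrm Y (y k))\<^sup>2) |
        (m :: nat) p q a b y.
      (\<forall>k<m. p k \<in> decomp K X \<and> q k \<in> decomp K X \<and> y k \<in> carrier Y) \<and>
      u = (\<Sum>k<m. etens2 K (ptensor K X) Y (p k - q k) (y k)) \<and>
      (\<forall>k<m. a k \<in> decomp K X \<and> b k \<in> decomp K X) \<and>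
      le_pi K X m p q m a b}"

definition gtensor ::
    "complex set \<Rightarrow> ('i::finite \<Rightarrow> 'a nspace) \<Rightarrow> 'b nspace \<Rightarrow> (('i, 'a) tensor, 'b) tensor2 nspace"
  where "gtensor K X Y =
    fun_nspace
      (lin_hull K {etens2 K (ptensor K X) Y v y | v y. v \<in> carrier (ptensor K X) \<and> y \<in> carrier Y})
      (gamma K X Y)"


subsection \<open>Finite dimensional subspaces\<close>

definition fd_subspace :: "complex set \<Rightarrow> 'a set \<Rightarrow> 'a nspace \<Rightarrow> bool"
  where "fd_subspace K E X \<longleftrightarrow>
    VectorSpace.subspace (scalar_ring K) E X \<and>
    vectorspace.fin_dim (scalar_ring K) (X\<lparr>carrier := E\<rparr>)"

definition restr :: "('i \<Rightarrow> 'a nspace) \<Rightarrow> ('i \<Rightarrow> 'a set) \<Rightarrow> 'i \<Rightarrow> 'a nspace"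
  where "restr X E = (\<lambda>i. (X i)\<lparr>carrier := E i\<rparr>)"

text \<open>
  The canonical (injective) linear inclusion of the tensor product of subspaces of the \<open>X i\<close> and of
  \<open>Y\<close> into that of the \<open>X i\<close> and \<open>Y\<close>, through which the former is regarded as a subspace of the latter;
  it sends \<open>(x\<^sub>1 \<otimes> \<dots> \<otimes> x\<^sub>n) \<otimes> y\<close> to \<open>(x\<^sub>1 \<otimes> \<dots> \<otimes> x\<^sub>n) \<otimes> y\<close>.
\<close>

definition tensor_incl ::
    "complex set \<Rightarrow> ('i::finite \<Rightarrow> 'a nspace) \<Rightarrow> 'b nspace \<Rightarrow>
     (('i, 'a) tensor, 'b) tensor2 \<Rightarrow> (('i, 'a) tensor, 'b) tensor2"
  where "tensor_incl K X Y =
    push (bforms K (ptensor K X) Y) (map_prod (push (mforms K X) id) id)"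

end

theory Submission
  imports Defs
begin

text \<open>
  Bounded functionals separate points (Hahn--Banach), and repeated use of this gives finite rank
  operators that are the identity on a given finite dimensional subspace. Applied to one tensor factor
  after the other they show that a nonzero tensor is detected by a functional
  \<open>g\<^sub>1 \<otimes> \<dots> \<otimes> g\<^sub>n \<otimes> h\<close> with bounded factors, and by Cauchy--Schwarz \<open>gamma\<close> dominates such
  functionals, so \<open>gamma\<close> is definite. The triangle inequality follows by concatenating
  representations whose two factors have been balanced by rescaling.

  Both \<open>R \<otimes> S\<close> and the inclusion of a tensor product of subspaces arise from a multilinear map into
  the decomposable tensors and a linear map; pulling bounded forms back along it preserves the
  relation \<open>le_pi\<close>, which gives (iv) and one inequality of (v). For the other inequality, a nearly
  optimal representation involves finitely many vectors only, and the finite rank operators onto their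
  span extend forms on the subspaces to forms on the whole spaces.
\<close>

section \<open>Hahn--Banach separation\<close>

text \<open>Equality of tensors is tested by all algebraic forms, while \<open>gamma\<close> and
  \<open>proj_norm\<close> see bounded forms only. Definiteness therefore means trading an arbitrary
  form for a product of bounded functionals. The relation \<open>le_pi\<close> contains no norms of
  forms. What can grow on passing to subspaces is the projective norm of \<open>a k - b k\<close>,
  so the spans must also contain the vectors of nearly optimal representations of these differences.
  In (iv) the operator takes values in a completion. It has to be brought back to the algebraic
  tensor product, which requires the embedding to be injective and hence the projective norm to be
  definite.\<close>

locale scalar_field =
  fixes K :: "complex set"
  assumes K: "K = \<real> \<or> K = UNIV"
begin

lemma K_closed [simp, intro]:
  "0 \<in> K" "1 \<in> K" "c \<in> K \<Longrightarrow> d \<in> K \<Longrightarrow> c + d \<in> K" "c \<in> K \<Longrightarrow> d \<in> K \<Longrightarrow> c * d \<in> K"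
  "c \<in> K \<Longrightarrow> - c \<in> K" "c \<in> K \<Longrightarrow> d \<in> K \<Longrightarrow> c - d \<in> K" "c \<in> K \<Longrightarrow> inverse c \<in> K"
  "complex_of_real t \<in> K"
  using K by auto

lemma K_prod [intro]: "(\<And>i. i \<in> I \<Longrightarrow> c i \<in> K) \<Longrightarrow> prod c I \<in> K"
  by (induction I rule: infinite_finite_induct) auto

lemma scalar_ring_simps [simp]:
  "carrier (scalar_ring K) = K" "mult (scalar_ring K) = (*)" "one (scalar_ring K) = 1"
  "zero (scalar_ring K) = 0" "add (scalar_ring K) = (+)"
  by (auto simp: scalar_ring_def)

lemma scalar_space_simps [simp]:
  "carrier (scalar_space K) = K" "smult (scalar_space K) = (*)"
  "zero (scalar_space K) = 0" "add (scalar_space K) = (+)" "nrm (scalar_space K) = cmod"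
  by (auto simp: scalar_space_def)

lemma field_scalar_ring: "field (scalar_ring K)"
proof -
  have "cring (scalar_ring K)"
  proof (rule cringI)
    show "abelian_group (scalar_ring K)"
      by (rule abelian_groupI) (auto simp: algebra_simps intro: bexI[of _ "- x" for x])
    show "comm_monoid (scalar_ring K)"
      by (rule comm_monoidI) (auto simp: algebra_simps)
  qed (auto simp: algebra_simps)
  then show ?thesis
  proof (rule cring.cring_fieldI)
    show "Units (scalar_ring K) = carrier (scalar_ring K) - {\<zero>\<^bsub>scalar_ring K\<^esub>}"
    proof (intro equalityI subsetI)
      fix c assume "c \<in> Units (scalar_ring K)"
      then show "c \<in> carrier (scalar_ring K) - {\<zero>\<^bsub>scalar_ring K\<^esub>}"
        by (auto simp: Units_def)
    next
      fix c assume "c \<in> carrier (scalar_ring K) - {\<zero>\<^bsub>scalar_ring K\<^esub>}"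
      then show "c \<in> Units (scalar_ring K)"
        by (auto simp: Units_def intro!: bexI[of _ "inverse c"])
    qed
  qed
qed

lemma vectorspaceI:
  assumes "abelian_group V"
    and "\<And>c x. c \<in> K \<Longrightarrow> x \<in> carrier V \<Longrightarrow> c \<odot>\<^bsub>V\<^esub> x \<in> carrier V"
    and "\<And>c d x. c \<in> K \<Longrightarrow> d \<in> K \<Longrightarrow> x \<in> carrier V \<Longrightarrow>
      (c + d) \<odot>\<^bsub>V\<^esub> x = c \<odot>\<^bsub>V\<^esub> x \<oplus>\<^bsub>V\<^esub> d \<odot>\<^bsub>V\<^esub> x"
    and "\<And>c x y. c \<in> K \<Longrightarrow> x \<in> carrier V \<Longrightarrow> y \<in> carrier V \<Longrightarrow>
      c \<odot>\<^bsub>V\<^esub> (x \<oplus>\<^bsub>V\<^esub> y) = c \<odot>\<^bsub>V\<^esub> x \<oplus>\<^bsub>V\<^esub> c \<odot>\<^bsub>V\<^esub> y"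
    and "\<And>c d x. c \<in> K \<Longrightarrow> d \<in> K \<Longrightarrow> x \<in> carrier V \<Longrightarrow> (c * d) \<odot>\<^bsub>V\<^esub> x = c \<odot>\<^bsub>V\<^esub> (d \<odot>\<^bsub>V\<^esub> x)"
    and "\<And>x. x \<in> carrier V \<Longrightarrow> 1 \<odot>\<^bsub>V\<^esub> x = x"
  shows "vectorspace (scalar_ring K) V"
proof -
  interpret field "scalar_ring K" by (rule field_scalar_ring)
  have "module (scalar_ring K) V"
    by (rule Module.moduleI) (use assms is_cring in auto)
  then show ?thesis
    using field_scalar_ring by (simp add: vectorspace_def)
qed

lemma vectorspace_scalar_space: "vectorspace (scalar_ring K) (scalar_space K)"
proof (rule vectorspaceI)
  show "abelian_group (scalar_space K)"
    by (rule abelian_groupI) (auto simp: algebra_simps intro: bexI[of _ "- x" for x])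
qed (auto simp: algebra_simps)

lemma module_hom_iff:
  "f \<in> module_hom (scalar_ring K) V W \<longleftrightarrow>
    (\<forall>x \<in> carrier V. f x \<in> carrier W) \<and>
    (\<forall>x \<in> carrier V. \<forall>y \<in> carrier V. f (x \<oplus>\<^bsub>V\<^esub> y) = f x \<oplus>\<^bsub>W\<^esub> f y) \<and>
    (\<forall>c \<in> K. \<forall>x \<in> carrier V. f (c \<odot>\<^bsub>V\<^esub> x) = c \<odot>\<^bsub>W\<^esub> f x)"
  unfolding module_hom_def by (auto simp: Pi_iff)

lemma linear_map_iff:
  "linear_map (scalar_ring K) V W f \<longleftrightarrow>
    vectorspace (scalar_ring K) V \<and> vectorspace (scalar_ring K) W \<and>
    f \<in> module_hom (scalar_ring K) V W"
  unfolding linear_map_def mod_hom_def mod_hom_axioms_def vectorspace_def by blast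

end

section \<open>Normed spaces and sublinear functionals\<close>

locale scalar_normed_space = scalar_field K + normed_space K X
  for K and X :: "'a nspace" (structure)
begin

lemma vectorspace_X: "vectorspace (scalar_ring K) X"
  by unfold_locales

lemma smult_in [simp, intro]: "c \<in> K \<Longrightarrow> x \<in> carrier X \<Longrightarrow> c \<odot> x \<in> carrier X"
  using smult_closed by simp

lemma smult_rules:
  "c \<in> K \<Longrightarrow> d \<in> K \<Longrightarrow> x \<in> carrier X \<Longrightarrow> (c + d) \<odot> x = c \<odot> x \<oplus> d \<odot> x"
  "c \<in> K \<Longrightarrow> x \<in> carrier X \<Longrightarrow> y \<in> carrier X \<Longrightarrow> c \<odot> (x \<oplus> y) = c \<odot> x \<oplus> c \<odot> y"
  "c \<in> K \<Longrightarrow> d \<in> K \<Longrightarrow> x \<in> carrier X \<Longrightarrow> c \<odot> (d \<odot> x) = (c * d) \<odot> x"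
  "x \<in> carrier X \<Longrightarrow> 1 \<odot> x = x"
  "x \<in> carrier X \<Longrightarrow> 0 \<odot> x = \<zero>"
  "c \<in> K \<Longrightarrow> c \<odot> \<zero> = \<zero>"
  using smult_l_distr[of c d x] smult_r_distr[of c x y] smult_assoc1[of c d x] smult_one[of x]
    smult_l_null[of x] smult_r_null[of c] by simp_all

lemma minus_eq_smult: "x \<in> carrier X \<Longrightarrow> \<ominus> x = (- 1) \<odot> x"
  using smult_rules(1)[of 1 "-1" x] smult_rules(4,5)
  by (metis K_closed(2,5) M.minus_equality M.a_comm smult_in add.right_inverse)

lemma nrm_zero [simp]: "nrm X \<zero> = 0"
  using nrm_eq_0_iff by simp

lemma nrm_minus: "x \<in> carrier X \<Longrightarrow> nrm X (\<ominus> x) = nrm X x"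
  by (simp add: minus_eq_smult nrm_smult)

text \<open>The value 0 off the carrier makes functionals that agree on the carrier equal, so the
  pointwise order and minimality refer to the carrier alone. Only one half of positive homogeneity
  is demanded, which keeps the verification for infima short.\<close>

definition sublinear :: "('a \<Rightarrow> real) \<Rightarrow> bool" where
  "sublinear p \<longleftrightarrow> (\<forall>x. x \<notin> carrier X \<longrightarrow> p x = 0) \<and>
    (\<forall>x \<in> carrier X. \<forall>y \<in> carrier X. p (x \<oplus> y) \<le> p x + p y) \<and>
    (\<forall>t>0. \<forall>x \<in> carrier X. p (of_real t \<odot> x) \<le> t * p x)"

lemma sublinear_outside: "sublinear p \<Longrightarrow> x \<notin> carrier X \<Longrightarrow> p x = 0"
  by (simp add: sublinear_def)

lemma sublinear_add: "sublinear p \<Longrightarrow> x \<in> carrier X \<Longrightarrow> y \<in> carrier X \<Longrightarrow> p (x \<oplus> y) \<le> p x + p y"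
  by (simp add: sublinear_def)

text \<open>The reverse inequality is the assumed one for \<open>inverse t\<close>, applied to
  \<open>t x\<close>.\<close>

lemma sublinear_smult_pos:
  assumes "sublinear p" "x \<in> carrier X" "0 < t"
  shows "p (of_real t \<odot> x) = t * p x"
proof (rule antisym)
  show "p (of_real t \<odot> x) \<le> t * p x"
    using assms by (simp add: sublinear_def)
  have "p (of_real (inverse t) \<odot> (of_real t \<odot> x)) \<le> inverse t * p (of_real t \<odot> x)"
    using assms by (simp add: sublinear_def del: of_real_inverse)
  moreover have "of_real (inverse t) \<odot> (of_real t \<odot> x) = x"
    using assms by (simp add: smult_rules del: of_real_inverse flip: of_real_mult)
  ultimately show "t * p x \<le> p (of_real t \<odot> x)"
    using assms(3) by (simp add: field_simps)
qed

lemma sublinear_zero: "sublinear p \<Longrightarrow> p \<zero> = 0"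
  using sublinear_smult_pos[of p \<zero> 2] smult_rules(6)[of 2] by (metis K_closed(8) M.zero_closed
    mult_2 smult_rules(6) zero_less_numeral add_cancel_right_right)

lemma sublinear_smult:
  "sublinear p \<Longrightarrow> x \<in> carrier X \<Longrightarrow> 0 \<le> t \<Longrightarrow> p (of_real t \<odot> x) = t * p x"
  using sublinear_smult_pos[of p x t] sublinear_zero[of p] smult_rules(5)[of x]
  by (cases "t = 0") auto

text \<open>From \<open>0 = p (x - x)\<close> and subadditivity. This lower bound keeps the
  pointwise infimum of a chain finite.\<close>

lemma sublinear_minus:
  assumes "sublinear p" "x \<in> carrier X"
  shows "- p (\<ominus> x) \<le> p x"
  using sublinear_add[OF assms(1,2), of "\<ominus> x"] assms sublinear_zero[of p]
  by (simp add: M.r_neg)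

text \<open>
  The infimum over \<open>t \<ge> 0\<close> of \<open>p (y + t x) - t p x\<close> is the largest sublinear functional below \<open>p\<close>
  that is linear on the line spanned by \<open>x\<close>; so a minimal sublinear functional is linear.
\<close>

lemma sublinear_shift:
  assumes p: "sublinear p" and x: "x \<in> carrier X"
  obtains q where "sublinear q" "q \<le> p" "\<And>y. y \<in> carrier X \<Longrightarrow> q y \<le> p (y \<oplus> x) - p x"
proof -
  define h where "h y t = p (y \<oplus> of_real t \<odot> x) - t * p x" for y t
  define q where "q y = (if y \<in> carrier X then INF t\<in>{0..}. h y t else 0)" for y
  \<comment> \<open>The bound does not depend on \<open>t\<close>, so the infimum defining
    \<open>q\<close> is finite.\<close>
  have low: "- p (\<ominus> y) \<le> h y t" if "y \<in> carrier X" "0 \<le> t" for y t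
  proof -
    have "t * p x = p (of_real t \<odot> x)"
      using sublinear_smult[OF p x that(2)] by simp
    also have "of_real t \<odot> x = (y \<oplus> of_real t \<odot> x) \<oplus> \<ominus> y"
      using that x by (simp add: M.a_ac M.r_neg2)
    also have "p \<dots> \<le> p (y \<oplus> of_real t \<odot> x) + p (\<ominus> y)"
      using that x by (intro sublinear_add p) auto
    finally show ?thesis by (simp add: h_def)
  qed
  have bdd: "bdd_below (h y ` {0..})" if "y \<in> carrier X" for y
    using low[OF that] by (intro bdd_belowI2[where m = "- p (\<ominus> y)"]) auto
  have q_le: "q y \<le> h y t" if "y \<in> carrier X" "0 \<le> t" for y t
    using that bdd unfolding q_def by (auto intro: cINF_lower)
  have le_q: "c \<le> q y" if "y \<in> carrier X" "\<And>t. 0 \<le> t \<Longrightarrow> c \<le> h y t" for c y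
    using that unfolding q_def by (auto intro: cINF_greatest)
  have "sublinear q"
    unfolding sublinear_def
  proof (intro conjI ballI allI impI)
    fix y z assume yz: "y \<in> carrier X" "z \<in> carrier X"
    \<comment> \<open>The two infima on the right run over independent parameters; their sum
      \<open>s + t\<close> is an admissible parameter for \<open>y + z\<close>.\<close>
    have "q (y \<oplus> z) \<le> h y s + h z t" if st: "0 \<le> s" "0 \<le> t" for s t
    proof -
      have "q (y \<oplus> z) \<le> h (y \<oplus> z) (s + t)"
        using yz st by (intro q_le) auto
      also have "(y \<oplus> z) \<oplus> of_real (s + t) \<odot> x = (y \<oplus> of_real s \<odot> x) \<oplus> (z \<oplus> of_real t \<odot> x)"
        using yz x by (simp add: smult_rules M.a_ac)
      then have "h (y \<oplus> z) (s + t) \<le> h y s + h z t"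
        using sublinear_add[OF p, of "y \<oplus> of_real s \<odot> x" "z \<oplus> of_real t \<odot> x"] yz x
        by (simp add: h_def algebra_simps)
      finally show ?thesis .
    qed
    then have "q (y \<oplus> z) - h y s \<le> q z" if "0 \<le> s" for s
      using that yz by (intro le_q) (auto simp: algebra_simps)
    then have "q (y \<oplus> z) - q z \<le> q y"
      using yz by (intro le_q) (auto simp: algebra_simps)
    then show "q (y \<oplus> z) \<le> q y + q z" by simp
  next
    fix s :: real and y assume sy: "0 < s" "y \<in> carrier X"
    have "q (of_real s \<odot> y) / s \<le> h y t" if t: "0 \<le> t" for t
    proof -
      \<comment> \<open>Scaling \<open>y\<close> by \<open>s\<close> is matched by the parameter
        \<open>s * t\<close>, so that a factor \<open>s\<close> comes out of
        \<open>h\<close>.\<close>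
      have "q (of_real s \<odot> y) \<le> h (of_real s \<odot> y) (s * t)"
        using sy t by (intro q_le) auto
      also have "of_real s \<odot> y \<oplus> of_real (s * t) \<odot> x = of_real s \<odot> (y \<oplus> of_real t \<odot> x)"
        using sy x by (simp add: smult_rules)
      then have "h (of_real s \<odot> y) (s * t) = s * h y t"
        using sublinear_smult_pos[OF p _ sy(1), of "y \<oplus> of_real t \<odot> x"] sy x
        by (simp add: h_def algebra_simps)
      finally show ?thesis using sy by (simp add: field_simps)
    qed
    then have "q (of_real s \<odot> y) / s \<le> q y"
      using sy by (intro le_q) auto
    then show "q (of_real s \<odot> y) \<le> s * q y"
      using sy by (simp add: field_simps)
  qed (simp add: q_def)
  moreover have "q \<le> p"
  proof (rule le_funI)
    fix y show "q y \<le> p y"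
      using q_le[of y 0] x smult_rules(5)[OF x] sublinear_outside[OF p, of y]
      by (cases "y \<in> carrier X") (auto simp: h_def q_def)
  qed
  moreover have "q y \<le> p (y \<oplus> x) - p x" if "y \<in> carrier X" for y
    using q_le[OF that, of 1] smult_rules(4)[OF x] by (simp add: h_def)
  ultimately show ?thesis by (rule that)
qed

text \<open>The pointwise infimum works: of two members of a chain the smaller one serves both
  arguments, which gives subadditivity. The common upper bound \<open>r0\<close> also yields a lower
  bound, through \<open>- p (- y) \<le> p y\<close>.\<close>

lemma sublinear_Inf_chain:
  assumes C: "C \<noteq> {}" "\<And>p. p \<in> C \<Longrightarrow> sublinear p" "\<And>p r. p \<in> C \<Longrightarrow> r \<in> C \<Longrightarrow> p \<le> r \<or> r \<le> p"
    and dom: "\<And>p. p \<in> C \<Longrightarrow> p \<le> r0"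
  obtains q where "sublinear q" "\<And>p. p \<in> C \<Longrightarrow> q \<le> p"
proof -
  define q where "q y = (INF p\<in>C. p y)" for y
  have bdd: "bdd_below ((\<lambda>p. p y) ` C)" for y
  proof (rule bdd_belowI2)
    fix p assume "p \<in> C"
    \<comment> \<open>The 0 accounts for \<open>y\<close> off the carrier, where every
      \<open>p y\<close> is 0.\<close>
    then show "min 0 (- r0 (\<ominus> y)) \<le> p y"
      using sublinear_minus[of p y] C(2) le_funD[OF dom, of p "\<ominus> y"] sublinear_outside[of p y]
      by (cases "y \<in> carrier X") force+
  qed
  have q_le: "q y \<le> p y" if "p \<in> C" for p y
    unfolding q_def using that bdd by (auto intro: cINF_lower)
  have le_q: "c \<le> q y" if "\<And>p. p \<in> C \<Longrightarrow> c \<le> p y" for c y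
    unfolding q_def using that C(1) by (auto intro: cINF_greatest)
  have "sublinear q"
    unfolding sublinear_def
  proof (intro conjI ballI allI impI)
    fix y assume "y \<notin> carrier X"
    then show "q y = 0"
      using C unfolding q_def by (simp add: sublinear_outside)
  next
    fix y z assume yz: "y \<in> carrier X" "z \<in> carrier X"
    have "q (y \<oplus> z) - p y \<le> r z" if pr: "p \<in> C" "r \<in> C" for p r
    proof -
      obtain s where s: "s \<in> C" "s \<le> p" "s \<le> r"
        using C(3)[OF pr] pr by blast
      have "q (y \<oplus> z) \<le> s (y \<oplus> z)" using s by (intro q_le)
      also have "\<dots> \<le> s y + s z" using s C(2) yz by (intro sublinear_add) auto
      also have "\<dots> \<le> p y + r z" using s by (intro add_mono) (auto dest: le_funD)
      finally show ?thesis by simp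
    qed
    then have "q (y \<oplus> z) - p y \<le> q z" if "p \<in> C" for p
      using that by (intro le_q)
    then have "q (y \<oplus> z) - q z \<le> p y" if "p \<in> C" for p
      using that by (simp add: algebra_simps)
    then have "q (y \<oplus> z) - q z \<le> q y"
      by (rule le_q)
    then show "q (y \<oplus> z) \<le> q y + q z" by simp
  next
    fix s :: real and y assume sy: "0 < s" "y \<in> carrier X"
    have "q (of_real s \<odot> y) / s \<le> p y" if "p \<in> C" for p
      using q_le[OF that, of "of_real s \<odot> y"] sublinear_smult_pos[of p y s] that C(2) sy
      by (simp add: field_simps)
    then have "q (of_real s \<odot> y) / s \<le> q y" by (rule le_q)
    then show "q (of_real s \<odot> y) \<le> s * q y"
      using sy by (simp add: field_simps)
  qed
  then show ?thesis using q_le by (intro that) (auto intro: le_funI)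
qed

text \<open>No functional is extended from a subspace. \<open>sublinear_shift\<close> at
  \<open>x\<close> lowers the norm to some \<open>p0\<close> with
  \<open>p0 (- x) \<le> - nrm X x\<close>, and a linear functional below \<open>p0\<close> then
  attains the norm at \<open>x\<close>. A minimal sublinear functional below \<open>p0\<close> is
  linear, since \<open>sublinear_shift\<close> cannot lower it any further.\<close>

lemma real_functional_exists:
  assumes x: "x \<in> carrier X"
  obtains f where "\<And>y z. y \<in> carrier X \<Longrightarrow> z \<in> carrier X \<Longrightarrow> f (y \<oplus> z) = f y + f z"
    "\<And>t y. y \<in> carrier X \<Longrightarrow> f (of_real t \<odot> y) = t * f y"
    "\<And>y. y \<in> carrier X \<Longrightarrow> \<bar>f y\<bar> \<le> nrm X y"
    "nrm X x \<le> f x"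
proof -
  define r where "r y = (if y \<in> carrier X then nrm X y else 0)" for y
  have "sublinear r"
    using nrm_triangle nrm_smult by (auto simp: sublinear_def r_def)
  then obtain p0 where p0: "sublinear p0" "p0 \<le> r"
    "\<And>y. y \<in> carrier X \<Longrightarrow> p0 y \<le> r (y \<oplus> x) - r x"
    using sublinear_shift[OF _ x] by blast
  define S where "S = {p. sublinear p \<and> p \<le> p0}"
  \<comment> \<open>Zorn's lemma yields maximal elements, hence the reversed order.\<close>
  have "\<exists>f \<in> S. \<forall>p \<in> S. p \<le> f \<longrightarrow> p = f"
  proof (rule predicate_Zorn)
    show "partial_order_on S (relation_of (\<lambda>p q. q \<le> p) S)"
      by (intro partial_order_on_relation_ofI) auto
  next
    fix C assume C: "C \<in> Chains (relation_of (\<lambda>p q. q \<le> p) S)"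
    then have CS: "C \<subseteq> S" and lin: "\<And>p q. p \<in> C \<Longrightarrow> q \<in> C \<Longrightarrow> p \<le> q \<or> q \<le> p"
      by (auto simp: Chains_def relation_of_def)
    show "\<exists>u\<in>S. \<forall>p\<in>C. u \<le> p"
    proof (cases "C = {}")
      case True
      then show ?thesis using p0 by (auto simp: S_def)
    next
      case False
      obtain q where "sublinear q" "\<And>p. p \<in> C \<Longrightarrow> q \<le> p"
        using sublinear_Inf_chain[OF False, of p0] CS lin unfolding S_def by blast
      then show ?thesis
        using False CS by (intro bexI[of _ q]) (auto simp: S_def intro: order_trans)
    qed
  qed
  then obtain f where f: "sublinear f" "f \<le> p0" and min: "\<And>p. sublinear p \<Longrightarrow> p \<le> f \<Longrightarrow> p = f"
    unfolding S_def by (auto intro: order_trans)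
  have add: "f (y \<oplus> z) = f y + f z" if yz: "y \<in> carrier X" "z \<in> carrier X" for y z
  proof -
    \<comment> \<open>Minimality forces \<open>q = f\<close>, and the bound on \<open>q\<close>
      turns into superadditivity of \<open>f\<close>.\<close>
    obtain q where "sublinear q" "q \<le> f" "\<And>y. y \<in> carrier X \<Longrightarrow> q y \<le> f (y \<oplus> z) - f z"
      using sublinear_shift[OF f(1) yz(2)] by blast
    with min have "f y \<le> f (y \<oplus> z) - f z"
      using yz by metis
    then show ?thesis
      using sublinear_add[OF f(1) yz] by simp
  qed
  have minus: "f (\<ominus> y) = - f y" if "y \<in> carrier X" for y
    using add[of y "\<ominus> y"] sublinear_zero[OF f(1)] that by (simp add: M.r_neg)
  have smult: "f (of_real t \<odot> y) = t * f y" if y: "y \<in> carrier X" for t y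
  proof (cases "0 \<le> t")
    case False
    have "of_real t \<odot> y = \<ominus> (of_real (- t) \<odot> y)"
      using y by (simp add: minus_eq_smult smult_rules)
    then show ?thesis
      using sublinear_smult[OF f(1) y, of "- t"] minus[of "of_real (- t) \<odot> y"] False y by simp
  qed (use sublinear_smult[OF f(1) y] in auto)
  have le: "f y \<le> nrm X y" if "y \<in> carrier X" for y
    using le_funD[OF order_trans[OF f(2) p0(2)], of y] that by (simp add: r_def)
  have "f (\<ominus> x) \<le> - nrm X x"
    using p0(3)[of "\<ominus> x"] le_funD[OF f(2), of "\<ominus> x"] x by (simp add: r_def M.l_neg)
  moreover have "\<bar>f y\<bar> \<le> nrm X y" if "y \<in> carrier X" for y
    using le[of y] le[of "\<ominus> y"] that minus[of y] nrm_minus[of y] by auto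
  ultimately show ?thesis
    using add smult minus[OF x] by (intro that[of f]) auto
qed

section \<open>Bounded functionals and separation of points\<close>

definition bounded_functional :: "('a \<Rightarrow> complex) \<Rightarrow> bool" where
  "bounded_functional g \<longleftrightarrow>
    g \<in> module_hom (scalar_ring K) X (scalar_space K) \<and>
    (\<exists>C. \<forall>x \<in> carrier X. cmod (g x) \<le> C * nrm X x)"

lemma bounded_functional_zero: "bounded_functional (\<lambda>_. 0)"
  unfolding bounded_functional_def module_hom_iff by (auto intro: exI[of _ 0])

theorem Hahn_Banach_separation:
  assumes x: "x \<in> carrier X" "x \<noteq> \<zero>"
  obtains g where "bounded_functional g" "g x \<noteq> 0"
proof -
  obtain f where add: "\<And>y z. y \<in> carrier X \<Longrightarrow> z \<in> carrier X \<Longrightarrow> f (y \<oplus> z) = f y + f z"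
    and smult: "\<And>t y. y \<in> carrier X \<Longrightarrow> f (of_real t \<odot> y) = t * f y"
    and bound: "\<And>y. y \<in> carrier X \<Longrightarrow> \<bar>f y\<bar> \<le> nrm X y" and fx: "nrm X x \<le> f x"
    using real_functional_exists[OF x(1)] by metis
  have pos: "0 < f x"
    using fx nrm_nonneg[OF x(1)] nrm_eq_0_iff[OF x(1)] x(2) by linarith
  from K show ?thesis
  proof
    assume KR: "K = \<real>"
    have "bounded_functional (\<lambda>y. of_real (f y))"
      unfolding bounded_functional_def module_hom_iff
    proof (intro conjI ballI exI[of _ 1])
      fix c y assume c: "c \<in> K" and y: "y \<in> carrier X"
      obtain t where "c = of_real t"
        using c KR by (auto elim: Reals_cases)
      with y show "of_real (f (c \<odot> y)) = c \<odot>\<^bsub>scalar_space K\<^esub> of_real (f y)"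
        by (simp add: smult)
    qed (use add bound in auto)
    then show ?thesis using that pos by force
  next
    assume KU: "K = UNIV"
    then have in_K [simp]: "d \<in> K" for d
      by simp
    \<comment> \<open>This is the complex linear functional with real part \<open>f\<close>. The
      triangle inequality bounds it with constant 2 instead of the sharp 1; separation asks for
      boundedness only.\<close>
    define g where "g y = of_real (f y) - \<i> * of_real (f (\<i> \<odot> y))" for y
    have "bounded_functional g"
      unfolding bounded_functional_def module_hom_iff
    proof (intro conjI ballI exI[of _ 2])
      fix y z assume "y \<in> carrier X" "z \<in> carrier X"
      then show "g (y \<oplus> z) = g y \<oplus>\<^bsub>scalar_space K\<^esub> g z"
        by (simp add: g_def add smult_rules algebra_simps)
    next
      fix c y assume y: "y \<in> carrier X"
      have f_decomp: "f (d \<odot> y) = Re d * f y + Im d * f (\<i> \<odot> y)" for d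
      proof -
        have "d \<odot> y = of_real (Re d) \<odot> y \<oplus> of_real (Im d) \<odot> (\<i> \<odot> y)"
          using y by (simp add: smult_rules mult.commute flip: smult_rules(1) complex_eq)
        then show ?thesis
          using y by (simp add: add smult)
      qed
      have "f (\<i> \<odot> (c \<odot> y)) = - Im c * f y + Re c * f (\<i> \<odot> y)"
        using y f_decomp[of "\<i> * c"] by (simp add: smult_rules)
      then show "g (c \<odot> y) = c \<odot>\<^bsub>scalar_space K\<^esub> g y"
        using f_decomp[of c] by (simp add: g_def complex_eq_iff algebra_simps)
    next
      fix y assume y: "y \<in> carrier X"
      have "cmod (g y) \<le> \<bar>f y\<bar> + \<bar>f (\<i> \<odot> y)\<bar>"
        unfolding g_def by (rule order_trans[OF norm_triangle_ineq4]) (simp add: norm_mult)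
      also have "\<dots> \<le> nrm X y + nrm X (\<i> \<odot> y)"
        using y by (intro add_mono bound) auto
      also have "\<dots> = 2 * nrm X y"
        using y by (simp add: nrm_smult)
      finally show "cmod (g y) \<le> 2 * nrm X y" .
    qed auto
    moreover have "g x \<noteq> 0"
      using pos by (auto simp: g_def complex_eq_iff)
    ultimately show ?thesis by (rule that)
  qed
qed

end


section \<open>Finite rank operators\<close>

lemma (in scalar_field) module_hom_zero:
  assumes "vectorspace (scalar_ring K) V" "vectorspace (scalar_ring K) W"
    and "f \<in> module_hom (scalar_ring K) V W"
  shows "f \<zero>\<^bsub>V\<^esub> = \<zero>\<^bsub>W\<^esub>"
proof -
  interpret linear_map "scalar_ring K" V W f
    using assms by (simp add: linear_map_iff)
  show ?thesis by (rule f0_is_0)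
qed

context scalar_normed_space
begin

lemma bounded_functional_hom:
  "bounded_functional g \<Longrightarrow> g \<in> module_hom (scalar_ring K) X (scalar_space K)"
  by (simp add: bounded_functional_def)

lemma bounded_functional_in [simp]: "bounded_functional g \<Longrightarrow> x \<in> carrier X \<Longrightarrow> g x \<in> K"
  using bounded_functional_hom by (auto simp: module_hom_iff)

lemma bounded_functional_bound:
  assumes "bounded_functional g"
  obtains C where "0 \<le> C" "\<And>x. x \<in> carrier X \<Longrightarrow> cmod (g x) \<le> C * nrm X x"
proof -
  obtain C where "\<And>x. x \<in> carrier X \<Longrightarrow> cmod (g x) \<le> C * nrm X x"
    using assms by (auto simp: bounded_functional_def)
  then have "cmod (g x) \<le> \<bar>C\<bar> * nrm X x" if "x \<in> carrier X" for x
    using that nrm_nonneg[of x] by (meson abs_ge_self mult_right_mono order_trans)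
  then show ?thesis using that[of "\<bar>C\<bar>"] by simp
qed

text \<open>Finite sums of rank one operators with bounded functionals, generated one summand at a
  time, so that linearity, boundedness and the separation of a coordinate follow by rule
  induction.\<close>

inductive finite_rank :: "('a \<Rightarrow> 'a) \<Rightarrow> bool" where
  zero: "finite_rank (\<lambda>_. \<zero>)"
| step: "finite_rank P \<Longrightarrow> bounded_functional g \<Longrightarrow> e \<in> carrier X \<Longrightarrow>
    finite_rank (\<lambda>y. P y \<oplus> g y \<odot> e)"

lemma finite_rank_hom: "finite_rank P \<Longrightarrow> P \<in> module_hom (scalar_ring K) X X"
proof (induction rule: finite_rank.induct)
  case zero
  show ?case by (auto simp: module_hom_iff smult_rules)
next
  case (step P g e)
  note g = bounded_functional_hom[OF step.hyps(2)]
  show ?case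
    using step.IH g step.hyps(3) by (auto simp: module_hom_iff smult_rules M.a_ac)
qed

lemma finite_rank_bound:
  assumes "finite_rank P"
  shows "\<exists>C\<ge>0. \<forall>x \<in> carrier X. nrm X (P x) \<le> C * nrm X x"
  using assms
proof (induction rule: finite_rank.induct)
  case zero
  show ?case by (auto intro: exI[of _ 0])
next
  case (step P g e)
  obtain C where C: "0 \<le> C" "\<And>x. x \<in> carrier X \<Longrightarrow> nrm X (P x) \<le> C * nrm X x"
    using step.IH by blast
  obtain D where D: "0 \<le> D" "\<And>x. x \<in> carrier X \<Longrightarrow> cmod (g x) \<le> D * nrm X x"
    using bounded_functional_bound[OF step.hyps(2)] by blast
  have "nrm X (P x \<oplus> g x \<odot> e) \<le> (C + D * nrm X e) * nrm X x" if x: "x \<in> carrier X" for x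
  proof -
    have "P x \<in> carrier X"
      using finite_rank_hom[OF step.hyps(1)] x by (auto simp: module_hom_iff)
    then have "nrm X (P x \<oplus> g x \<odot> e) \<le> nrm X (P x) + cmod (g x) * nrm X e"
      using nrm_triangle[of "P x" "g x \<odot> e"] nrm_smult[of "g x" e] step.hyps x by simp
    also have "\<dots> \<le> C * nrm X x + D * nrm X x * nrm X e"
      using C D x step.hyps(3) by (intro add_mono mult_right_mono nrm_nonneg) auto
    finally show ?thesis by (simp add: algebra_simps)
  qed
  moreover have "0 \<le> C + D * nrm X e"
    using C D nrm_nonneg[OF step.hyps(3)] by simp
  ultimately show ?case by blast
qed

text \<open>
  If \<open>P\<close> fixes \<open>A\<close>, then adding to \<open>P\<close> the rank one operator \<open>y \<mapsto> g (y - P y) (x - P x)\<close> with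
  \<open>g (x - P x) = 1\<close> also fixes \<open>x\<close>, and it still fixes \<open>A\<close>.
\<close>

lemma finite_rank_identity_on_finite:
  assumes "finite A" "A \<subseteq> E" and E: "submodule (scalar_ring K) E X"
  obtains P where "finite_rank P" "\<And>x. x \<in> carrier X \<Longrightarrow> P x \<in> E" "\<And>a. a \<in> A \<Longrightarrow> P a = a"
proof -
  interpret E: submodule "scalar_ring K" E X by (rule E)
  have sub: "x \<in> E \<Longrightarrow> x \<in> carrier X" for x
    using E.subset by auto
  have "\<exists>P. finite_rank P \<and> (\<forall>x \<in> carrier X. P x \<in> E) \<and> (\<forall>a \<in> A. P a = a)"
    using assms(1,2)
  proof induction
    case empty
    show ?case
      using zero by (intro exI[of _ "\<lambda>_. \<zero>"]) auto
  next
    case (insert x A)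
    then obtain P where P: "finite_rank P" "\<forall>x \<in> carrier X. P x \<in> E" "\<forall>a \<in> A. P a = a"
      by auto
    note hom = finite_rank_hom[OF P(1), unfolded module_hom_iff]
    \<comment> \<open>The identity minus \<open>P\<close>: it vanishes exactly at the fixed points
      of \<open>P\<close>, in particular on \<open>A\<close>.\<close>
    define D where "D y = y \<oplus> (-1) \<odot> P y" for y
    have x: "x \<in> E" "x \<in> carrier X"
      using insert sub by auto
    have D_in: "D y \<in> carrier X" if "y \<in> carrier X" for y
      using that hom by (auto simp: D_def)
    have DxE: "D x \<in> E"
      using x P unfolding D_def by auto
    have D_fix: "D y = \<zero> \<longleftrightarrow> P y = y" if y: "y \<in> carrier X" for y
    proof -
      have Dy: "D y = y \<oplus> \<ominus> P y" and Py: "P y \<in> carrier X"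
        using y hom by (auto simp: D_def minus_eq_smult)
      have "D y \<oplus> P y = y"
        using y Py by (simp add: Dy M.a_assoc M.l_neg)
      then show ?thesis using y Py Dy by (metis M.l_zero M.r_neg)
    qed
    show ?case
    proof (cases "D x = \<zero>")
      case True
      then show ?thesis using P D_fix x by (intro exI[of _ P]) auto
    next
      case False
      then obtain g where g: "bounded_functional g" "g (D x) \<noteq> 0"
        using Hahn_Banach_separation[OF D_in[OF x(2)]] by blast
      obtain C where C: "0 \<le> C" "\<And>x. x \<in> carrier X \<Longrightarrow> cmod (g x) \<le> C * nrm X x"
        using bounded_functional_bound[OF g(1)] by blast
      obtain B where B: "0 \<le> B" "\<And>x. x \<in> carrier X \<Longrightarrow> nrm X (P x) \<le> B * nrm X x"
        using finite_rank_bound[OF P(1)] by blast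
      note ghom = bounded_functional_hom[OF g(1), unfolded module_hom_iff]
      have Dhom: "D \<in> module_hom (scalar_ring K) X X"
        using hom by (auto simp: module_hom_iff D_def smult_rules M.a_ac mult.commute)
      \<comment> \<open>Normalised to \<open>h x = 1\<close>; on \<open>A\<close> it is 0 because
        \<open>D\<close> is. The values of the corrected operator stay in \<open>E\<close> because
        \<open>D x\<close> lies there.\<close>
      define h where "h y = inverse (g (D x)) * g (D y)" for y
      have "bounded_functional h"
        unfolding bounded_functional_def
      proof (intro conjI exI ballI)
        show "h \<in> module_hom (scalar_ring K) X (scalar_space K)"
          using ghom Dhom x D_in by (auto simp: module_hom_iff h_def algebra_simps)
      next
        fix y assume y: "y \<in> carrier X"
        have "nrm X (D y) \<le> nrm X y + nrm X (P y)"
          using nrm_triangle[of y "(-1) \<odot> P y"] nrm_smult[of "-1" "P y"] y hom by (simp add: D_def)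
        also have "\<dots> \<le> (1 + B) * nrm X y"
          using B(2)[OF y] by (simp add: algebra_simps)
        finally have "cmod (g (D y)) \<le> C * ((1 + B) * nrm X y)"
          using C(2)[OF D_in[OF y]] C(1) by (meson mult_left_mono order_trans)
        then have "cmod (h y) \<le> cmod (inverse (g (D x))) * (C * ((1 + B) * nrm X y))"
          by (simp add: h_def norm_mult mult_left_mono del: norm_inverse)
        then show "cmod (h y) \<le> (cmod (inverse (g (D x))) * C * (1 + B)) * nrm X y"
          by (simp only: mult.assoc)
      qed
      then have "finite_rank (\<lambda>y. P y \<oplus> h y \<odot> D x)"
        by (intro finite_rank.step P(1) D_in x)
      moreover have "P y \<oplus> h y \<odot> D x \<in> E" if "y \<in> carrier X" for y
        using that P(2) DxE \<open>bounded_functional h\<close> by auto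
      moreover have "P a \<oplus> h a \<odot> D x = a" if "a \<in> A" for a
      proof -
        have "a \<in> carrier X" using that insert.prems sub by auto
        moreover from this have "D a = \<zero>" using D_fix P(3) that by auto
        moreover have "g \<zero> = 0"
          using module_hom_zero[OF vectorspace_X vectorspace_scalar_space bounded_functional_hom[OF g(1)]]
          by simp
        ultimately show ?thesis
          using P(3) that D_in x by (simp add: h_def smult_rules)
      qed
      moreover have "P x \<oplus> h x \<odot> D x = x"
      proof -
        have Px: "P x \<in> carrier X" using hom x by auto
        have "P x \<oplus> h x \<odot> D x = P x \<oplus> (x \<oplus> \<ominus> P x)"
          using g(2) D_in x Px by (simp add: h_def smult_rules) (simp add: D_def minus_eq_smult)
        also have "\<dots> = x"
          using x Px by (simp add: M.a_ac M.r_neg2 M.r_neg)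
        finally show ?thesis .
      qed
      ultimately show ?thesis
        by (intro exI[of _ "\<lambda>y. P y \<oplus> h y \<odot> D x"]) auto
    qed
  qed
  then show ?thesis using that by blast
qed

text \<open>Trades an arbitrary linear dependence on the vectors \<open>x k\<close> for a bounded
  functional; the maps \<open>\<Phi> k\<close> may be unbounded. An operator \<open>P\<close> of
  finite rank that fixes every \<open>x k\<close> leaves the sum unchanged, and expanding
  \<open>P\<close> into its rank one terms splits the sum into pieces of the asserted form, one of
  which is nonzero.\<close>

lemma separate_coordinate:
  fixes x :: "nat \<Rightarrow> 'a" and \<Phi> :: "nat \<Rightarrow> 'a \<Rightarrow> complex"
  assumes x: "\<And>k. k < m \<Longrightarrow> x k \<in> carrier X"
    and \<Phi>: "\<And>k. k < m \<Longrightarrow> \<Phi> k \<in> module_hom (scalar_ring K) X (scalar_space K)"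
    and nz: "(\<Sum>k<m. \<Phi> k (x k)) \<noteq> 0"
  obtains g e where "bounded_functional g" "e \<in> carrier X" "(\<Sum>k<m. g (x k) * \<Phi> k e) \<noteq> 0"
proof -
  have "submodule (scalar_ring K) (carrier X) X"
    using vectorspace_X by (auto simp: submodule_def vectorspace_def)
  moreover have "x ` {..<m} \<subseteq> carrier X"
    using x by auto
  ultimately obtain P where P: "finite_rank P" "\<And>a. a \<in> x ` {..<m} \<Longrightarrow> P a = a"
    using finite_rank_identity_on_finite[of "x ` {..<m}" "carrier X"] by (metis finite_imageI finite_lessThan)
  have "(\<Sum>k<m. \<Phi> k (P (x k))) \<noteq> 0"
    using nz P(2) by simp
  with P(1) have "\<exists>g e. bounded_functional g \<and> e \<in> carrier X \<and> (\<Sum>k<m. g (x k) * \<Phi> k e) \<noteq> 0"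
  proof (induction rule: finite_rank.induct)
    case zero
    moreover have "\<Phi> k \<zero> = 0" if "k < m" for k
      using module_hom_zero[OF vectorspace_X vectorspace_scalar_space \<Phi>[OF that]] by simp
    ultimately show ?case by simp
  next
    case (step P g e)
    have "\<Phi> k (P (x k) \<oplus> g (x k) \<odot> e) = \<Phi> k (P (x k)) + g (x k) * \<Phi> k e" if "k < m" for k
      using \<Phi>[OF that] x[OF that] finite_rank_hom[OF step.hyps(1)] step.hyps(2,3)
      by (auto simp: module_hom_iff)
    then have "(\<Sum>k<m. \<Phi> k (P (x k))) + (\<Sum>k<m. g (x k) * \<Phi> k e) \<noteq> 0"
      using step.prems by (simp add: sum.distrib)
    then show ?case
      using step by (cases "(\<Sum>k<m. \<Phi> k (P (x k))) = 0") auto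
  qed
  then show ?thesis using that by blast
qed

end


section \<open>The projective tensor product\<close>

lemma fun_sum_apply: "(\<Sum>k\<in>A. f k) x = (\<Sum>k\<in>A. f k x)"
  by (induction A rule: infinite_finite_induct) auto

text \<open>Carriers of tensor products are linear hulls of sets closed under scalars. Coefficients
  can then be absorbed into the generators, and finite sums without coefficients come with an
  induction rule.\<close>

inductive_set finite_sums :: "'v::comm_monoid_add set \<Rightarrow> 'v set" for A where
  zero: "0 \<in> finite_sums A"
| add: "u \<in> finite_sums A \<Longrightarrow> a \<in> A \<Longrightarrow> u + a \<in> finite_sums A"

lemma finite_sums_base: "a \<in> A \<Longrightarrow> a \<in> finite_sums A"
  using finite_sums.add[OF finite_sums.zero, of a A] by simp

lemma finite_sums_plus: "u \<in> finite_sums A \<Longrightarrow> v \<in> finite_sums A \<Longrightarrow> u + v \<in> finite_sums A"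
  by (rotate_tac, induction v rule: finite_sums.induct)
    (auto simp flip: add.assoc intro: finite_sums.add)

lemma finite_sums_sum: "(\<And>i. i \<in> I \<Longrightarrow> f i \<in> finite_sums A) \<Longrightarrow> sum f I \<in> finite_sums A"
  by (induction I rule: infinite_finite_induct) (auto intro: finite_sums.zero finite_sums_plus)

lemma finite_sums_iff:
  "u \<in> finite_sums A \<longleftrightarrow> (\<exists>(m::nat) a. (\<forall>k<m. a k \<in> A) \<and> u = (\<Sum>k<m. a k))"
proof
  assume "u \<in> finite_sums A"
  then show "\<exists>(m::nat) a. (\<forall>k<m. a k \<in> A) \<and> u = (\<Sum>k<m. a k)"
  proof induction
    case zero
    show ?case by (rule exI[of _ 0]) simp
  next
    case (add u a)
    then obtain m f where f: "\<forall>k<m. f k \<in> A" "u = (\<Sum>k<m::nat. f k)" by blast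
    then have "(\<Sum>k<Suc m. (f(m := a)) k) = u + a" by simp
    with f add.hyps(2) show ?case
      by (intro exI[of _ "Suc m"] exI[of _ "f(m := a)"]) auto
  qed
qed (elim exE conjE, simp, rule finite_sums_sum, simp add: finite_sums_base)

lemma fun_nspace_simps [simp]:
  "carrier (fun_nspace S N) = S" "zero (fun_nspace S N) = 0" "add (fun_nspace S N) = (+)"
  "smult (fun_nspace S N) = (\<lambda>c u \<phi>. c * u \<phi>)" "nrm (fun_nspace S N) = N"
  by (auto simp: fun_nspace_def)

context scalar_field
begin

lemma finite_sums_smult:
  assumes "\<And>a. a \<in> A \<Longrightarrow> (\<lambda>\<phi>. c * a \<phi>) \<in> finite_sums A" and "u \<in> finite_sums A"
  shows "(\<lambda>\<phi>. c * u \<phi> :: complex) \<in> finite_sums A"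
  using assms(2)
proof induction
  case zero
  show ?case using finite_sums.zero[of A] by (simp add: zero_fun_def)
next
  case (add u a)
  have "(\<lambda>\<phi>. c * (u + a) \<phi>) = (\<lambda>\<phi>. c * u \<phi>) + (\<lambda>\<phi>. c * a \<phi>)"
    by (auto simp: algebra_simps)
  then show ?case using add assms(1) by (simp add: finite_sums_plus)
qed

lemma lin_hull_eq_finite_sums:
  assumes "\<And>c a. c \<in> K \<Longrightarrow> a \<in> A \<Longrightarrow> (\<lambda>\<phi>. c * a \<phi>) \<in> finite_sums A"
  shows "lin_hull K A = finite_sums A"
proof (intro equalityI subsetI)
  fix u assume "u \<in> lin_hull K A"
  then show "u \<in> finite_sums A"
    using assms unfolding lin_hull_def by (auto intro!: finite_sums_sum)
next
  fix u assume "u \<in> finite_sums A"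
  then obtain m a where "\<forall>k<m. a k \<in> A" "u = (\<Sum>k<m::nat. a k)"
    unfolding finite_sums_iff by blast
  then show "u \<in> lin_hull K A"
    unfolding lin_hull_def
    by (auto intro!: exI[of _ m] exI[of _ "\<lambda>_. 1"] exI[of _ a])
qed

lemma vectorspace_finite_sums:
  assumes "\<And>c a. c \<in> K \<Longrightarrow> a \<in> A \<Longrightarrow> (\<lambda>\<phi>. c * a \<phi>) \<in> finite_sums A"
  shows "vectorspace (scalar_ring K) (fun_nspace (finite_sums A) N)"
proof (rule vectorspaceI)
  have smult: "(\<lambda>\<phi>. c * u \<phi>) \<in> finite_sums A" if "c \<in> K" "u \<in> finite_sums A" for c u
    using assms[OF that(1)] that(2) by (rule finite_sums_smult)
  show "abelian_group (fun_nspace (finite_sums A) N)"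
  proof (rule abelian_groupI)
    fix u assume u: "u \<in> carrier (fun_nspace (finite_sums A) N)"
    have "(\<lambda>\<phi>. (- 1) * u \<phi>) \<in> finite_sums A"
      using u by (intro smult) auto
    then show "\<exists>v \<in> carrier (fun_nspace (finite_sums A) N).
        v \<oplus>\<^bsub>fun_nspace (finite_sums A) N\<^esub> u = \<zero>\<^bsub>fun_nspace (finite_sums A) N\<^esub>"
      by (intro bexI[of _ "\<lambda>\<phi>. (- 1) * u \<phi>"]) auto
  qed (auto simp: algebra_simps intro: finite_sums_plus finite_sums.zero)
  fix c u assume "c \<in> K" "u \<in> carrier (fun_nspace (finite_sums A) N)"
  then show "c \<odot>\<^bsub>fun_nspace (finite_sums A) N\<^esub> u \<in> carrier (fun_nspace (finite_sums A) N)"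
    using smult by simp
qed (auto simp: algebra_simps fun_eq_iff)

lemma normed_scalar_space: "normed_space K (scalar_space K)"
  using vectorspace_scalar_space
  by (auto simp: normed_space_def normed_space_axioms_def norm_mult norm_triangle_ineq)

text \<open>Estimates against an infimum \<open>a\<close> are made with a representation whose cost
  lies below an arbitrary \<open>c > a\<close>; this returns to \<open>a\<close> itself.\<close>

lemma le_mult_of_gt:
  fixes z M a :: real
  assumes "\<And>c. a < c \<Longrightarrow> z \<le> M * c" "0 \<le> M"
  shows "z \<le> M * a"
proof (rule field_le_epsilon)
  fix e :: real assume e: "0 < e"
  \<comment> \<open>The denominator is \<open>M + 1\<close> because \<open>M\<close> may be
    0.\<close>
  define d where "d = e / (M + 1)"
  have "0 < d" using e assms(2) by (simp add: d_def)
  then have "z \<le> M * (a + d)" by (intro assms(1)) auto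
  also have "M * d \<le> e"
    using e assms(2) by (simp add: d_def field_simps)
  then have "M * (a + d) \<le> M * a + e" by (simp add: algebra_simps)
  finally show "z \<le> M * a + e" .
qed

end

lemma sum_concat:
  fixes m1 m2 :: nat
  shows "(\<Sum>k<m1 + m2. h k) = (\<Sum>k<m1. h k) + (\<Sum>k<m2. h (m1 + k))"
  by (induction m2) (auto simp: add.assoc)

section \<open>Multilinear maps on a finite family of normed spaces\<close>

locale tensor_factors = scalar_field K for K +
  fixes X :: "'i::finite \<Rightarrow> 'a nspace"
  assumes normed_X: "\<And>i. normed_space K (X i)"
begin

lemma factor: "scalar_normed_space K (X i)"
  using scalar_field_axioms normed_X by (simp add: scalar_normed_space_def)

lemma factor_vs: "vectorspace (scalar_ring K) (X i)"
  using scalar_normed_space.vectorspace_X[OF factor] .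

lemma nrm_X_nonneg: "x \<in> tuples X \<Longrightarrow> 0 \<le> nrm (X i) (x i)"
  using normed_space.nrm_nonneg[OF normed_X] by (auto simp: tuples_def)

lemma prod_nrm_nonneg: "x \<in> tuples X \<Longrightarrow> 0 \<le> (\<Prod>i\<in>UNIV. nrm (X i) (x i))"
  by (simp add: prod_nonneg nrm_X_nonneg)

lemma tuples_in: "x \<in> tuples X \<Longrightarrow> x i \<in> carrier (X i)"
  by (simp add: tuples_def)

lemma tuples_upd: "x \<in> tuples X \<Longrightarrow> t \<in> carrier (X i) \<Longrightarrow> x(i := t) \<in> tuples X"
  by (auto simp: tuples_def)

lemma tuples_zero: "(\<lambda>i. \<zero>\<^bsub>X i\<^esub>) \<in> tuples X"
proof -
  have "\<zero>\<^bsub>X i\<^esub> \<in> carrier (X i)" for i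
  proof -
    interpret scalar_normed_space K "X i" by (rule factor)
    show ?thesis by (rule M.zero_closed)
  qed
  then show ?thesis by (simp add: tuples_def)
qed

lemma tuples_smult: "x \<in> tuples X \<Longrightarrow> (\<And>i. c i \<in> K) \<Longrightarrow> (\<lambda>i. c i \<odot>\<^bsub>X i\<^esub> x i) \<in> tuples X"
  using scalar_normed_space.smult_in[OF factor] by (auto simp: tuples_def)

lemma multilinear_iff:
  assumes "vectorspace (scalar_ring K) V"
  shows "multilinear K X V R \<longleftrightarrow>
    (\<forall>x \<in> tuples X. \<forall>i. (\<lambda>t. R (x(i := t))) \<in> module_hom (scalar_ring K) (X i) V)"
  unfolding multilinear_def linear_map_iff using assms factor_vs by auto

lemma multilinear_hom:
  "multilinear K X V R \<Longrightarrow> x \<in> tuples X \<Longrightarrow>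
    (\<lambda>t. R (x(i := t))) \<in> module_hom (scalar_ring K) (X i) V"
  unfolding multilinear_def linear_map_iff by auto

lemma multilinear_in: "multilinear K X V R \<Longrightarrow> x \<in> tuples X \<Longrightarrow> R x \<in> carrier V"
  using multilinear_hom[of V R x undefined] tuples_in[of x undefined]
  by (auto simp: module_hom_iff dest: bspec[of _ _ "x undefined"])

text \<open>The scalars come out one coordinate at a time, by induction on the set of coordinates
  already scaled.\<close>

lemma multilinear_smult:
  assumes R: "multilinear K X V R" and V: "vectorspace (scalar_ring K) V"
    and x: "x \<in> tuples X" and c: "\<And>i. c i \<in> K"
  shows "R (\<lambda>i. c i \<odot>\<^bsub>X i\<^esub> x i) = (\<Prod>i\<in>UNIV. c i) \<odot>\<^bsub>V\<^esub> R x"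
proof -
  interpret V: vectorspace "scalar_ring K" V by (rule V)
  have "R (\<lambda>i. if i \<in> I then c i \<odot>\<^bsub>X i\<^esub> x i else x i) = (\<Prod>i\<in>I. c i) \<odot>\<^bsub>V\<^esub> R x"
    if "finite I" for I
    using that
  proof induction
    case empty
    show ?case using V.smult_one[OF multilinear_in[OF R x]] by simp
  next
    case (insert j I)
    define y where "y = (\<lambda>i. if i \<in> I then c i \<odot>\<^bsub>X i\<^esub> x i else x i)"
    have y: "y \<in> tuples X"
      using x c scalar_normed_space.smult_in[OF factor] by (auto simp: tuples_def y_def)
    have "(\<lambda>i. if i \<in> insert j I then c i \<odot>\<^bsub>X i\<^esub> x i else x i) = y(j := c j \<odot>\<^bsub>X j\<^esub> x j)"
      by (auto simp: y_def)
    then have "R (\<lambda>i. if i \<in> insert j I then c i \<odot>\<^bsub>X i\<^esub> x i else x i) = R (y(j := c j \<odot>\<^bsub>X j\<^esub> x j))"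
      by simp
    also have "\<dots> = c j \<odot>\<^bsub>V\<^esub> R (y(j := x j))"
      using multilinear_hom[OF R y, of j] c tuples_in[OF x] by (auto simp: module_hom_iff)
    also have "y(j := x j) = y" using insert by (auto simp: y_def)
    also have "R y = (\<Prod>i\<in>I. c i) \<odot>\<^bsub>V\<^esub> R x" using insert by (simp add: y_def)
    also have "c j \<odot>\<^bsub>V\<^esub> ((\<Prod>i\<in>I. c i) \<odot>\<^bsub>V\<^esub> R x) = (c j * (\<Prod>i\<in>I. c i)) \<odot>\<^bsub>V\<^esub> R x"
      using V.smult_assoc1[of "c j" "\<Prod>i\<in>I. c i" "R x"] c multilinear_in[OF R x] K_prod[of I c] by simp
    finally show ?case using insert by simp
  qed
  from this[of UNIV, OF finite] show ?thesis by simp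
qed

lemma multilinear_zero_coordinate:
  assumes R: "multilinear K X V R" and V: "vectorspace (scalar_ring K) V"
    and x: "x \<in> tuples X" and i: "x i = \<zero>\<^bsub>X i\<^esub>"
  shows "R x = \<zero>\<^bsub>V\<^esub>"
  using module_hom_zero[OF factor_vs V multilinear_hom[OF R x, of i]]
  by (simp flip: i)

lemma unit_image_nonempty:
  "nrm V (R (\<lambda>i. \<zero>\<^bsub>X i\<^esub>)) \<in> unit_image X V R"
  unfolding unit_image_def
  using tuples_zero scalar_normed_space.nrm_zero[OF factor]
  by (auto intro!: exI[of _ "\<lambda>i. \<zero>\<^bsub>X i\<^esub>"])

lemma multi_norm_nonneg:
  assumes R: "bounded_multilinear K X V R" and V: "normed_space K V"
  shows "0 \<le> multi_norm X V R"
proof -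
  have "0 \<le> nrm V (R (\<lambda>i. \<zero>\<^bsub>X i\<^esub>))"
    using normed_space.nrm_nonneg[OF V] multilinear_in tuples_zero R
    by (auto simp: bounded_multilinear_def)
  also have "\<dots> \<le> multi_norm X V R"
    unfolding multi_norm_def
    using R unit_image_nonempty by (auto simp: bounded_multilinear_def intro: cSup_upper)
  finally show ?thesis .
qed

text \<open>If some coordinate is zero, then so is \<open>R x\<close>. Otherwise dividing each
  coordinate by its norm gives a tuple that competes in the supremum, and the divisors come out by
  homogeneity.\<close>

lemma multi_norm_bound:
  assumes R: "bounded_multilinear K X V R" and V: "normed_space K V" and x: "x \<in> tuples X"
  shows "nrm V (R x) \<le> multi_norm X V R * (\<Prod>i\<in>UNIV. nrm (X i) (x i))"
proof -
  interpret V: scalar_normed_space K V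
    using scalar_field_axioms V by (simp add: scalar_normed_space_def)
  have ml: "multilinear K X V R" using R by (simp add: bounded_multilinear_def)
  show ?thesis
  proof (cases "\<exists>i. x i = \<zero>\<^bsub>X i\<^esub>")
    case True
    then have "R x = \<zero>\<^bsub>V\<^esub>"
      using multilinear_zero_coordinate[OF ml V.vectorspace_X x] by blast
    then show ?thesis
      using multi_norm_nonneg[OF R V] prod_nrm_nonneg[OF x] by simp
  next
    case False
    define n where "n i = nrm (X i) (x i)" for i
    have pos: "0 < n i" for i
      using False nrm_X_nonneg[OF x, of i] normed_space.nrm_eq_0_iff[OF normed_X tuples_in[OF x]]
      by (auto simp: n_def less_le)
    define y where "y = (\<lambda>i. complex_of_real (inverse (n i)) \<odot>\<^bsub>X i\<^esub> x i)"
    have y: "y \<in> tuples X" unfolding y_def by (intro tuples_smult x) auto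
    have "nrm (X i) (y i) = 1" for i
      using normed_space.nrm_smult[OF normed_X, of "complex_of_real (inverse (n i))" "x i" i]
        tuples_in[OF x] pos[of i]
      by (simp add: y_def norm_divide norm_inverse n_def del: of_real_inverse)
    then have "nrm V (R y) \<le> multi_norm X V R"
      unfolding multi_norm_def using R y
      by (intro cSup_upper) (auto simp: bounded_multilinear_def unit_image_def)
    moreover have "R y = complex_of_real (\<Prod>i\<in>UNIV. inverse (n i)) \<odot>\<^bsub>V\<^esub> R x"
      using multilinear_smult[OF ml V.vectorspace_X x, of "\<lambda>i. complex_of_real (inverse (n i))"]
      by (simp add: y_def del: of_real_inverse)
    moreover have "0 < (\<Prod>i\<in>UNIV. inverse (n i))" using pos by (intro prod_pos) auto
    ultimately have "(\<Prod>i\<in>UNIV. inverse (n i)) * nrm V (R x) \<le> multi_norm X V R"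
      using V.nrm_smult[OF _ multilinear_in[OF ml x], of "complex_of_real (\<Prod>i\<in>UNIV. inverse (n i))"]
      by (simp del: of_real_prod of_real_inverse)
    moreover have "(\<Prod>i\<in>UNIV. inverse (n i)) = inverse (\<Prod>i\<in>UNIV. n i)"
      using prod_inversef[of n UNIV] by (simp add: o_def)
    moreover have "0 < (\<Prod>i\<in>UNIV. n i)" using pos by (intro prod_pos) auto
    ultimately show ?thesis
      by (simp add: field_simps flip: n_def)
  qed
qed

lemma bounded_multilinearI:
  assumes "multilinear K X V R"
    and "\<And>x. x \<in> tuples X \<Longrightarrow> nrm V (R x) \<le> M * (\<Prod>i\<in>UNIV. nrm (X i) (x i))"
  shows "bounded_multilinear K X V R"
  unfolding bounded_multilinear_def
proof
  \<comment> \<open>The constant \<open>M\<close> may be negative, so the bound on the unit ball is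
    its absolute value.\<close>
  have "nrm V (R x) \<le> \<bar>M\<bar>" if x: "x \<in> tuples X" "\<forall>i. nrm (X i) (x i) \<le> 1" for x
  proof -
    have "nrm V (R x) \<le> M * (\<Prod>i\<in>UNIV. nrm (X i) (x i))" by (rule assms(2)[OF x(1)])
    also have "\<dots> \<le> \<bar>M\<bar> * 1"
      using x nrm_X_nonneg[OF x(1)] by (intro mult_mono prod_le_1 prod_nonneg) auto
    finally show ?thesis by simp
  qed
  then show "bdd_above (unit_image X V R)"
    by (auto simp: unit_image_def intro!: bdd_aboveI[of _ "\<bar>M\<bar>"])
qed fact

section \<open>Tensors as evaluations at multilinear forms\<close>

lemma mforms_iff:
  "\<phi> \<in> mforms K X \<longleftrightarrow> (\<forall>x \<in> tuples X. \<forall>i.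
    (\<lambda>t. \<phi> (x(i := t))) \<in> module_hom (scalar_ring K) (X i) (scalar_space K))"
  using multilinear_iff[OF vectorspace_scalar_space] by (simp add: mforms_def)

lemma mforms_in: "\<phi> \<in> mforms K X \<Longrightarrow> x \<in> tuples X \<Longrightarrow> \<phi> x \<in> K"
  using multilinear_in[of "scalar_space K" \<phi> x] by (simp add: mforms_def)

lemma etens_apply: "etens K X x \<phi> = (if \<phi> \<in> mforms K X then \<phi> x else 0)"
  by (simp add: etens_def ev_def)

lemma etens_smult:
  "x \<in> tuples X \<Longrightarrow> c \<in> K \<Longrightarrow>
    etens K X (x(i := c \<odot>\<^bsub>X i\<^esub> x i)) = (\<lambda>\<phi>. c * etens K X x \<phi>)"
  using tuples_in[of x i] by (auto simp: fun_eq_iff etens_apply mforms_iff module_hom_iff)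

lemma decomp_smult:
  assumes "c \<in> K" "p \<in> decomp K X"
  shows "(\<lambda>\<phi>. c * p \<phi>) \<in> decomp K X"
proof -
  obtain x where x: "x \<in> tuples X" "p = etens K X x"
    using assms by (auto simp: decomp_def)
  \<comment> \<open>Any single coordinate can absorb the scalar; index types are inhabited, so
    \<open>undefined\<close> names one.\<close>
  define i :: 'i where "i = undefined"
  have "(\<lambda>\<phi>. c * p \<phi>) = etens K X (x(i := c \<odot>\<^bsub>X i\<^esub> x i))"
    using etens_smult[OF x(1) assms(1), of i] x(2) by simp
  moreover have "x(i := c \<odot>\<^bsub>X i\<^esub> x i) \<in> tuples X"
    using x assms scalar_normed_space.smult_in[OF factor] by (intro tuples_upd) (auto simp: tuples_in)
  ultimately show ?thesis by (auto simp: decomp_def)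
qed

lemma zero_decomp: "0 \<in> decomp K X"
proof -
  have "etens K X (\<lambda>i. \<zero>\<^bsub>X i\<^esub>) \<in> decomp K X" using tuples_zero by (auto simp: decomp_def)
  from decomp_smult[OF K_closed(1) this] show ?thesis by (simp add: zero_fun_def)
qed

lemma ptensor_eq: "ptensor K X = fun_nspace (finite_sums (decomp K X)) (proj_norm K X)"
  unfolding ptensor_def
  by (subst lin_hull_eq_finite_sums) (auto intro: finite_sums_base decomp_smult)

lemma ptensor_simps [simp]:
  "carrier (ptensor K X) = finite_sums (decomp K X)" "zero (ptensor K X) = 0"
  "add (ptensor K X) = (+)" "smult (ptensor K X) = (\<lambda>c u \<phi>. c * u \<phi>)"
  "nrm (ptensor K X) = proj_norm K X"
  by (simp_all add: ptensor_eq)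

lemma vectorspace_ptensor: "vectorspace (scalar_ring K) (ptensor K X)"
  unfolding ptensor_eq by (rule vectorspace_finite_sums) (auto intro: finite_sums_base decomp_smult)

lemma ptensor_smult_in:
  "c \<in> K \<Longrightarrow> u \<in> finite_sums (decomp K X) \<Longrightarrow> (\<lambda>\<phi>. c * u \<phi>) \<in> finite_sums (decomp K X)"
  by (rule finite_sums_smult) (simp_all add: finite_sums_base decomp_smult)

lemma ptensor_diff_in:
  assumes "u \<in> finite_sums (decomp K X)" "v \<in> finite_sums (decomp K X)"
  shows "u - v \<in> finite_sums (decomp K X)"
proof -
  have "u - v = u + (\<lambda>\<phi>. (- 1) * v \<phi>)" by (auto simp: fun_eq_iff)
  also have "\<dots> \<in> finite_sums (decomp K X)"
    using assms by (intro finite_sums_plus ptensor_smult_in) auto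
  finally show ?thesis .
qed

lemma decomp_diff_in: "p \<in> decomp K X \<Longrightarrow> q \<in> decomp K X \<Longrightarrow> p - q \<in> finite_sums (decomp K X)"
  by (simp add: ptensor_diff_in finite_sums_base)

lemma etens_in [intro]: "x \<in> tuples X \<Longrightarrow> etens K X x \<in> decomp K X"
  by (simp add: decomp_def)

lemma ptensor_sumE:
  assumes "u \<in> finite_sums (decomp K X)"
  obtains m :: nat and x where "\<forall>k<m. x k \<in> tuples X" "u = (\<Sum>k<m. etens K X (x k))"
proof -
  obtain m a where a: "\<forall>k<m. a k \<in> decomp K X" "u = (\<Sum>k<m::nat. a k)"
    using finite_sums_iff[THEN iffD1, OF assms] by (elim exE conjE)
  have "\<forall>k. \<exists>x. k < m \<longrightarrow> x \<in> tuples X \<and> a k = etens K X x"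
    using a(1) unfolding decomp_def by blast
  then obtain x where "\<forall>k<m. x k \<in> tuples X \<and> a k = etens K X (x k)"
    by metis
  then show ?thesis
    by (intro that[of m x]) (simp_all add: a(2))
qed

text \<open>An elementary tensor is evaluation at forms, so this is multilinearity of each form,
  read pointwise.\<close>

lemma multilinear_etens: "multilinear K X (ptensor K X) (etens K X)"
  unfolding multilinear_iff[OF vectorspace_ptensor]
proof (intro ballI allI)
  fix x i assume x: "x \<in> tuples X"
  have *: "\<phi> (x(i := s \<oplus>\<^bsub>X i\<^esub> t)) = \<phi> (x(i := s)) + \<phi> (x(i := t))"
    "c \<in> K \<Longrightarrow> \<phi> (x(i := c \<odot>\<^bsub>X i\<^esub> t)) = c * \<phi> (x(i := t))"
    if "\<phi> \<in> mforms K X" "s \<in> carrier (X i)" "t \<in> carrier (X i)" for s t c \<phi>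
    using that x by (auto simp: mforms_iff module_hom_iff)
  show "(\<lambda>t. etens K X (x(i := t))) \<in> module_hom (scalar_ring K) (X i) (ptensor K X)"
    unfolding module_hom_iff ptensor_simps
    by (intro conjI ballI finite_sums_base etens_in tuples_upd x)
      (simp_all add: fun_eq_iff etens_apply *)
qed

lemma ptensor_value_in:
  assumes "\<phi> \<in> mforms K X" "u \<in> finite_sums (decomp K X)"
  shows "u \<phi> \<in> K"
  using assms(2)
proof induction
  case (add u a)
  then show ?case
    using mforms_in[OF assms(1)] assms(1) by (auto simp: decomp_def etens_apply)
qed simp

text \<open>Evaluation at \<open>\<phi>\<close> is the linear functional induced by
  \<open>\<phi>\<close> on the tensor product: in this encoding the linearisation of a form is mere
  application.\<close>

lemma form_hom: "\<phi> \<in> mforms K X \<Longrightarrow> (\<lambda>v. v \<phi>) \<in> module_hom (scalar_ring K) (ptensor K X) (scalar_space K)"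
  by (auto simp: module_hom_iff ptensor_value_in)

section \<open>The projective norm\<close>

lemma proj_norm_bdd:
  "bdd_below {(\<Sum>k<m. \<Prod>i\<in>UNIV. nrm (X i) (x k i)) | (m :: nat) x.
      (\<forall>k<m. x k \<in> tuples X) \<and> u = (\<Sum>k<m. etens K X (x k))}"
  by (rule bdd_belowI[of _ 0]) (auto simp: prod_nrm_nonneg intro!: sum_nonneg)

lemma proj_norm_le:
  fixes m :: nat
  assumes "\<And>k. k < m \<Longrightarrow> x k \<in> tuples X" "u = (\<Sum>k<m. etens K X (x k))"
  shows "proj_norm K X u \<le> (\<Sum>k<m. \<Prod>i\<in>UNIV. nrm (X i) (x k i))"
  unfolding proj_norm_def
  by (rule cInf_lower[OF _ proj_norm_bdd], intro CollectI exI[of _ m] exI[of _ x]) (use assms in simp)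

text \<open>Membership in the tensor product makes the set of representations nonempty, so that its
  \<open>Inf\<close> can be approached.\<close>

lemma proj_norm_approx:
  assumes "u \<in> finite_sums (decomp K X)" "proj_norm K X u < c"
  obtains m :: nat and x where "\<forall>k<m. x k \<in> tuples X" "u = (\<Sum>k<m. etens K X (x k))"
    "(\<Sum>k<m. \<Prod>i\<in>UNIV. nrm (X i) (x k i)) < c"
proof -
  define A where "A = {(\<Sum>k<m. \<Prod>i\<in>UNIV. nrm (X i) (x k i)) | (m :: nat) x.
      (\<forall>k<m. x k \<in> tuples X) \<and> u = (\<Sum>k<m. etens K X (x k))}"
  obtain m :: nat and x where "\<forall>k<m. x k \<in> tuples X" "u = (\<Sum>k<m. etens K X (x k))"
    by (rule ptensor_sumE[OF assms(1)])
  then have "(\<Sum>k<m. \<Prod>i\<in>UNIV. nrm (X i) (x k i)) \<in> A"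
    unfolding A_def by (intro CollectI exI[of _ m] exI[of _ x]) simp
  then have "A \<noteq> {}" by blast
  moreover have "Inf A < c" using assms(2) by (simp add: proj_norm_def A_def)
  ultimately obtain s where s: "s \<in> A" "s < c"
    using cInf_lessD by blast
  from s(1) obtain m :: nat and x where mx: "s = (\<Sum>k<m. \<Prod>i\<in>UNIV. nrm (X i) (x k i))"
    "\<forall>k<m. x k \<in> tuples X" "u = (\<Sum>k<m. etens K X (x k))"
    unfolding A_def mem_Collect_eq by (elim exE conjE)
  show ?thesis by (rule that[OF mx(2,3)]) (use mx(1) s(2) in simp)
qed

lemma proj_norm_nonneg: "u \<in> finite_sums (decomp K X) \<Longrightarrow> 0 \<le> proj_norm K X u"
proof (rule ccontr)
  assume u: "u \<in> finite_sums (decomp K X)" and "\<not> 0 \<le> proj_norm K X u"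
  then have "proj_norm K X u < 0" by simp
  then obtain m :: nat and x where "\<forall>k<m. x k \<in> tuples X" "u = (\<Sum>k<m. etens K X (x k))"
    "(\<Sum>k<m. \<Prod>i\<in>UNIV. nrm (X i) (x k i)) < 0"
    by (rule proj_norm_approx[OF u])
  moreover from this(1) have "0 \<le> (\<Sum>k<m. \<Prod>i\<in>UNIV. nrm (X i) (x k i))"
    by (auto simp: prod_nrm_nonneg intro!: sum_nonneg)
  ultimately show False by simp
qed

lemma proj_norm_zero: "proj_norm K X 0 = 0"
  using proj_norm_le[of 0 undefined 0] proj_norm_nonneg[OF finite_sums.zero] by simp

lemma proj_norm_triangle:
  assumes "u \<in> finite_sums (decomp K X)" "v \<in> finite_sums (decomp K X)"
  shows "proj_norm K X (u + v) \<le> proj_norm K X u + proj_norm K X v"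
proof (rule field_le_epsilon)
  fix e :: real assume e: "0 < e"
  obtain m :: nat and x where x: "\<forall>k<m. x k \<in> tuples X" "u = (\<Sum>k<m. etens K X (x k))"
    "(\<Sum>k<m. \<Prod>i\<in>UNIV. nrm (X i) (x k i)) < proj_norm K X u + e / 2"
    by (rule proj_norm_approx[OF assms(1), of "proj_norm K X u + e / 2"]) (use e in simp)
  obtain n :: nat and y where y: "\<forall>k<n. y k \<in> tuples X" "v = (\<Sum>k<n. etens K X (y k))"
    "(\<Sum>k<n. \<Prod>i\<in>UNIV. nrm (X i) (y k i)) < proj_norm K X v + e / 2"
    by (rule proj_norm_approx[OF assms(2), of "proj_norm K X v + e / 2"]) (use e in simp)
  define z where "z k = (if k < m then x k else y (k - m))" for k
  have "proj_norm K X (u + v) \<le> (\<Sum>k<m + n. \<Prod>i\<in>UNIV. nrm (X i) (z k i))"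
    by (rule proj_norm_le) (auto simp: z_def x y sum_concat)
  also have "\<dots> = (\<Sum>k<m. \<Prod>i\<in>UNIV. nrm (X i) (x k i)) + (\<Sum>k<n. \<Prod>i\<in>UNIV. nrm (X i) (y k i))"
    by (simp add: z_def sum_concat)
  finally show "proj_norm K X (u + v) \<le> proj_norm K X u + proj_norm K X v + e"
    using x(3) y(3) by simp
qed

text \<open>One fixed coordinate of each term absorbs the scalar, which multiplies the product of
  norms by \<open>cmod c\<close>.\<close>

lemma proj_norm_smult_le:
  assumes "u \<in> finite_sums (decomp K X)" "c \<in> K"
  shows "proj_norm K X (\<lambda>\<phi>. c * u \<phi>) \<le> cmod c * proj_norm K X u"
proof (rule le_mult_of_gt)
  fix b assume "proj_norm K X u < b"
  then obtain m :: nat and x where x: "\<forall>k<m. x k \<in> tuples X" "u = (\<Sum>k<m. etens K X (x k))"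
    "(\<Sum>k<m. \<Prod>i\<in>UNIV. nrm (X i) (x k i)) < b"
    by (rule proj_norm_approx[OF assms(1)])
  define j :: 'i where "j = undefined"
  define y where "y k = (x k)(j := c \<odot>\<^bsub>X j\<^esub> x k j)" for k
  have y: "y k \<in> tuples X" if "k < m" for k
    using x(1)[rule_format, OF that] assms(2) scalar_normed_space.smult_in[OF factor]
    by (auto simp: y_def tuples_in intro: tuples_upd)
  have "proj_norm K X (\<lambda>\<phi>. c * u \<phi>) \<le> (\<Sum>k<m. \<Prod>i\<in>UNIV. nrm (X i) (y k i))"
    by (rule proj_norm_le[OF y])
      (auto simp: x(2) fun_eq_iff fun_sum_apply sum_distrib_left y_def etens_smult[OF x(1)[rule_format] assms(2)])
  also have "(\<Prod>i\<in>UNIV. nrm (X i) (y k i)) = cmod c * (\<Prod>i\<in>UNIV. nrm (X i) (x k i))" if "k < m" for k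
  proof -
    have "(\<Prod>i\<in>UNIV. nrm (X i) (y k i)) = nrm (X j) (y k j) * (\<Prod>i\<in>UNIV - {j}. nrm (X i) (y k i))"
      by (rule prod.remove) auto
    also have "\<dots> = cmod c * (nrm (X j) (x k j) * (\<Prod>i\<in>UNIV - {j}. nrm (X i) (x k i)))"
      using normed_space.nrm_smult[OF normed_X assms(2) tuples_in[OF x(1)[rule_format, OF that]]]
      by (simp add: y_def)
    also have "nrm (X j) (x k j) * (\<Prod>i\<in>UNIV - {j}. nrm (X i) (x k i)) = (\<Prod>i\<in>UNIV. nrm (X i) (x k i))"
      by (rule prod.remove[symmetric]) auto
    finally show ?thesis .
  qed
  then have "(\<Sum>k<m. \<Prod>i\<in>UNIV. nrm (X i) (y k i)) = cmod c * (\<Sum>k<m. \<Prod>i\<in>UNIV. nrm (X i) (x k i))"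
    by (simp add: sum_distrib_left)
  also have "\<dots> \<le> cmod c * b" using x(3) by (intro mult_left_mono) auto
  finally show "proj_norm K X (\<lambda>\<phi>. c * u \<phi>) \<le> cmod c * b" .
qed auto

lemma bounded_form_mform: "bounded_multilinear K X (scalar_space K) \<phi> \<Longrightarrow> \<phi> \<in> mforms K X"
  by (simp add: bounded_multilinear_def mforms_def)

text \<open>The easy half of the duality between the projective norm and bounded forms: a termwise
  estimate on a nearly optimal representation.\<close>

lemma form_le_proj_norm:
  assumes \<phi>: "bounded_multilinear K X (scalar_space K) \<phi>" and u: "u \<in> finite_sums (decomp K X)"
  shows "cmod (u \<phi>) \<le> multi_norm X (scalar_space K) \<phi> * proj_norm K X u"
proof (rule le_mult_of_gt)
  let ?M = "multi_norm X (scalar_space K) \<phi>"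
  fix b assume "proj_norm K X u < b"
  then obtain m :: nat and x where x: "\<forall>k<m. x k \<in> tuples X" "u = (\<Sum>k<m. etens K X (x k))"
    "(\<Sum>k<m. \<Prod>i\<in>UNIV. nrm (X i) (x k i)) < b"
    by (rule proj_norm_approx[OF u])
  have "cmod (u \<phi>) = cmod (\<Sum>k<m. \<phi> (x k))"
    using bounded_form_mform[OF \<phi>] by (simp add: x(2) fun_sum_apply etens_apply)
  also have "\<dots> \<le> (\<Sum>k<m. cmod (\<phi> (x k)))" by (rule norm_sum)
  also have "\<dots> \<le> (\<Sum>k<m. ?M * (\<Prod>i\<in>UNIV. nrm (X i) (x k i)))"
    using multi_norm_bound[OF \<phi> normed_scalar_space x(1)[rule_format]] by (intro sum_mono) auto
  also have "\<dots> = ?M * (\<Sum>k<m. \<Prod>i\<in>UNIV. nrm (X i) (x k i))" by (simp add: sum_distrib_left)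
  also have "\<dots> \<le> ?M * b"
    using x(3) multi_norm_nonneg[OF \<phi> normed_scalar_space] by (intro mult_left_mono) auto
  finally show "cmod (u \<phi>) \<le> ?M * b" .
qed (rule multi_norm_nonneg[OF \<phi> normed_scalar_space])

end


section \<open>The norm gamma\<close>

lemma finite_sums_subset:
  assumes "\<And>a. a \<in> A \<Longrightarrow> a \<in> finite_sums B"
  shows "finite_sums A \<subseteq> finite_sums B"
proof
  fix u assume "u \<in> finite_sums A"
  then show "u \<in> finite_sums B"
    by induction (auto intro: finite_sums.zero finite_sums_plus assms)
qed

section \<open>Separation by products of bounded functionals\<close>

context tensor_factors
begin

lemma product_form:
  assumes g: "\<And>i. scalar_normed_space.bounded_functional K (X i) (g i)"
  shows "bounded_multilinear K X (scalar_space K) (\<lambda>x. \<Prod>i\<in>UNIV. g i (x i))"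
proof -
  have "\<exists>C. \<forall>i. 0 \<le> C i \<and> (\<forall>t \<in> carrier (X i). cmod (g i t) \<le> C i * nrm (X i) t)"
    using scalar_normed_space.bounded_functional_bound[OF factor g] by (intro choice) metis
  then obtain C where C: "\<And>i. 0 \<le> C i" "\<And>i t. t \<in> carrier (X i) \<Longrightarrow> cmod (g i t) \<le> C i * nrm (X i) t"
    by blast
  have g_in: "g i t \<in> K" if "t \<in> carrier (X i)" for i t
    using scalar_normed_space.bounded_functional_in[OF factor g that] .
  show ?thesis
  proof (rule bounded_multilinearI)
    show "multilinear K X (scalar_space K) (\<lambda>x. \<Prod>i\<in>UNIV. g i (x i))"
      unfolding multilinear_iff[OF vectorspace_scalar_space]
    proof (intro ballI allI)
      fix x j assume x: "x \<in> tuples X"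
      have "(\<lambda>t. \<Prod>i\<in>UNIV. g i ((x(j := t)) i)) = (\<lambda>t. (\<Prod>i\<in>UNIV - {j}. g i (x i)) * g j t)"
        by (rule ext, subst prod.remove[of _ j]) auto
      moreover have "(\<Prod>i\<in>UNIV - {j}. g i (x i)) \<in> K"
        using g_in x by (intro K_prod) (auto simp: tuples_in)
      ultimately show "(\<lambda>t. \<Prod>i\<in>UNIV. g i ((x(j := t)) i))
          \<in> module_hom (scalar_ring K) (X j) (scalar_space K)"
        using scalar_normed_space.bounded_functional_hom[OF factor g, of j]
        by (auto simp: module_hom_iff algebra_simps)
    qed
    show "nrm (scalar_space K) (\<Prod>i\<in>UNIV. g i (x i))
        \<le> (\<Prod>i\<in>UNIV. C i) * (\<Prod>i\<in>UNIV. nrm (X i) (x i))" if "x \<in> tuples X" for x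
      using C that by (auto simp: tuples_in simp flip: prod.distrib prod_norm intro!: prod_mono)
  qed
qed

text \<open>\<open>\<phi>\<close> may be unbounded. The induction runs over the coordinates: at each
  one, \<open>separate_coordinate\<close> freezes that argument of \<open>\<phi>\<close> at a fixed
  vector while a bounded functional takes over the vectors \<open>x k j\<close>. The coefficients
  \<open>c k\<close> leave room for the values of a functional on a further factor.\<close>

lemma separate_by_product_form:
  fixes x :: "nat \<Rightarrow> 'i \<Rightarrow> 'a"
  assumes \<phi>: "\<phi> \<in> mforms K X" and x: "\<And>k. k < m \<Longrightarrow> x k \<in> tuples X"
    and c: "\<And>k. k < m \<Longrightarrow> c k \<in> K" and nz: "(\<Sum>k<m. c k * \<phi> (x k)) \<noteq> 0"
  obtains g where "\<And>i. scalar_normed_space.bounded_functional K (X i) (g i)"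
    "(\<Sum>k<m. c k * (\<Prod>i\<in>UNIV. g i (x k i))) \<noteq> 0"
proof -
  have "\<exists>g e. (\<forall>i. scalar_normed_space.bounded_functional K (X i) (g i)) \<and> e \<in> tuples X \<and>
      (\<Sum>k<m. c k * (\<Prod>i\<in>I. g i (x k i)) * \<phi> (\<lambda>i. if i \<in> I then e i else x k i)) \<noteq> 0"
    if "finite I" for I
    using that
  proof induction
    case empty
    show ?case
      using nz tuples_zero scalar_normed_space.bounded_functional_zero[OF factor]
      by (intro exI[of _ "\<lambda>_ _. 0"] exI[of _ "\<lambda>i. \<zero>\<^bsub>X i\<^esub>"]) simp
  next
    case (insert j I)
    then obtain g e where g: "\<And>i. scalar_normed_space.bounded_functional K (X i) (g i)"
      and e: "e \<in> tuples X"
      and ne: "(\<Sum>k<m. c k * (\<Prod>i\<in>I. g i (x k i)) * \<phi> (\<lambda>i. if i \<in> I then e i else x k i)) \<noteq> 0"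
      by blast
    \<comment> \<open>Coordinates in \<open>I\<close> are already frozen at \<open>e\<close>;
      coordinate \<open>j\<close> is treated next, and \<open>d k\<close> collects the functionals
      found so far.\<close>
    define z where "z k = (\<lambda>i. if i \<in> I then e i else x k i)" for k
    have z: "z k \<in> tuples X" if "k < m" for k
      using x[OF that] e by (auto simp: z_def tuples_def)
    define d where "d k = c k * (\<Prod>i\<in>I. g i (x k i))" for k
    have d: "d k \<in> K" if "k < m" for k
      unfolding d_def
      using scalar_normed_space.bounded_functional_in[OF factor g] tuples_in[OF x[OF that]] c[OF that]
      by (intro K_closed K_prod) auto
    interpret Xj: scalar_normed_space K "X j" by (rule factor)
    have "\<exists>h f. Xj.bounded_functional h \<and> f \<in> carrier (X j) \<and>
        (\<Sum>k<m. h (x k j) * (d k * \<phi> ((z k)(j := f)))) \<noteq> 0"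
    proof (rule Xj.separate_coordinate[of m "\<lambda>k. x k j" "\<lambda>k t. d k * \<phi> ((z k)(j := t))"])
      show "x k j \<in> carrier (X j)" if "k < m" for k using x[OF that] by (rule tuples_in)
      show "(\<lambda>t. d k * \<phi> ((z k)(j := t))) \<in> module_hom (scalar_ring K) (X j) (scalar_space K)"
        if "k < m" for k
        using \<phi> z[OF that] d[OF that] by (auto simp: mforms_iff module_hom_iff algebra_simps)
      have "(z k)(j := x k j) = z k" for k using insert.hyps by (auto simp: z_def)
      then show "(\<Sum>k<m. d k * \<phi> ((z k)(j := x k j))) \<noteq> 0"
        using ne by (simp add: d_def z_def)
    qed blast
    then obtain h f where h: "Xj.bounded_functional h" and f: "f \<in> carrier (X j)"
      and hf: "(\<Sum>k<m. h (x k j) * (d k * \<phi> ((z k)(j := f)))) \<noteq> 0"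
      by blast
    have "(\<Prod>i\<in>I. (g(j := h)) i (x k i)) = (\<Prod>i\<in>I. g i (x k i))" for k
      using insert.hyps by (intro prod.cong) auto
    moreover have "(\<lambda>i. if i \<in> insert j I then (e(j := f)) i else x k i) = (z k)(j := f)" for k
      using insert.hyps by (auto simp: z_def)
    ultimately have "(\<Sum>k<m. c k * (\<Prod>i\<in>insert j I. (g(j := h)) i (x k i)) *
        \<phi> (\<lambda>i. if i \<in> insert j I then (e(j := f)) i else x k i)) \<noteq> 0"
      using hf insert.hyps by (simp add: d_def algebra_simps)
    moreover have "e(j := f) \<in> tuples X" using e f by (rule tuples_upd)
    moreover have "\<forall>i. scalar_normed_space.bounded_functional K (X i) ((g(j := h)) i)"
      using g h by simp
    ultimately show ?case by blast
  qed
  from this[of UNIV] obtain g e where g: "\<And>i. scalar_normed_space.bounded_functional K (X i) (g i)"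
    and ne: "(\<Sum>k<m. c k * (\<Prod>i\<in>UNIV. g i (x k i)) * \<phi> e) \<noteq> 0"
    by auto
  have "(\<Sum>k<m. c k * (\<Prod>i\<in>UNIV. g i (x k i))) * \<phi> e \<noteq> 0"
    using ne by (simp add: sum_distrib_right)
  then show ?thesis by (intro that[OF g]) auto
qed

end

section \<open>Admissible representations and their cost\<close>

definition gamma_rep ::
    "complex set \<Rightarrow> ('i::finite \<Rightarrow> 'a nspace) \<Rightarrow> 'b nspace \<Rightarrow> (('i, 'a) tensor, 'b) tensor2 \<Rightarrow>
     nat \<Rightarrow> (nat \<Rightarrow> ('i, 'a) tensor) \<Rightarrow> (nat \<Rightarrow> ('i, 'a) tensor) \<Rightarrow>
     (nat \<Rightarrow> ('i, 'a) tensor) \<Rightarrow> (nat \<Rightarrow> ('i, 'a) tensor) \<Rightarrow> (nat \<Rightarrow> 'b) \<Rightarrow> bool"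
  where "gamma_rep K X Y u m p q a b y \<longleftrightarrow>
    (\<forall>k<m. p k \<in> decomp K X \<and> q k \<in> decomp K X \<and> y k \<in> carrier Y) \<and>
    u = (\<Sum>k<m. etens2 K (ptensor K X) Y (p k - q k) (y k)) \<and>
    (\<forall>k<m. a k \<in> decomp K X \<and> b k \<in> decomp K X) \<and>
    le_pi K X m p q m a b"

definition gamma_cost ::
    "complex set \<Rightarrow> ('i::finite \<Rightarrow> 'a nspace) \<Rightarrow> 'b nspace \<Rightarrow> nat \<Rightarrow>
     (nat \<Rightarrow> ('i, 'a) tensor) \<Rightarrow> (nat \<Rightarrow> ('i, 'a) tensor) \<Rightarrow> (nat \<Rightarrow> 'b) \<Rightarrow> real"
  where "gamma_cost K X Y m a b y =
    sqrt (\<Sum>k<m. (proj_norm K X (a k - b k))\<^sup>2) * sqrt (\<Sum>k<m. (nrm Y (y k))\<^sup>2)"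

lemma gamma_eq_Inf:
  "gamma K X Y u = Inf {gamma_cost K X Y m a b y | m p q a b y. gamma_rep K X Y u m p q a b y}"
  unfolding gamma_def gamma_rep_def gamma_cost_def ..

lemma gamma_cost_nonneg: "0 \<le> gamma_cost K X Y m a b y"
  by (simp add: gamma_cost_def sum_nonneg)

lemma gamma_le:
  assumes "gamma_rep K X Y u m p q a b y"
  shows "gamma K X Y u \<le> gamma_cost K X Y m a b y"
  unfolding gamma_eq_Inf
proof (rule cInf_lower)
  show "bdd_below {gamma_cost K X Y m a b y | m p q a b y. gamma_rep K X Y u m p q a b y}"
    by (rule bdd_belowI[of _ 0]) (auto simp: gamma_cost_nonneg)
qed (use assms in blast)

text \<open>The first representation only witnesses that the infimum is taken over a nonempty
  set.\<close>

lemma gamma_approx: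
  assumes "gamma_rep K X Y u m0 p0 q0 a0 b0 y0" and "gamma K X Y u < c"
  obtains m p q a b y where "gamma_rep K X Y u m p q a b y" "gamma_cost K X Y m a b y < c"
proof -
  let ?A = "{gamma_cost K X Y m a b y | m p q a b y. gamma_rep K X Y u m p q a b y}"
  have "gamma_cost K X Y m0 a0 b0 y0 \<in> ?A" using assms(1) by blast
  then obtain s where "s \<in> ?A" "s < c"
    using assms(2) cInf_lessD[of ?A c] unfolding gamma_eq_Inf by blast
  then show ?thesis using that by blast
qed

section \<open>The tensor product with one further factor\<close>

locale tensor_pair = tensor_factors K X
  for K and X :: "'i::finite \<Rightarrow> 'a nspace" +
  fixes Y :: "'b nspace"
  assumes normed_Y: "normed_space K Y"
begin

sublocale Y: scalar_normed_space K Y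
  using scalar_field_axioms normed_Y by (simp add: scalar_normed_space_def)

abbreviation PT :: "('i, 'a) tensor set" where "PT \<equiv> finite_sums (decomp K X)"

abbreviation tensor_vec :: "('i, 'a) tensor \<Rightarrow> 'b \<Rightarrow> (('i, 'a) tensor, 'b) tensor2" (infixl "\<otimes>\<^sub>t" 75)
  where "v \<otimes>\<^sub>t y \<equiv> etens2 K (ptensor K X) Y v y"

lemma bforms_iff:
  "\<beta> \<in> bforms K (ptensor K X) Y \<longleftrightarrow>
    (\<forall>y \<in> carrier Y. (\<lambda>v. \<beta> (v, y)) \<in> module_hom (scalar_ring K) (ptensor K X) (scalar_space K)) \<and>
    (\<forall>v \<in> PT. (\<lambda>y. \<beta> (v, y)) \<in> module_hom (scalar_ring K) Y (scalar_space K))"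
  using vectorspace_ptensor vectorspace_scalar_space Y.vectorspace_X
  by (simp add: bforms_def linear_map_iff)

lemma etens2_apply: "(v \<otimes>\<^sub>t y) \<beta> = (if \<beta> \<in> bforms K (ptensor K X) Y then \<beta> (v, y) else 0)"
  by (simp add: etens2_def ev_def)

lemma etens2_add_left:
  "v \<in> PT \<Longrightarrow> w \<in> PT \<Longrightarrow> y \<in> carrier Y \<Longrightarrow> (v + w) \<otimes>\<^sub>t y = v \<otimes>\<^sub>t y + w \<otimes>\<^sub>t y"
  by (auto simp: fun_eq_iff etens2_apply bforms_iff module_hom_iff)

lemma etens2_smult_left:
  "c \<in> K \<Longrightarrow> v \<in> PT \<Longrightarrow> y \<in> carrier Y \<Longrightarrow> (\<lambda>\<phi>. c * v \<phi>) \<otimes>\<^sub>t y = (\<lambda>\<beta>. c * (v \<otimes>\<^sub>t y) \<beta>)"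
  by (auto simp: fun_eq_iff etens2_apply bforms_iff module_hom_iff)

lemma etens2_smult_right:
  "c \<in> K \<Longrightarrow> v \<in> PT \<Longrightarrow> y \<in> carrier Y \<Longrightarrow> v \<otimes>\<^sub>t (c \<odot>\<^bsub>Y\<^esub> y) = (\<lambda>\<beta>. c * (v \<otimes>\<^sub>t y) \<beta>)"
  by (auto simp: fun_eq_iff etens2_apply bforms_iff module_hom_iff)

lemma etens2_zero_left: "y \<in> carrier Y \<Longrightarrow> 0 \<otimes>\<^sub>t y = 0"
  using etens2_smult_left[OF K_closed(1) finite_sums.zero, of y]
  by (simp add: zero_fun_def)

lemma etens2_sum_left:
  "(\<And>k. k \<in> I \<Longrightarrow> v k \<in> PT) \<Longrightarrow> y \<in> carrier Y \<Longrightarrow> (\<Sum>k\<in>I. v k) \<otimes>\<^sub>t y = (\<Sum>k\<in>I. v k \<otimes>\<^sub>t y)"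
proof (induction I rule: infinite_finite_induct)
  case (insert i I)
  then show ?case
    unfolding sum.insert[OF insert.hyps] by (subst etens2_add_left) (auto intro: finite_sums_sum)
qed (simp_all add: etens2_zero_left)

text \<open>A smaller generating set than the one in \<open>gtensor\<close>, whose first entries are
  arbitrary tensors. Additivity in the first entry gives the same span, and inductions over it meet
  elementary tensors only.\<close>

definition simple_tensors :: "(('i, 'a) tensor, 'b) tensor2 set" where
  "simple_tensors = {etens K X x \<otimes>\<^sub>t y | x y. x \<in> tuples X \<and> y \<in> carrier Y}"

abbreviation GT :: "(('i, 'a) tensor, 'b) tensor2 set" where "GT \<equiv> finite_sums simple_tensors"

lemma etens_in_PT [intro]: "x \<in> tuples X \<Longrightarrow> etens K X x \<in> PT"
  by (simp add: finite_sums_base etens_in)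

lemma simple_tensors_smult: "c \<in> K \<Longrightarrow> t \<in> simple_tensors \<Longrightarrow> (\<lambda>\<beta>. c * t \<beta>) \<in> simple_tensors"
  unfolding simple_tensors_def
  using etens2_smult_right[OF _ etens_in_PT, symmetric] by fastforce

lemma etens2_in:
  assumes "v \<in> PT" "y \<in> carrier Y"
  shows "v \<otimes>\<^sub>t y \<in> GT"
proof -
  obtain m :: nat and x where x: "\<forall>k<m. x k \<in> tuples X" "v = (\<Sum>k<m. etens K X (x k))"
    by (rule ptensor_sumE[OF assms(1)])
  have "v \<otimes>\<^sub>t y = (\<Sum>k<m. etens K X (x k) \<otimes>\<^sub>t y)"
    unfolding x(2) by (rule etens2_sum_left) (use x assms in auto)
  also have "\<dots> \<in> GT"
    by (rule finite_sums_sum, rule finite_sums_base) (use x assms in \<open>auto simp: simple_tensors_def\<close>)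
  finally show ?thesis .
qed

lemma gtensor_eq: "gtensor K X Y = fun_nspace GT (gamma K X Y)"
proof -
  let ?A = "{v \<otimes>\<^sub>t y | v y. v \<in> carrier (ptensor K X) \<and> y \<in> carrier Y}"
  have "lin_hull K ?A = finite_sums ?A"
  proof (rule lin_hull_eq_finite_sums)
    fix c t assume c: "c \<in> K" and "t \<in> ?A"
    then obtain v y where vy: "t = v \<otimes>\<^sub>t y" "v \<in> PT" "y \<in> carrier Y" by auto
    have "(\<lambda>\<beta>. c * t \<beta>) = v \<otimes>\<^sub>t (c \<odot>\<^bsub>Y\<^esub> y)" using etens2_smult_right c vy by simp
    moreover have "c \<odot>\<^bsub>Y\<^esub> y \<in> carrier Y" using c vy by simp
    ultimately show "(\<lambda>\<beta>. c * t \<beta>) \<in> finite_sums ?A"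
      using vy(2) by (intro finite_sums_base) auto
  qed
  also have "finite_sums ?A = GT"
  proof (intro equalityI finite_sums_subset)
    show "a \<in> GT" if "a \<in> ?A" for a using that etens2_in by auto
    show "a \<in> finite_sums ?A" if "a \<in> simple_tensors" for a
      using that by (intro finite_sums_base) (auto simp: simple_tensors_def)
  qed
  finally show ?thesis unfolding gtensor_def by simp
qed

lemma gtensor_simps [simp]:
  "carrier (gtensor K X Y) = GT" "zero (gtensor K X Y) = 0"
  "add (gtensor K X Y) = (+)" "smult (gtensor K X Y) = (\<lambda>c u \<beta>. c * u \<beta>)"
  "nrm (gtensor K X Y) = gamma K X Y"
  by (simp_all add: gtensor_eq)

lemma vectorspace_gtensor: "vectorspace (scalar_ring K) (gtensor K X Y)"
  unfolding gtensor_eq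
  by (rule vectorspace_finite_sums) (simp add: finite_sums_base simple_tensors_smult)

lemma gtensor_sumE:
  assumes "u \<in> GT"
  obtains m :: nat and x y where "\<forall>k<m. x k \<in> tuples X" "\<forall>k<m. y k \<in> carrier Y"
    "u = (\<Sum>k<m. etens K X (x k) \<otimes>\<^sub>t y k)"
proof -
  obtain m a where a: "\<forall>k<m. a k \<in> simple_tensors" "u = (\<Sum>k<m::nat. a k)"
    using finite_sums_iff[THEN iffD1, OF assms] by (elim exE conjE)
  have "\<forall>k. \<exists>xy. k < m \<longrightarrow> fst xy \<in> tuples X \<and> snd xy \<in> carrier Y \<and> a k = etens K X (fst xy) \<otimes>\<^sub>t snd xy"
    using a(1) unfolding simple_tensors_def by fastforce
  then obtain xy where xy: "\<forall>k<m. fst (xy k) \<in> tuples X \<and> snd (xy k) \<in> carrier Y \<and>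
      a k = etens K X (fst (xy k)) \<otimes>\<^sub>t snd (xy k)"
    by metis
  show ?thesis
    by (rule that[of m "\<lambda>k. fst (xy k)" "\<lambda>k. snd (xy k)"]) (simp_all add: a(2) xy)
qed

text \<open>Supplies the uniqueness clauses for the functionals and operators on the tensor
  product.\<close>

lemma gtensor_hom_unique:
  assumes W: "vectorspace (scalar_ring K) W"
    and T: "T \<in> module_hom (scalar_ring K) (gtensor K X Y) W"
    and T': "T' \<in> module_hom (scalar_ring K) (gtensor K X Y) W"
    and eq: "\<And>x y. x \<in> tuples X \<Longrightarrow> y \<in> carrier Y \<Longrightarrow> T' (etens K X x \<otimes>\<^sub>t y) = T (etens K X x \<otimes>\<^sub>t y)"
    and u: "u \<in> GT"
  shows "T' u = T u"
  using u
proof induction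
  case zero
  show ?case
    using module_hom_zero[OF vectorspace_gtensor W T] module_hom_zero[OF vectorspace_gtensor W T'] by (simp add: zero_fun_def)
next
  case (add u a)
  have a: "a \<in> GT" "T' a = T a"
    using finite_sums_base[OF add.hyps(2)] add.hyps(2) eq by (auto simp: simple_tensors_def)
  have "F (u + a) = F u \<oplus>\<^bsub>W\<^esub> F a" if "F \<in> module_hom (scalar_ring K) (gtensor K X Y) W" for F
    using module_hom_add[OF that, of u a] add.hyps(1) a(1) by (simp only: gtensor_simps)
  from this[OF T] this[OF T'] show ?case using add.IH a(2) by (simp only:)
qed

lemma gtensor_value_in:
  assumes "\<beta> \<in> bforms K (ptensor K X) Y" "u \<in> GT"
  shows "u \<beta> \<in> K"
  using assms(2)
proof induction
  case (add u a)
  from add.hyps(2) obtain x y where "x \<in> tuples X" "y \<in> carrier Y" "a = etens K X x \<otimes>\<^sub>t y"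
    by (auto simp: simple_tensors_def)
  moreover from this have "\<beta> (etens K X x, y) \<in> K"
    using assms(1) etens_in_PT by (auto simp: bforms_iff module_hom_iff)
  ultimately show ?case using add.IH assms(1) by (simp add: etens2_apply)
qed simp

lemma gamma_rep_exists:
  assumes "u \<in> GT"
  obtains m p q a b y where "gamma_rep K X Y u m p q a b y"
proof -
  obtain m :: nat and x y where x: "\<forall>k<m. x k \<in> tuples X" "\<forall>k<m. y k \<in> carrier Y"
    and u: "u = (\<Sum>k<m. etens K X (x k) \<otimes>\<^sub>t y k)"
    by (rule gtensor_sumE[OF assms])
  \<comment> \<open>With \<open>q = b = 0\<close> and \<open>a = p\<close> the two sides of the
    comparison coincide.\<close>
  have "gamma_rep K X Y u m (\<lambda>k. etens K X (x k)) (\<lambda>_. 0) (\<lambda>k. etens K X (x k)) (\<lambda>_. 0) y"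
    using x zero_decomp by (auto simp: gamma_rep_def le_pi_def u)
  then show ?thesis by (rule that)
qed

lemma gamma_approx_rep:
  assumes "u \<in> GT" and "gamma K X Y u < c"
  obtains m p q a b y where "gamma_rep K X Y u m p q a b y" "gamma_cost K X Y m a b y < c"
proof -
  obtain m p q a b y where rep: "gamma_rep K X Y u m p q a b y"
    by (rule gamma_rep_exists[OF assms(1)])
  show ?thesis by (rule gamma_approx[OF rep assms(2)]) (rule that)
qed

section \<open>Seminorm properties of gamma\<close>

lemma gamma_nonneg:
  assumes "u \<in> GT"
  shows "0 \<le> gamma K X Y u"
proof (rule ccontr)
  assume "\<not> 0 \<le> gamma K X Y u"
  then have "gamma K X Y u < 0" by simp
  then obtain m p q a b y where "gamma_rep K X Y u m p q a b y" "gamma_cost K X Y m a b y < 0"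
    by (rule gamma_approx_rep[OF assms])
  then show False using gamma_cost_nonneg[of K X Y m a b y] by simp
qed

text \<open>A one-term representation compared with itself is admissible, and its cost is the
  right-hand side.\<close>

lemma gamma_simple_le:
  assumes "p \<in> decomp K X" "q \<in> decomp K X" "y \<in> carrier Y"
  shows "gamma K X Y ((p - q) \<otimes>\<^sub>t y) \<le> proj_norm K X (p - q) * nrm Y y"
proof -
  have "gamma_rep K X Y ((p - q) \<otimes>\<^sub>t y) 1 (\<lambda>_. p) (\<lambda>_. q) (\<lambda>_. p) (\<lambda>_. q) (\<lambda>_. y)"
    using assms by (simp add: gamma_rep_def le_pi_def)
  from gamma_le[OF this] show ?thesis
    using proj_norm_nonneg[OF decomp_diff_in[OF assms(1,2)]] Y.nrm_nonneg[OF assms(3)]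
    by (simp add: gamma_cost_def)
qed

text \<open>The factors \<open>t\<close> and \<open>inverse t\<close> cancel in each term of
  \<open>u\<close>, and both sides of the comparison acquire the same factor
  \<open>t\<^sup>2\<close>.\<close>

lemma gamma_rep_rescale:
  assumes rep: "gamma_rep K X Y u m p q a b y" and t: "0 < t"
  defines "s \<equiv> (\<lambda>v k \<phi>. complex_of_real t * v k \<phi>)"
  shows "gamma_rep K X Y u m (s p) (s q) (s a) (s b) (\<lambda>k. complex_of_real (inverse t) \<odot>\<^bsub>Y\<^esub> y k)"
proof -
  have s_diff: "s v k - s w k = (\<lambda>\<phi>. complex_of_real t * (v k - w k) \<phi>)" for v w k
    by (auto simp: s_def algebra_simps)
  have "(s p k - s q k) \<otimes>\<^sub>t (complex_of_real (inverse t) \<odot>\<^bsub>Y\<^esub> y k) = (p k - q k) \<otimes>\<^sub>t y k" if "k < m" for k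
  proof -
    have pq: "p k - q k \<in> PT" and y: "y k \<in> carrier Y"
      using rep that decomp_diff_in by (auto simp: gamma_rep_def)
    have "(s p k - s q k) \<otimes>\<^sub>t (complex_of_real (inverse t) \<odot>\<^bsub>Y\<^esub> y k)
        = (\<lambda>\<beta>. complex_of_real t * (complex_of_real (inverse t) * ((p k - q k) \<otimes>\<^sub>t y k) \<beta>))"
      unfolding s_diff using pq y
      by (subst etens2_smult_left) (simp_all add: etens2_smult_right del: of_real_inverse)
    then show ?thesis using t by (simp flip: mult.assoc)
  qed
  moreover have "le_pi K X m (s p) (s q) m (s a) (s b)"
  proof -
    have scale: "(\<Sum>k<m. (cmod (f_form \<phi> (s v k) - f_form \<phi> (s w k)))\<^sup>2) =
        t\<^sup>2 * (\<Sum>k<m. (cmod (f_form \<phi> (v k) - f_form \<phi> (w k)))\<^sup>2)" for v w \<phi>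
      using t by (simp add: s_def f_form_def norm_mult power_mult_distrib sum_distrib_left
          flip: right_diff_distrib)
    show ?thesis
      using rep unfolding le_pi_def scale gamma_rep_def by (simp add: mult_left_mono)
  qed
  ultimately show ?thesis
    using rep decomp_smult[of "complex_of_real t"] by (auto simp: gamma_rep_def s_def simp del: of_real_inverse)
qed

text \<open>A product of two square roots does not add up under concatenation, but a common bound on
  the two sums of squares does. Rescaling shifts weight between the two sums until both are at most
  \<open>c\<close>.\<close>

lemma gamma_balanced_rep:
  assumes u: "u \<in> GT" and c: "gamma K X Y u < c"
  obtains m p q a b y where "gamma_rep K X Y u m p q a b y"
    "(\<Sum>k<m. (proj_norm K X (a k - b k))\<^sup>2) \<le> c" "(\<Sum>k<m. (nrm Y (y k))\<^sup>2) \<le> c"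
proof -
  obtain m p q a b y where rep: "gamma_rep K X Y u m p q a b y" and cost: "gamma_cost K X Y m a b y < c"
    by (rule gamma_approx_rep[OF u c])
  define A where "A = (\<Sum>k<m. (proj_norm K X (a k - b k))\<^sup>2)"
  define B where "B = (\<Sum>k<m. (nrm Y (y k))\<^sup>2)"
  have AB: "0 \<le> A" "0 \<le> B" "sqrt A * sqrt B < c"
    using cost by (auto simp: A_def B_def gamma_cost_def sum_nonneg)
  have cpos: "0 < c" using gamma_nonneg[OF u] c by simp
  \<comment> \<open>If \<open>A = 0\<close>, any large \<open>t\<close> will do, and the added 1
    keeps it positive when \<open>B = 0\<close>. Otherwise \<open>t\<^sup>2 = c / A\<close> makes
    the first bound an equality, and the second one is \<open>A * B \<le> c * c\<close>.\<close>
  have "\<exists>t>0. t\<^sup>2 * A \<le> c \<and> B \<le> c * t\<^sup>2"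
  proof (cases "A = 0")
    case True
    have "B \<le> c * (sqrt (B / c + 1))\<^sup>2" using AB cpos by (simp add: field_simps)
    then show ?thesis using True AB cpos
      by (intro exI[of _ "sqrt (B / c + 1)"]) (simp add: add_nonneg_pos)
  next
    case False
    have "(sqrt A * sqrt B)\<^sup>2 \<le> c\<^sup>2" using AB by (intro power_mono) auto
    moreover have "(sqrt A * sqrt B)\<^sup>2 = A * B" using AB by (simp add: power_mult_distrib)
    ultimately have "A * B \<le> c * c" by (simp add: power2_eq_square)
    then show ?thesis using False AB cpos
      by (intro exI[of _ "sqrt (c / A)"]) (simp add: field_simps)
  qed
  then obtain t where t: "0 < t" "t\<^sup>2 * A \<le> c" "B \<le> c * t\<^sup>2" by blast
  define s :: "(nat \<Rightarrow> ('i, 'a) tensor) \<Rightarrow> nat \<Rightarrow> ('i, 'a) tensor"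
    where "s = (\<lambda>v k \<phi>. complex_of_real t * v k \<phi>)"
  have rep': "gamma_rep K X Y u m (s p) (s q) (s a) (s b) (\<lambda>k. complex_of_real (inverse t) \<odot>\<^bsub>Y\<^esub> y k)"
    unfolding s_def by (rule gamma_rep_rescale[OF rep t(1)])
  have "(\<Sum>k<m. (proj_norm K X (s a k - s b k))\<^sup>2) \<le> (\<Sum>k<m. t\<^sup>2 * (proj_norm K X (a k - b k))\<^sup>2)"
  proof (rule sum_mono)
    fix k assume "k \<in> {..<m}"
    then have ab: "a k - b k \<in> PT" "s a k - s b k \<in> PT"
      using rep rep' decomp_diff_in by (auto simp: gamma_rep_def)
    have "s a k - s b k = (\<lambda>\<phi>. complex_of_real t * (a k - b k) \<phi>)"
      by (auto simp: s_def algebra_simps)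
    then have "proj_norm K X (s a k - s b k) \<le> t * proj_norm K X (a k - b k)"
      using proj_norm_smult_le[OF ab(1), of "complex_of_real t"] t by simp
    then have "(proj_norm K X (s a k - s b k))\<^sup>2 \<le> (t * proj_norm K X (a k - b k))\<^sup>2"
      using proj_norm_nonneg[OF ab(2)] by (rule power_mono)
    then show "(proj_norm K X (s a k - s b k))\<^sup>2 \<le> t\<^sup>2 * (proj_norm K X (a k - b k))\<^sup>2"
      by (simp add: power_mult_distrib)
  qed
  also have "\<dots> \<le> c" using t(2) by (simp add: A_def sum_distrib_left)
  finally have cA: "(\<Sum>k<m. (proj_norm K X (s a k - s b k))\<^sup>2) \<le> c" .
  have "(\<Sum>k<m. (nrm Y (complex_of_real (inverse t) \<odot>\<^bsub>Y\<^esub> y k))\<^sup>2) = (inverse t)\<^sup>2 * B"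
    unfolding B_def sum_distrib_left
  proof (rule sum.cong)
    fix k assume "k \<in> {..<m}"
    then have "y k \<in> carrier Y" using rep by (auto simp: gamma_rep_def)
    then have "nrm Y (complex_of_real (inverse t) \<odot>\<^bsub>Y\<^esub> y k) = inverse t * nrm Y (y k)"
      using t Y.nrm_smult[of "complex_of_real (inverse t)" "y k"]
      by (simp add: norm_inverse norm_divide del: of_real_inverse)
    then show "(nrm Y (complex_of_real (inverse t) \<odot>\<^bsub>Y\<^esub> y k))\<^sup>2 = (inverse t)\<^sup>2 * (nrm Y (y k))\<^sup>2"
      by (simp add: power_mult_distrib)
  qed simp
  also have "\<dots> \<le> c" using t by (simp add: field_simps)
  finally show ?thesis using that[OF rep' cA] by simp
qed

text \<open>After balancing, both sums of squares of the concatenated representation are at most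
  \<open>c + d\<close>, so its cost is at most \<open>sqrt (c + d) * sqrt (c + d)\<close>, which is
  \<open>c + d\<close> without loss.\<close>

lemma gamma_triangle:
  assumes u: "u \<in> GT" and v: "v \<in> GT"
  shows "gamma K X Y (u + v) \<le> gamma K X Y u + gamma K X Y v"
proof (rule field_le_epsilon)
  fix e :: real assume e: "0 < e"
  define c where "c = gamma K X Y u + e / 2"
  define d where "d = gamma K X Y v + e / 2"
  have cd: "gamma K X Y u < c" "gamma K X Y v < d" using e by (auto simp: c_def d_def)
  obtain m p q a b y where r1: "gamma_rep K X Y u m p q a b y"
    "(\<Sum>k<m. (proj_norm K X (a k - b k))\<^sup>2) \<le> c" "(\<Sum>k<m. (nrm Y (y k))\<^sup>2) \<le> c"
    by (rule gamma_balanced_rep[OF u cd(1)])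
  obtain m' p' q' a' b' y' where r2: "gamma_rep K X Y v m' p' q' a' b' y'"
    "(\<Sum>k<m'. (proj_norm K X (a' k - b' k))\<^sup>2) \<le> d" "(\<Sum>k<m'. (nrm Y (y' k))\<^sup>2) \<le> d"
    by (rule gamma_balanced_rep[OF v cd(2)])
  define j where "j f g k = (if k < m then f k else g (k - m))" for f g :: "nat \<Rightarrow> ('i, 'a) tensor" and k
  define z where "z k = (if k < m then y k else y' (k - m))" for k
  have "le_pi K X (m + m') (j p p') (j q q') (m + m') (j a a') (j b b')"
    using r1(1) r2(1) unfolding le_pi_def gamma_rep_def sum_concat j_def
    by (auto intro!: add_mono)
  then have "gamma_rep K X Y (u + v) (m + m') (j p p') (j q q') (j a a') (j b b') z"
    using r1(1) r2(1) unfolding gamma_rep_def by (auto simp: j_def z_def sum_concat)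
  from gamma_le[OF this]
  have "gamma K X Y (u + v) \<le> gamma_cost K X Y (m + m') (j a a') (j b b') z" .
  also have "\<dots> \<le> sqrt (c + d) * sqrt (c + d)"
    unfolding gamma_cost_def sum_concat
    using r1(2,3) r2(2,3) cd gamma_nonneg[OF u] gamma_nonneg[OF v]
    by (intro mult_mono) (auto simp: j_def z_def sum_nonneg)
  also have "\<dots> = c + d"
    using cd gamma_nonneg[OF u] gamma_nonneg[OF v] by simp
  finally show "gamma K X Y (u + v) \<le> gamma K X Y u + gamma K X Y v + e"
    by (simp add: c_def d_def)
qed

lemma gtensor_smult_in: "c \<in> K \<Longrightarrow> u \<in> GT \<Longrightarrow> (\<lambda>\<beta>. c * u \<beta>) \<in> GT"
  by (rule finite_sums_smult) (simp_all add: finite_sums_base simple_tensors_smult)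

text \<open>The scalar is put into the vectors \<open>y k\<close>; the tensors, and with them the
  comparison, remain untouched.\<close>

lemma gamma_smult_le:
  assumes u: "u \<in> GT" and c: "c \<in> K"
  shows "gamma K X Y (\<lambda>\<beta>. c * u \<beta>) \<le> cmod c * gamma K X Y u"
proof (rule le_mult_of_gt)
  fix r assume "gamma K X Y u < r"
  then obtain m p q a b y where rep: "gamma_rep K X Y u m p q a b y" and cost: "gamma_cost K X Y m a b y < r"
    by (rule gamma_approx_rep[OF u])
  have "(p k - q k) \<otimes>\<^sub>t (c \<odot>\<^bsub>Y\<^esub> y k) = (\<lambda>\<beta>. c * ((p k - q k) \<otimes>\<^sub>t y k) \<beta>)" if "k < m" for k
    using rep that c decomp_diff_in by (intro etens2_smult_right) (auto simp: gamma_rep_def)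
  then have "gamma_rep K X Y (\<lambda>\<beta>. c * u \<beta>) m p q a b (\<lambda>k. c \<odot>\<^bsub>Y\<^esub> y k)"
    using rep c by (auto simp: gamma_rep_def fun_eq_iff fun_sum_apply sum_distrib_left)
  from gamma_le[OF this]
  have "gamma K X Y (\<lambda>\<beta>. c * u \<beta>) \<le> gamma_cost K X Y m a b (\<lambda>k. c \<odot>\<^bsub>Y\<^esub> y k)" .
  also have "\<dots> = cmod c * gamma_cost K X Y m a b y"
  proof -
    have "(\<Sum>k<m. (nrm Y (c \<odot>\<^bsub>Y\<^esub> y k))\<^sup>2) = (cmod c)\<^sup>2 * (\<Sum>k<m. (nrm Y (y k))\<^sup>2)"
      using rep c Y.nrm_smult by (simp add: gamma_rep_def sum_distrib_left power_mult_distrib)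
    then show ?thesis by (simp add: gamma_cost_def real_sqrt_mult)
  qed
  also have "\<dots> \<le> cmod c * r" using cost by (intro mult_left_mono) auto
  finally show "gamma K X Y (\<lambda>\<beta>. c * u \<beta>) \<le> cmod c * r" .
qed simp

lemma gamma_smult:
  assumes u: "u \<in> GT" and c: "c \<in> K"
  shows "gamma K X Y (\<lambda>\<beta>. c * u \<beta>) = cmod c * gamma K X Y u"
proof (cases "c = 0")
  case True
  then show ?thesis
    using gamma_smult_le[OF u c] gamma_nonneg[OF gtensor_smult_in[OF c u]] by simp
next
  case False
  have "gamma K X Y (\<lambda>\<beta>. inverse c * (c * u \<beta>)) \<le> cmod (inverse c) * gamma K X Y (\<lambda>\<beta>. c * u \<beta>)"
    by (rule gamma_smult_le[OF gtensor_smult_in[OF c u]]) (use c in auto)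
  moreover have "(\<lambda>\<beta>. inverse c * (c * u \<beta>)) = u" using False by auto
  ultimately have "cmod c * gamma K X Y u \<le> gamma K X Y (\<lambda>\<beta>. c * u \<beta>)"
    using False by (simp add: norm_divide norm_inverse field_simps)
  then show ?thesis using gamma_smult_le[OF u c] by simp
qed

section \<open>Functionals on the tensor product and definiteness\<close>

lemma form_tensor_functional_bform:
  assumes \<phi>: "\<phi> \<in> mforms K X" and h: "h \<in> module_hom (scalar_ring K) Y (scalar_space K)"
  shows "(\<lambda>(v, y). v \<phi> * h y) \<in> bforms K (ptensor K X) Y"
  using h form_hom[OF \<phi>] by (auto simp: bforms_iff module_hom_iff algebra_simps)

text \<open>Cauchy--Schwarz leaves exactly the sum of squares that \<open>le_pi\<close> compares, so
  \<open>p\<close>, \<open>q\<close> may be replaced by \<open>a\<close>, \<open>b\<close> before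
  \<open>form_le_proj_norm\<close> is applied. The same estimate yields the norm bound for
  \<open>\<phi> \<otimes> h\<close> and, at \<open>gamma = 0\<close>, definiteness.\<close>

lemma form_tensor_functional_bound:
  assumes \<phi>: "bounded_multilinear K X (scalar_space K) \<phi>"
    and h: "h \<in> module_hom (scalar_ring K) Y (scalar_space K)"
    and D: "0 \<le> D" "\<And>y. y \<in> carrier Y \<Longrightarrow> cmod (h y) \<le> D * nrm Y y" and u: "u \<in> GT"
  shows "cmod (u (\<lambda>(v, y). v \<phi> * h y)) \<le> multi_norm X (scalar_space K) \<phi> * D * gamma K X Y u"
proof (rule le_mult_of_gt)
  let ?M = "multi_norm X (scalar_space K) \<phi>"
  have M: "0 \<le> ?M" using multi_norm_nonneg[OF \<phi> normed_scalar_space] .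
  show "0 \<le> ?M * D" using M D by simp
  fix r assume "gamma K X Y u < r"
  then obtain m p q a b y where rep: "gamma_rep K X Y u m p q a b y" and cost: "gamma_cost K X Y m a b y < r"
    by (rule gamma_approx_rep[OF u])
  have "u (\<lambda>(v, y). v \<phi> * h y) = (\<Sum>k<m. (p k \<phi> - q k \<phi>) * h (y k))"
    using rep form_tensor_functional_bform[OF bounded_form_mform[OF \<phi>] h]
    by (simp add: gamma_rep_def fun_sum_apply etens2_apply)
  also have "cmod \<dots> \<le> (\<Sum>k<m. cmod (p k \<phi> - q k \<phi>) * cmod (h (y k)))"
    by (rule order_trans[OF norm_sum]) (simp add: norm_mult)
  also have "\<dots> \<le> sqrt (\<Sum>k<m. (cmod (p k \<phi> - q k \<phi>))\<^sup>2) * sqrt (\<Sum>k<m. (cmod (h (y k)))\<^sup>2)"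
    using L2_set_mult_ineq[of "\<lambda>k. cmod (p k \<phi> - q k \<phi>)" "\<lambda>k. cmod (h (y k))" "{..<m}"]
    by (simp add: L2_set_def)
  also have "\<dots> \<le> sqrt (?M\<^sup>2 * (\<Sum>k<m. (proj_norm K X (a k - b k))\<^sup>2)) * sqrt (D\<^sup>2 * (\<Sum>k<m. (nrm Y (y k))\<^sup>2))"
  proof (intro mult_mono real_sqrt_le_mono)
    \<comment> \<open>Boundedness of \<open>\<phi>\<close> is what allows the comparison to be
      tested on it.\<close>
    have "(\<Sum>k<m. (cmod (p k \<phi> - q k \<phi>))\<^sup>2) \<le> (\<Sum>k<m. (cmod (a k \<phi> - b k \<phi>))\<^sup>2)"
      using rep \<phi> by (simp add: gamma_rep_def le_pi_def f_form_def)
    also have "\<dots> \<le> (\<Sum>k<m. ?M\<^sup>2 * (proj_norm K X (a k - b k))\<^sup>2)"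
    proof (rule sum_mono)
      fix k assume "k \<in> {..<m}"
      then have "a k - b k \<in> PT" using rep decomp_diff_in by (auto simp: gamma_rep_def)
      from form_le_proj_norm[OF \<phi> this]
      show "(cmod (a k \<phi> - b k \<phi>))\<^sup>2 \<le> ?M\<^sup>2 * (proj_norm K X (a k - b k))\<^sup>2"
        by (simp flip: power_mult_distrib add: power_mono)
    qed
    finally show "(\<Sum>k<m. (cmod (p k \<phi> - q k \<phi>))\<^sup>2) \<le> ?M\<^sup>2 * (\<Sum>k<m. (proj_norm K X (a k - b k))\<^sup>2)"
      by (simp add: sum_distrib_left)
    show "(\<Sum>k<m. (cmod (h (y k)))\<^sup>2) \<le> D\<^sup>2 * (\<Sum>k<m. (nrm Y (y k))\<^sup>2)"
      unfolding sum_distrib_left power_mult_distrib[symmetric]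
      using D(2) rep by (intro sum_mono power_mono) (auto simp: gamma_rep_def)
  qed (auto simp: sum_nonneg)
  also have "\<dots> = ?M * D * gamma_cost K X Y m a b y"
    using M D by (simp add: gamma_cost_def real_sqrt_mult)
  also have "\<dots> \<le> ?M * D * r"
    using M D cost by (intro mult_left_mono) auto
  finally show "cmod (u (\<lambda>(v, y). v \<phi> * h y)) \<le> ?M * D * r" .
qed

text \<open>A nonzero tensor is detected by some bilinear form \<open>\<beta>\<close> about which no
  bound is known. The factor \<open>Y\<close> is separated before the others, and the result is a
  bounded detecting functional, which a vanishing \<open>gamma\<close> excludes.\<close>

lemma gamma_eq_0:
  assumes u: "u \<in> GT" and 0: "gamma K X Y u = 0"
  shows "u = 0"
proof (rule ccontr)
  assume "u \<noteq> 0"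
  then obtain \<beta> where \<beta>: "u \<beta> \<noteq> 0" by (auto simp: fun_eq_iff)
  obtain m :: nat and x y where x: "\<forall>k<m. x k \<in> tuples X" and y: "\<forall>k<m. y k \<in> carrier Y"
    and u_eq: "u = (\<Sum>k<m. etens K X (x k) \<otimes>\<^sub>t y k)"
    by (rule gtensor_sumE[OF u])
  have \<beta>_bform: "\<beta> \<in> bforms K (ptensor K X) Y"
  proof (rule ccontr)
    assume "\<beta> \<notin> bforms K (ptensor K X) Y"
    then show False using \<beta> by (simp add: u_eq fun_sum_apply etens2_apply)
  qed
  have nz: "(\<Sum>k<m. \<beta> (etens K X (x k), y k)) \<noteq> 0"
    using \<beta> \<beta>_bform by (simp add: u_eq fun_sum_apply etens2_apply)
  have hom: "(\<lambda>y. \<beta> (etens K X (x k), y)) \<in> module_hom (scalar_ring K) Y (scalar_space K)" if "k < m" for k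
    using \<beta>_bform x that etens_in_PT by (simp add: bforms_iff)
  obtain h f where h: "Y.bounded_functional h" and f: "f \<in> carrier Y"
    and nz2: "(\<Sum>k<m. h (y k) * \<beta> (etens K X (x k), f)) \<noteq> 0"
    by (rule Y.separate_coordinate[of m y "\<lambda>k y. \<beta> (etens K X (x k), y)"]) (use y hom nz in auto)
  \<comment> \<open>With the second argument frozen at \<open>f\<close>, what remains of
    \<open>\<beta>\<close> is an algebraic multilinear form, and the values \<open>h (y k)\<close>
    act as coefficients.\<close>
  have "(\<lambda>x. \<beta> (etens K X x, f)) \<in> mforms K X"
    unfolding mforms_iff
  proof (intro ballI allI)
    fix z i assume z: "z \<in> tuples X"
    have "(\<lambda>t. etens K X (z(i := t))) \<in> module_hom (scalar_ring K) (X i) (ptensor K X)"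
      by (rule multilinear_hom[OF multilinear_etens z])
    moreover have "(\<lambda>v. \<beta> (v, f)) \<in> module_hom (scalar_ring K) (ptensor K X) (scalar_space K)"
      using \<beta>_bform f by (simp add: bforms_iff)
    ultimately show "(\<lambda>t. \<beta> (etens K X (z(i := t)), f)) \<in> module_hom (scalar_ring K) (X i) (scalar_space K)"
      by (auto simp: module_hom_iff)
  qed
  then obtain g where g: "\<And>i. scalar_normed_space.bounded_functional K (X i) (g i)"
    and nz3: "(\<Sum>k<m. h (y k) * (\<Prod>i\<in>UNIV. g i (x k i))) \<noteq> 0"
    by (rule separate_by_product_form[of _ m x "\<lambda>k. h (y k)"]) (use x y h nz2 in auto)
  define \<phi> where "\<phi> z = (\<Prod>i\<in>UNIV. g i (z i))" for z
  have \<phi>: "bounded_multilinear K X (scalar_space K) \<phi>"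
    unfolding \<phi>_def by (rule product_form[OF g])
  obtain D where D: "0 \<le> D" "\<And>y. y \<in> carrier Y \<Longrightarrow> cmod (h y) \<le> D * nrm Y y"
    using Y.bounded_functional_bound[OF h] by blast
  note h_hom = Y.bounded_functional_hom[OF h]
  have "cmod (u (\<lambda>(v, y). v \<phi> * h y)) \<le> 0"
    using form_tensor_functional_bound[OF \<phi> h_hom D u] 0 by simp
  moreover have "u (\<lambda>(v, y). v \<phi> * h y) = (\<Sum>k<m. h (y k) * \<phi> (x k))"
    using form_tensor_functional_bform[OF bounded_form_mform[OF \<phi>] h_hom] bounded_form_mform[OF \<phi>]
    by (simp add: u_eq fun_sum_apply etens2_apply etens_apply mult.commute)
  ultimately show False using nz3 by (simp add: \<phi>_def)
qed

theorem normed_gtensor: "normed_space K (gtensor K X Y)"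
proof -
  have "gamma K X Y 0 = 0"
    using gamma_smult[OF finite_sums.zero K_closed(1)] by (simp add: zero_fun_def)
  then show ?thesis
    using vectorspace_gtensor
    by (auto simp: normed_space_def normed_space_axioms_def gamma_nonneg gamma_smult gamma_triangle
        intro: gamma_eq_0)
qed

end


section \<open>Linear maps of tensor products\<close>

context scalar_field
begin

lemma op_norm_zero_in:
  assumes V: "normed_space K V" and W: "normed_space K W"
    and T: "T \<in> module_hom (scalar_ring K) V W"
  shows "0 \<in> {nrm W (T v) | v. v \<in> carrier V \<and> nrm V v \<le> 1}"
proof -
  interpret V: scalar_normed_space K V using scalar_field_axioms V by (simp add: scalar_normed_space_def)
  interpret W: scalar_normed_space K W using scalar_field_axioms W by (simp add: scalar_normed_space_def)
  have "nrm W (T \<zero>\<^bsub>V\<^esub>) = 0"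
    using module_hom_zero[OF V.vectorspace_X W.vectorspace_X T] by simp
  then show ?thesis by (intro CollectI exI[of _ "\<zero>\<^bsub>V\<^esub>"]) simp
qed

lemma op_norm_bound:
  assumes V: "normed_space K V" and W: "normed_space K W" and T: "bounded_op K V W T"
  shows "0 \<le> op_norm V W T" and "v \<in> carrier V \<Longrightarrow> nrm W (T v) \<le> op_norm V W T * nrm V v"
proof -
  interpret V: scalar_normed_space K V using scalar_field_axioms V by (simp add: scalar_normed_space_def)
  interpret W: scalar_normed_space K W using scalar_field_axioms W by (simp add: scalar_normed_space_def)
  have hom: "T \<in> module_hom (scalar_ring K) V W" and
    bdd: "bdd_above {nrm W (T v) | v. v \<in> carrier V \<and> nrm V v \<le> 1}"
    using T by (auto simp: bounded_op_def linear_map_iff)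
  show nonneg: "0 \<le> op_norm V W T"
    unfolding op_norm_def by (rule cSup_upper[OF op_norm_zero_in[OF V W hom] bdd])
  assume v: "v \<in> carrier V"
  show "nrm W (T v) \<le> op_norm V W T * nrm V v"
  proof (cases "v = \<zero>\<^bsub>V\<^esub>")
    case True
    then show ?thesis using module_hom_zero[OF V.vectorspace_X W.vectorspace_X hom] by simp
  next
    case False
    define n where "n = nrm V v"
    have n: "0 < n" using False V.nrm_nonneg[OF v] V.nrm_eq_0_iff[OF v] by (simp add: n_def less_le)
    define w where "w = complex_of_real (inverse n) \<odot>\<^bsub>V\<^esub> v"
    have w: "w \<in> carrier V" unfolding w_def using v by (intro V.smult_in) auto
    have "nrm V w = 1"
      using V.nrm_smult[OF _ v, of "complex_of_real (inverse n)"] n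
      by (simp add: w_def norm_divide norm_inverse n_def del: of_real_inverse)
    then have "nrm W (T w) \<le> op_norm V W T"
      unfolding op_norm_def using w by (intro cSup_upper[OF _ bdd]) auto
    moreover have "T w = complex_of_real (inverse n) \<odot>\<^bsub>W\<^esub> T v" "T v \<in> carrier W"
      using hom v by (auto simp: w_def module_hom_iff simp del: of_real_inverse)
    then have "nrm W (T w) = inverse n * nrm W (T v)"
      using W.nrm_smult[of "complex_of_real (inverse n)" "T v"] n
      by (simp add: norm_divide norm_inverse del: of_real_inverse)
    ultimately show ?thesis using n by (simp add: field_simps flip: n_def)
  qed
qed

lemma bounded_opI:
  assumes V: "normed_space K V" and W: "normed_space K W"
    and T: "linear_map (scalar_ring K) V W T"
    and M: "0 \<le> M" and bound: "\<And>v. v \<in> carrier V \<Longrightarrow> nrm W (T v) \<le> M * nrm V v"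
  shows "bounded_op K V W T" and "op_norm V W T \<le> M"
proof -
  have le: "nrm W (T v) \<le> M" if "v \<in> carrier V" "nrm V v \<le> 1" for v
    using bound[OF that(1)] mult_left_mono[OF that(2) M] by simp
  show "bounded_op K V W T"
    unfolding bounded_op_def using T le by (auto intro!: bdd_aboveI[of _ M])
  show "op_norm V W T \<le> M"
    unfolding op_norm_def
    using op_norm_zero_in[OF V W, of T] T le
    by (intro cSup_least) (auto simp: linear_map_iff)
qed

end

context tensor_factors
begin

lemma proj_norm_sum_le:
  "(\<And>k. k \<in> I \<Longrightarrow> v k \<in> finite_sums (decomp K X)) \<Longrightarrow>
    proj_norm K X (\<Sum>k\<in>I. v k) \<le> (\<Sum>k\<in>I. proj_norm K X (v k))"
proof (induction I rule: infinite_finite_induct)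
  case (insert i I)
  have "proj_norm K X (v i + (\<Sum>k\<in>I. v k)) \<le> proj_norm K X (v i) + proj_norm K X (\<Sum>k\<in>I. v k)"
    by (intro proj_norm_triangle finite_sums_sum insert.prems) auto
  also have "proj_norm K X (\<Sum>k\<in>I. v k) \<le> (\<Sum>k\<in>I. proj_norm K X (v k))"
    by (intro insert.IH insert.prems) auto
  finally show ?case
    using insert.hyps by (simp del: plus_fun_apply)
qed (simp_all add: proj_norm_zero)

text \<open>Serves to make an isometric embedding into a completion injective. As for
  \<open>gamma\<close>, a detecting form is traded for a product of bounded functionals, which the
  projective norm dominates.\<close>

lemma proj_norm_eq_0:
  assumes u: "u \<in> finite_sums (decomp K X)" and 0: "proj_norm K X u = 0"
  shows "u = 0"
proof (rule ccontr)
  assume "u \<noteq> 0"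
  then obtain \<phi> where \<phi>: "u \<phi> \<noteq> 0" by (auto simp: fun_eq_iff)
  obtain m :: nat and x where x: "\<forall>k<m. x k \<in> tuples X" and u_eq: "u = (\<Sum>k<m. etens K X (x k))"
    by (rule ptensor_sumE[OF u])
  have form: "\<phi> \<in> mforms K X"
  proof (rule ccontr)
    assume "\<phi> \<notin> mforms K X"
    then show False using \<phi> by (simp add: u_eq fun_sum_apply etens_apply)
  qed
  have nz: "(\<Sum>k<m. 1 * \<phi> (x k)) \<noteq> 0"
    using \<phi> form by (simp add: u_eq fun_sum_apply etens_apply)
  obtain g where g: "\<And>i. scalar_normed_space.bounded_functional K (X i) (g i)"
    and nz': "(\<Sum>k<m. 1 * (\<Prod>i\<in>UNIV. g i (x k i))) \<noteq> 0"
    by (rule separate_by_product_form[OF form _ _ nz]) (use x in auto)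
  define \<psi> where "\<psi> z = (\<Prod>i\<in>UNIV. g i (z i))" for z
  have \<psi>: "bounded_multilinear K X (scalar_space K) \<psi>"
    unfolding \<psi>_def by (rule product_form[OF g])
  have "u \<psi> = (\<Sum>k<m. \<psi> (x k))"
    using bounded_form_mform[OF \<psi>] by (simp add: u_eq fun_sum_apply etens_apply)
  then show False
    using form_le_proj_norm[OF \<psi> u] 0 nz' by (simp add: \<psi>_def)
qed

end

text \<open>
  A multilinear map \<open>r\<close> into decomposable tensors together with a linear map \<open>S\<close> induces a linear map
  of the tensor products. It covers both the maps \<open>R \<otimes> S\<close> and the inclusions of tensor products of
  subspaces.
\<close>

locale tensor_map =
  src: tensor_pair K Z W + tgt: tensor_pair K X Y
  for K and Z :: "'j::finite \<Rightarrow> 'c nspace" and W :: "'d nspace"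
    and X :: "'i::finite \<Rightarrow> 'a nspace" and Y :: "'b nspace" +
  fixes r :: "('j \<Rightarrow> 'c) \<Rightarrow> ('i, 'a) tensor" and S :: "'d \<Rightarrow> 'b" and M N :: real
  assumes r_multilinear: "multilinear K Z (ptensor K X) r"
    and r_decomp: "\<And>z. z \<in> tuples Z \<Longrightarrow> r z \<in> decomp K X"
    and r_bound: "\<And>z. z \<in> tuples Z \<Longrightarrow> proj_norm K X (r z) \<le> M * (\<Prod>i\<in>UNIV. nrm (Z i) (z i))"
    and S_hom: "S \<in> module_hom (scalar_ring K) W Y"
    and S_bound: "\<And>w. w \<in> carrier W \<Longrightarrow> nrm Y (S w) \<le> N * nrm W w"
    and M_nonneg: "0 \<le> M" and N_nonneg: "0 \<le> N"
begin

notation src.tensor_vec (infixl "\<otimes>\<^sub>s" 75)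
notation tgt.tensor_vec (infixl "\<otimes>\<^sub>t" 75)

text \<open>The linearisation of \<open>r\<close>, written as a transpose: a form on the target is
  pulled back along \<open>r\<close> and handed to \<open>v\<close>. Linearity is then immediate,
  and no representation of \<open>v\<close> has to be chosen. \<open>tmap\<close> does the same with
  bilinear forms, pulled back along \<open>lift\<close> and \<open>S\<close>.\<close>

definition lift :: "('j, 'c) tensor \<Rightarrow> ('i, 'a) tensor" where
  "lift v = (\<lambda>\<phi>. if \<phi> \<in> mforms K X then v (\<lambda>z. r z \<phi>) else 0)"

definition tmap :: "(('j, 'c) tensor, 'd) tensor2 \<Rightarrow> (('i, 'a) tensor, 'b) tensor2" where
  "tmap u = (\<lambda>\<beta>. if \<beta> \<in> bforms K (ptensor K X) Y then u (\<lambda>(v, w). \<beta> (lift v, S w)) else 0)"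

lemma S_in: "w \<in> carrier W \<Longrightarrow> S w \<in> carrier Y"
  using S_hom by (simp add: src.module_hom_iff)

lemma r_in: "z \<in> tuples Z \<Longrightarrow> r z \<in> tgt.PT"
  by (simp add: finite_sums_base r_decomp)

lemma pullback_form: "\<phi> \<in> mforms K X \<Longrightarrow> (\<lambda>z. r z \<phi>) \<in> mforms K Z"
  using src.multilinear_hom[OF r_multilinear] tgt.form_hom[of \<phi>]
  by (auto simp: src.mforms_iff src.module_hom_iff)

lemma lift_add: "lift (u + v) = lift u + lift v"
  by (auto simp: lift_def)

lemma lift_smult: "lift (\<lambda>\<phi>. c * v \<phi>) = (\<lambda>\<phi>. c * lift v \<phi>)"
  by (auto simp: lift_def)

lemma lift_diff: "lift (u - v) = lift u - lift v"
  by (auto simp: lift_def)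

lemma lift_zero: "lift 0 = 0"
  by (auto simp: lift_def)

lemma lift_sum: "lift (\<Sum>k\<in>I. v k) = (\<Sum>k\<in>I. lift (v k))"
  by (induction I rule: infinite_finite_induct) (simp_all add: lift_zero lift_add del: plus_fun_apply zero_fun_apply)

lemma lift_etens:
  assumes z: "z \<in> tuples Z"
  shows "lift (etens K Z z) = r z"
proof
  fix \<phi>
  \<comment> \<open>An elementary tensor vanishes off \<open>mforms K X\<close>, as
    \<open>lift\<close> does by definition; this settles the arguments that are not forms.\<close>
  obtain x where "r z = etens K X x" using r_decomp[OF z] by (auto simp: decomp_def)
  then show "lift (etens K Z z) \<phi> = r z \<phi>"
    using pullback_form[of \<phi>] by (auto simp: lift_def src.etens_apply tgt.etens_apply)
qed

text \<open>Decomposable values of \<open>r\<close> are essential here: they keep lifted data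
  admissible in \<open>gamma\<close>.\<close>

lemma lift_decomp: "p \<in> decomp K Z \<Longrightarrow> lift p \<in> decomp K X"
  using lift_etens r_decomp by (auto simp: decomp_def[of K Z])

lemma lift_in:
  assumes "v \<in> src.PT"
  shows "lift v \<in> tgt.PT"
  using assms
proof induction
  case zero
  show ?case unfolding lift_zero by (rule finite_sums.zero)
next
  case (add u a)
  show ?case unfolding lift_add by (rule finite_sums.add[OF add.IH lift_decomp[OF add.hyps(2)]])
qed

lemma pullback_bform:
  "\<beta> \<in> bforms K (ptensor K X) Y \<Longrightarrow> (\<lambda>(v, w). \<beta> (lift v, S w)) \<in> bforms K (ptensor K Z) W"
  using S_hom by (auto simp: src.bforms_iff tgt.bforms_iff src.module_hom_iff lift_in lift_add lift_smult)

lemma tmap_add: "tmap (u + v) = tmap u + tmap v"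
  by (auto simp: tmap_def)

lemma tmap_zero: "tmap 0 = 0"
  by (auto simp: tmap_def)

lemma tmap_smult: "tmap (\<lambda>\<beta>. c * u \<beta>) = (\<lambda>\<beta>. c * tmap u \<beta>)"
  by (auto simp: tmap_def)

lemma tmap_sum: "tmap (\<Sum>k\<in>I. v k) = (\<Sum>k\<in>I. tmap (v k))"
  by (induction I rule: infinite_finite_induct) (simp_all add: tmap_zero tmap_add del: plus_fun_apply zero_fun_apply)

lemma tmap_etens2: "tmap (v \<otimes>\<^sub>s w) = lift v \<otimes>\<^sub>t S w"
  using pullback_bform by (auto simp: tmap_def src.etens2_apply tgt.etens2_apply)

lemma tmap_in:
  assumes "u \<in> src.GT"
  shows "tmap u \<in> tgt.GT"
  using assms
proof induction
  case zero
  show ?case unfolding tmap_zero by (rule finite_sums.zero)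
next
  case (add u a)
  from add.hyps(2) obtain z w where zw: "z \<in> tuples Z" "w \<in> carrier W" "a = etens K Z z \<otimes>\<^sub>s w"
    by (auto simp: src.simple_tensors_def)
  have "tmap a \<in> tgt.GT"
    unfolding zw(3) tmap_etens2 using zw by (intro tgt.etens2_in lift_in S_in) auto
  then show ?case unfolding tmap_add by (rule finite_sums_plus[OF add.IH])
qed

lemma tmap_hom: "tmap \<in> module_hom (scalar_ring K) (gtensor K Z W) (gtensor K X Y)"
  unfolding src.module_hom_iff src.gtensor_simps tgt.gtensor_simps
  by (simp add: tmap_in tmap_add tmap_smult del: plus_fun_apply)

lemma proj_norm_lift_le:
  assumes v: "v \<in> src.PT"
  shows "proj_norm K X (lift v) \<le> M * proj_norm K Z v"
proof (rule src.le_mult_of_gt[OF _ M_nonneg])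
  fix c assume "proj_norm K Z v < c"
  then obtain m :: nat and z where z: "\<forall>k<m. z k \<in> tuples Z" "v = (\<Sum>k<m. etens K Z (z k))"
    and c: "(\<Sum>k<m. \<Prod>i\<in>UNIV. nrm (Z i) (z k i)) < c"
    by (rule src.proj_norm_approx[OF v])
  have "lift v = (\<Sum>k<m. r (z k))"
    unfolding z(2) lift_sum using z(1) by (intro sum.cong) (auto simp: lift_etens)
  then have "proj_norm K X (lift v) \<le> (\<Sum>k<m. proj_norm K X (r (z k)))"
    using tgt.proj_norm_sum_le[of "{..<m}" "\<lambda>k. r (z k)"] z(1) r_in by simp
  also have "\<dots> \<le> (\<Sum>k<m. M * (\<Prod>i\<in>UNIV. nrm (Z i) (z k i)))"
    using z(1) by (intro sum_mono r_bound) auto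
  also have "\<dots> = M * (\<Sum>k<m. \<Prod>i\<in>UNIV. nrm (Z i) (z k i))" by (simp add: sum_distrib_left)
  also have "\<dots> \<le> M * c" using c M_nonneg by (intro mult_left_mono) auto
  finally show "proj_norm K X (lift v) \<le> M * c" .
qed

text \<open>The comparison on the source speaks about bounded forms only, so a pulled-back form can
  be inserted once it is bounded; its constant is the norm of \<open>\<phi>\<close> times
  \<open>M\<close>.\<close>

lemma pullback_bounded_form:
  assumes \<phi>: "bounded_multilinear K X (scalar_space K) \<phi>"
  shows "bounded_multilinear K Z (scalar_space K) (\<lambda>z. r z \<phi>)"
proof (rule src.bounded_multilinearI)
  show "multilinear K Z (scalar_space K) (\<lambda>z. r z \<phi>)"
    using pullback_form[OF tgt.bounded_form_mform[OF \<phi>]] by (simp add: mforms_def)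
  fix z assume z: "z \<in> tuples Z"
  let ?B = "multi_norm X (scalar_space K) \<phi>"
  have "cmod (r z \<phi>) \<le> ?B * proj_norm K X (r z)"
    by (rule tgt.form_le_proj_norm[OF \<phi> r_in[OF z]])
  also have "\<dots> \<le> ?B * (M * (\<Prod>i\<in>UNIV. nrm (Z i) (z i)))"
    using tgt.multi_norm_nonneg[OF \<phi> src.normed_scalar_space] r_bound[OF z] by (intro mult_left_mono)
  finally show "nrm (scalar_space K) (r z \<phi>) \<le> (?B * M) * (\<Prod>i\<in>UNIV. nrm (Z i) (z i))"
    by (simp add: mult.assoc)
qed

lemma gamma_rep_tmap:
  assumes rep: "gamma_rep K Z W u m p q a b w"
  shows "gamma_rep K X Y (tmap u) m (\<lambda>k. lift (p k)) (\<lambda>k. lift (q k)) (\<lambda>k. lift (a k)) (\<lambda>k. lift (b k))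
    (\<lambda>k. S (w k))"
proof -
  have "tmap u = (\<Sum>k<m. (lift (p k) - lift (q k)) \<otimes>\<^sub>t S (w k))"
    using rep by (simp only: gamma_rep_def tmap_sum tmap_etens2 lift_diff)
  moreover have "le_pi K X m (\<lambda>k. lift (p k)) (\<lambda>k. lift (q k)) m (\<lambda>k. lift (a k)) (\<lambda>k. lift (b k))"
    unfolding le_pi_def
  proof (intro allI impI)
    fix \<phi> assume \<phi>: "bounded_multilinear K X (scalar_space K) \<phi>"
    have "f_form \<phi> (lift v) = f_form (\<lambda>z. r z \<phi>) v" for v
      using tgt.bounded_form_mform[OF \<phi>] by (simp add: f_form_def lift_def)
    then show "(\<Sum>k<m. (cmod (f_form \<phi> (lift (p k)) - f_form \<phi> (lift (q k))))\<^sup>2)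
        \<le> (\<Sum>k<m. (cmod (f_form \<phi> (lift (a k)) - f_form \<phi> (lift (b k))))\<^sup>2)"
      using rep pullback_bounded_form[OF \<phi>] by (simp add: gamma_rep_def le_pi_def)
  qed
  ultimately show ?thesis
    using rep by (simp add: gamma_rep_def lift_decomp S_in)
qed

text \<open>The comparison tensors are lifted along with the representation. Their differences grow
  by at most \<open>M\<close>, the vectors by at most \<open>N\<close>, and these factors come out
  of the two square roots.\<close>

lemma gamma_tmap_le:
  assumes u: "u \<in> src.GT"
  shows "gamma K X Y (tmap u) \<le> M * N * gamma K Z W u"
proof (rule src.le_mult_of_gt)
  show "0 \<le> M * N" using M_nonneg N_nonneg by simp
  fix c assume "gamma K Z W u < c"
  then obtain m p q a b w where rep: "gamma_rep K Z W u m p q a b w"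
    and cost: "gamma_cost K Z W m a b w < c"
    by (rule src.gamma_approx_rep[OF u])
  have "gamma K X Y (tmap u) \<le> gamma_cost K X Y m (\<lambda>k. lift (a k)) (\<lambda>k. lift (b k)) (\<lambda>k. S (w k))"
    by (rule gamma_le[OF gamma_rep_tmap[OF rep]])
  also have "\<dots> \<le> sqrt (M\<^sup>2 * (\<Sum>k<m. (proj_norm K Z (a k - b k))\<^sup>2)) * sqrt (N\<^sup>2 * (\<Sum>k<m. (nrm W (w k))\<^sup>2))"
    unfolding gamma_cost_def
  proof (intro mult_mono real_sqrt_le_mono)
    show "(\<Sum>k<m. (proj_norm K X (lift (a k) - lift (b k)))\<^sup>2) \<le> M\<^sup>2 * (\<Sum>k<m. (proj_norm K Z (a k - b k))\<^sup>2)"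
      unfolding sum_distrib_left
    proof (rule sum_mono)
      fix k assume "k \<in> {..<m}"
      then have ab: "a k - b k \<in> src.PT" using rep src.decomp_diff_in by (auto simp: gamma_rep_def)
      have "(proj_norm K X (lift (a k - b k)))\<^sup>2 \<le> (M * proj_norm K Z (a k - b k))\<^sup>2"
        by (intro power_mono proj_norm_lift_le[OF ab] tgt.proj_norm_nonneg lift_in[OF ab])
      then show "(proj_norm K X (lift (a k) - lift (b k)))\<^sup>2 \<le> M\<^sup>2 * (proj_norm K Z (a k - b k))\<^sup>2"
        by (simp add: lift_diff power_mult_distrib)
    qed
    show "(\<Sum>k<m. (nrm Y (S (w k)))\<^sup>2) \<le> N\<^sup>2 * (\<Sum>k<m. (nrm W (w k))\<^sup>2)"
      unfolding sum_distrib_left power_mult_distrib[symmetric]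
      using rep by (intro sum_mono power_mono S_bound tgt.Y.nrm_nonneg S_in) (auto simp: gamma_rep_def)
  qed (auto simp: sum_nonneg)
  also have "\<dots> = M * N * gamma_cost K Z W m a b w"
    using M_nonneg N_nonneg by (simp add: gamma_cost_def real_sqrt_mult)
  also have "\<dots> \<le> M * N * c"
    using M_nonneg N_nonneg cost by (intro mult_left_mono) auto
  finally show "gamma K X Y (tmap u) \<le> M * N * c" .
qed

end

section \<open>The functional of a form and the operator of a multilinear map\<close>

context tensor_pair
begin

theorem form_tensor_functional:
  assumes \<phi>: "bounded_multilinear K X (scalar_space K) \<phi>"
    and ys: "bounded_op K Y (scalar_space K) ys"
  defines "is_functional \<equiv> (\<lambda>T.
      linear_map (scalar_ring K) (gtensor K X Y) (scalar_space K) T \<and>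
      (\<forall>x \<in> tuples X. \<forall>y \<in> carrier Y. T (etens K X x \<otimes>\<^sub>t y) = \<phi> x * ys y))"
  shows "\<exists>T. is_functional T \<and>
    (\<forall>T'. is_functional T' \<longrightarrow> (\<forall>u \<in> carrier (gtensor K X Y). T' u = T u)) \<and>
    bounded_op K (gtensor K X Y) (scalar_space K) T \<and>
    op_norm (gtensor K X Y) (scalar_space K) T
      \<le> multi_norm X (scalar_space K) \<phi> * op_norm Y (scalar_space K) ys"
proof -
  \<comment> \<open>The desired functional is evaluation of tensors at one bilinear form, so it is
    well defined and linear at once.\<close>
  define T where "T u = u (\<lambda>(v, y). v \<phi> * ys y)" for u :: "(('i, 'a) tensor, 'b) tensor2"
  have hom: "ys \<in> module_hom (scalar_ring K) Y (scalar_space K)"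
    using ys by (simp add: bounded_op_def linear_map_iff)
  note form = bounded_form_mform[OF \<phi>]
  note bform = form_tensor_functional_bform[OF form hom]
  have lin: "linear_map (scalar_ring K) (gtensor K X Y) (scalar_space K) T"
    unfolding linear_map_iff
    using vectorspace_gtensor vectorspace_scalar_space gtensor_value_in[OF bform]
    by (auto simp: module_hom_iff T_def)
  have val: "T (etens K X x \<otimes>\<^sub>t y) = \<phi> x * ys y" for x y
    using bform form by (simp add: T_def etens2_apply etens_apply)
  have func: "is_functional T"
    using lin val by (simp add: is_functional_def)
  have unique: "T' u = T u" if T': "is_functional T'" and u: "u \<in> GT" for T' u
  proof (rule gtensor_hom_unique[OF vectorspace_scalar_space _ _ _ u])
    show "T \<in> module_hom (scalar_ring K) (gtensor K X Y) (scalar_space K)"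
      using lin by (simp add: linear_map_iff)
    show "T' \<in> module_hom (scalar_ring K) (gtensor K X Y) (scalar_space K)"
      using T' by (simp add: is_functional_def linear_map_iff)
    show "T' (etens K X x \<otimes>\<^sub>t y) = T (etens K X x \<otimes>\<^sub>t y)" if "x \<in> tuples X" "y \<in> carrier Y" for x y
      using T' that val by (simp add: is_functional_def)
  qed
  have bound: "nrm (scalar_space K) (T u)
      \<le> multi_norm X (scalar_space K) \<phi> * op_norm Y (scalar_space K) ys * nrm (gtensor K X Y) u"
    if "u \<in> carrier (gtensor K X Y)" for u
    using form_tensor_functional_bound[OF \<phi> hom op_norm_bound(1)[OF normed_Y normed_scalar_space ys], of u]
      op_norm_bound(2)[OF normed_Y normed_scalar_space ys] that
    by (simp add: T_def)
  have "0 \<le> multi_norm X (scalar_space K) \<phi> * op_norm Y (scalar_space K) ys"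
    using multi_norm_nonneg[OF \<phi> normed_scalar_space] op_norm_bound(1)[OF normed_Y normed_scalar_space ys]
    by simp
  note bounded_opI[OF normed_gtensor normed_scalar_space lin this bound]
  then show ?thesis using func unique by (intro exI[of _ T]) auto
qed

text \<open>\<open>R\<close> factors through the embedding as \<open>\<iota> \<circ> r\<close> with
  \<open>r\<close> decomposable-valued. Since \<open>\<iota>\<close> is linear, injective and
  isometric, multilinearity and the bound pass from \<open>R\<close> to \<open>r\<close>, and the
  induced map is \<open>tmap\<close>.\<close>

theorem multilinear_tensor_operator:
  fixes Z :: "'m::finite \<Rightarrow> 'c nspace" and W :: "'d nspace" and C :: "'e nspace"
  assumes Z: "\<And>i. normed_space K (Z i)" and W: "normed_space K W"
    and C: "is_completion K (ptensor K X) C \<iota>"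
    and R: "bounded_multilinear K Z C R" and R_decomp: "R ` tuples Z \<subseteq> \<iota> ` decomp K X"
    and S: "bounded_op K W Y S"
  defines "is_tensor_map \<equiv> (\<lambda>T.
      linear_map (scalar_ring K) (gtensor K Z W) (gtensor K X Y) T \<and>
      (\<forall>z \<in> tuples Z. \<forall>w \<in> carrier W. \<forall>p \<in> decomp K X. \<iota> p = R z \<longrightarrow>
         T (etens2 K (ptensor K Z) W (etens K Z z) w) = p \<otimes>\<^sub>t S w))"
  shows "\<exists>T. is_tensor_map T \<and>
    (\<forall>T'. is_tensor_map T' \<longrightarrow> (\<forall>u \<in> carrier (gtensor K Z W). T' u = T u)) \<and>
    bounded_op K (gtensor K Z W) (gtensor K X Y) T \<and>
    op_norm (gtensor K Z W) (gtensor K X Y) T \<le> multi_norm Z C R * op_norm W Y S"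
proof -
  interpret Z: tensor_pair K Z W
    using scalar_field_axioms Z W
    by (simp add: tensor_pair_def tensor_pair_axioms_def tensor_factors_def tensor_factors_axioms_def)
  have normed_C: "normed_space K C" and \<iota>_hom: "\<iota> \<in> module_hom (scalar_ring K) (ptensor K X) C"
    and isometry: "\<And>v. v \<in> PT \<Longrightarrow> nrm C (\<iota> v) = proj_norm K X v"
    using C by (auto simp: is_completion_def linear_map_iff banach_space_def)
  interpret C: scalar_normed_space K C
    using scalar_field_axioms normed_C by (simp add: scalar_normed_space_def)
  \<comment> \<open>An isometry for a definite norm has trivial kernel.\<close>
  have \<iota>_inj: "u = v" if "u \<in> PT" "v \<in> PT" "\<iota> u = \<iota> v" for u v
  proof -
    have v': "(\<lambda>\<phi>. (- 1) * v \<phi>) \<in> PT" using that(2) by (intro ptensor_smult_in) auto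
    have diff: "u - v = u + (\<lambda>\<phi>. (- 1) * v \<phi>)" by (auto simp: fun_eq_iff)
    have "\<iota> (u + (\<lambda>\<phi>. (- 1) * v \<phi>)) = \<iota> u \<oplus>\<^bsub>C\<^esub> \<iota> (\<lambda>\<phi>. (- 1) * v \<phi>)"
      using module_hom_add[OF \<iota>_hom, of u "\<lambda>\<phi>. (- 1) * v \<phi>"] that(1) v' by (simp only: ptensor_simps)
    also have "\<iota> (\<lambda>\<phi>. (- 1) * v \<phi>) = (- 1) \<odot>\<^bsub>C\<^esub> \<iota> v"
      using module_hom_smult[OF \<iota>_hom, of "- 1" v] that(2) K_closed(2,5)
      by (simp only: ptensor_simps scalar_ring_simps)
    also have "\<iota> v \<in> carrier C" using \<iota>_hom that(2) by (auto simp: module_hom_iff)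
    then have "\<iota> u \<oplus>\<^bsub>C\<^esub> (- 1) \<odot>\<^bsub>C\<^esub> \<iota> v = \<zero>\<^bsub>C\<^esub>"
      using that(3) by (simp add: C.M.r_neg flip: C.minus_eq_smult)
    finally have "\<iota> (u - v) = \<zero>\<^bsub>C\<^esub>" by (simp only: diff)
    then have "proj_norm K X (u - v) = 0"
      using isometry[OF ptensor_diff_in[OF that(1,2)]] by simp
    then have "u - v = 0" by (rule proj_norm_eq_0[OF ptensor_diff_in[OF that(1,2)]])
    then show ?thesis by simp
  qed
  \<comment> \<open>By \<open>\<iota>_inj\<close> the preimage is unique, so the choice is harmless;
    this is also what makes \<open>r\<close> multilinear.\<close>
  define r where "r z = (SOME p. p \<in> decomp K X \<and> \<iota> p = R z)" for z
  have r: "r z \<in> decomp K X" "\<iota> (r z) = R z" if "z \<in> tuples Z" for z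
  proof -
    have "\<exists>p. p \<in> decomp K X \<and> \<iota> p = R z" using R_decomp that by force
    then have "r z \<in> decomp K X \<and> \<iota> (r z) = R z" unfolding r_def by (rule someI_ex)
    then show "r z \<in> decomp K X" "\<iota> (r z) = R z" by auto
  qed
  have r_PT: "r z \<in> PT" if "z \<in> tuples Z" for z
    using r(1)[OF that] by (rule finite_sums_base)
  have R_ml: "multilinear K Z C R" using R by (simp add: bounded_multilinear_def)
  have r_ml: "multilinear K Z (ptensor K X) r"
    unfolding Z.multilinear_iff[OF vectorspace_ptensor]
  proof (intro ballI allI)
    fix z i assume z: "z \<in> tuples Z"
    note hom = Z.multilinear_hom[OF R_ml z, of i]
    interpret Zi: scalar_normed_space K "Z i" by (rule Z.factor)
    \<comment> \<open>Both sides are algebraic tensors with the same image under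
      \<open>\<iota>\<close>, because \<open>R\<close> is additive in this coordinate.\<close>
    have add: "r (z(i := s \<oplus>\<^bsub>Z i\<^esub> t)) = r (z(i := s)) + r (z(i := t))"
      if st: "s \<in> carrier (Z i)" "t \<in> carrier (Z i)" for s t
    proof (rule \<iota>_inj)
      show "r (z(i := s \<oplus>\<^bsub>Z i\<^esub> t)) \<in> PT" using z st by (intro r_PT Z.tuples_upd Zi.M.a_closed)
      show "r (z(i := s)) + r (z(i := t)) \<in> PT" using z st by (intro finite_sums_plus r_PT Z.tuples_upd)
      have "\<iota> (r (z(i := s)) + r (z(i := t))) = \<iota> (r (z(i := s))) \<oplus>\<^bsub>C\<^esub> \<iota> (r (z(i := t)))"
        using module_hom_add[OF \<iota>_hom, of "r (z(i := s))" "r (z(i := t))"] r_PT Z.tuples_upd z st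
        by (simp only: ptensor_simps)
      then show "\<iota> (r (z(i := s \<oplus>\<^bsub>Z i\<^esub> t))) = \<iota> (r (z(i := s)) + r (z(i := t)))"
        using r(2) Z.tuples_upd[OF z] st module_hom_add[OF hom st] Zi.M.a_closed by simp
    qed
    have smult: "r (z(i := c \<odot>\<^bsub>Z i\<^esub> t)) = (\<lambda>\<phi>. c * r (z(i := t)) \<phi>)"
      if ct: "c \<in> K" "t \<in> carrier (Z i)" for c t
    proof (rule \<iota>_inj)
      show "r (z(i := c \<odot>\<^bsub>Z i\<^esub> t)) \<in> PT" using z ct by (intro r_PT Z.tuples_upd Zi.smult_in)
      show "(\<lambda>\<phi>. c * r (z(i := t)) \<phi>) \<in> PT" using z ct by (intro ptensor_smult_in r_PT Z.tuples_upd)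
      have "\<iota> (\<lambda>\<phi>. c * r (z(i := t)) \<phi>) = c \<odot>\<^bsub>C\<^esub> \<iota> (r (z(i := t)))"
        using module_hom_smult[OF \<iota>_hom, of c "r (z(i := t))"] r_PT Z.tuples_upd z ct
        by (simp only: ptensor_simps scalar_ring_simps)
      then show "\<iota> (r (z(i := c \<odot>\<^bsub>Z i\<^esub> t))) = \<iota> (\<lambda>\<phi>. c * r (z(i := t)) \<phi>)"
        using r(2) Z.tuples_upd[OF z] ct module_hom_smult[OF hom, of c t] Zi.smult_in by simp
    qed
    show "(\<lambda>t. r (z(i := t))) \<in> module_hom (scalar_ring K) (Z i) (ptensor K X)"
      unfolding module_hom_iff ptensor_simps using add smult r_PT Z.tuples_upd[OF z] by blast
  qed
  have S_hom: "S \<in> module_hom (scalar_ring K) W Y" using S by (simp add: bounded_op_def linear_map_iff)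
  interpret tensor_map K Z W X Y r S "multi_norm Z C R" "op_norm W Y S"
  proof
    show "proj_norm K X (r z) \<le> multi_norm Z C R * (\<Prod>i\<in>UNIV. nrm (Z i) (z i))"
      if "z \<in> tuples Z" for z
      using Z.multi_norm_bound[OF R normed_C that] isometry[OF r_PT[OF that]] r(2)[OF that] by simp
    show "nrm Y (S w) \<le> op_norm W Y S * nrm W w" if "w \<in> carrier W" for w
      by (rule op_norm_bound(2)[OF W normed_Y S that])
    show "0 \<le> multi_norm Z C R" by (rule Z.multi_norm_nonneg[OF R normed_C])
    show "0 \<le> op_norm W Y S" by (rule op_norm_bound(1)[OF W normed_Y S])
  qed (use r_ml r(1) S_hom in auto)
  have lin: "linear_map (scalar_ring K) (gtensor K Z W) (gtensor K X Y) tmap"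
    using Z.vectorspace_gtensor vectorspace_gtensor tmap_hom by (simp add: linear_map_iff)
  have val: "tmap (etens2 K (ptensor K Z) W (etens K Z z) w) = p \<otimes>\<^sub>t S w"
    if "z \<in> tuples Z" "p \<in> decomp K X" "\<iota> p = R z" for z w p
  proof -
    have "p = r z"
      using that r(2)[OF that(1)] by (intro \<iota>_inj r_PT finite_sums_base) auto
    then show ?thesis using tmap_etens2 lift_etens[OF that(1)] by simp
  qed
  have T: "is_tensor_map tmap" using lin val by (simp add: is_tensor_map_def)
  have unique: "T' u = tmap u" if T': "is_tensor_map T'" and u: "u \<in> Z.GT" for T' u
  proof (rule Z.gtensor_hom_unique[OF vectorspace_gtensor tmap_hom _ _ u])
    show "T' \<in> module_hom (scalar_ring K) (gtensor K Z W) (gtensor K X Y)"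
      using T' by (simp add: is_tensor_map_def linear_map_iff)
    show "T' (etens2 K (ptensor K Z) W (etens K Z z) w) = tmap (etens2 K (ptensor K Z) W (etens K Z z) w)"
      if "z \<in> tuples Z" "w \<in> carrier W" for z w
      using T' that r[OF that(1)] val[OF that(1) r[OF that(1)]] unfolding is_tensor_map_def by metis
  qed
  have bound: "nrm (gtensor K X Y) (tmap u) \<le> multi_norm Z C R * op_norm W Y S * nrm (gtensor K Z W) u"
    if "u \<in> carrier (gtensor K Z W)" for u
    using gamma_tmap_le that by simp
  have "0 \<le> multi_norm Z C R * op_norm W Y S" using M_nonneg N_nonneg by simp
  note bounded = bounded_opI[OF Z.normed_gtensor normed_gtensor lin this bound]
  show ?thesis
  proof (intro exI[of _ tmap] conjI allI impI ballI)
    show "T' u = tmap u" if "is_tensor_map T'" "u \<in> carrier (gtensor K Z W)" for T' u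
      by (rule unique[OF that(1)]) (use that(2) in simp)
    show "is_tensor_map tmap" by (rule T)
    show "bounded_op K (gtensor K Z W) (gtensor K X Y) tmap" by (rule bounded(1))
    show "op_norm (gtensor K Z W) (gtensor K X Y) tmap \<le> multi_norm Z C R * op_norm W Y S"
      by (rule bounded(2))
  qed
qed

end


section \<open>Reduction to finite dimensional subspaces\<close>

context scalar_normed_space
begin

lemma normed_subspace:
  assumes "VectorSpace.subspace (scalar_ring K) E X"
  shows "normed_space K (X\<lparr>carrier := E\<rparr>)"
proof -
  interpret E: VectorSpace.subspace "scalar_ring K" E X by (rule assms)
  interpret E': submodule "scalar_ring K" E X by (rule E.submod)
  have "vectorspace (scalar_ring K) (X\<lparr>carrier := E\<rparr>)"
    by (rule subspace_is_vs[OF assms])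
  moreover have "x \<in> E \<Longrightarrow> x \<in> carrier X" for x using E'.subset by auto
  ultimately show ?thesis
    using nrm_nonneg nrm_eq_0_iff nrm_smult nrm_triangle
    by (auto simp: normed_space_def normed_space_axioms_def)
qed

lemma fd_subspace_span:
  assumes "finite A" "A \<subseteq> carrier X"
  shows "fd_subspace K (span A) X"
proof -
  have sub: "VectorSpace.subspace (scalar_ring K) (span A) X"
    by (rule span_is_subspace[OF assms(2)])
  have submod: "submodule (scalar_ring K) (span A) X"
    by (rule span_is_submodule[OF assms(2)])
  interpret E: vectorspace "scalar_ring K" "X\<lparr>carrier := span A\<rparr>"
    by (rule subspace_is_vs[OF sub])
  have A: "A \<subseteq> span A" by (rule in_own_span[OF assms(2)])
  have "E.span A = span A"
    by (rule span_li_not_depend(1)[OF A submod])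
  then have "E.fin_dim"
    unfolding E.fin_dim_def using assms(1) A by auto
  with sub show ?thesis by (simp add: fd_subspace_def)
qed

text \<open>The fixed points of a linear operator form a submodule, so fixing \<open>A\<close> means
  fixing its span. The constant \<open>C\<close> is arbitrary: it only has to keep extended forms
  bounded.\<close>

lemma bounded_retraction_onto_span:
  assumes A: "finite A" "A \<subseteq> carrier X"
  shows "\<exists>P C. P \<in> module_hom (scalar_ring K) X X \<and> (\<forall>x \<in> carrier X. P x \<in> span A) \<and>
    (\<forall>x \<in> span A. P x = x) \<and> 0 \<le> C \<and> (\<forall>x \<in> carrier X. nrm X (P x) \<le> C * nrm X x)"
proof -
  have submod: "submodule (scalar_ring K) (span A) X"
    by (rule span_is_submodule[OF A(2)])
  obtain P where P: "finite_rank P" "\<And>x. x \<in> carrier X \<Longrightarrow> P x \<in> span A" "\<And>a. a \<in> A \<Longrightarrow> P a = a"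
    using finite_rank_identity_on_finite[OF A(1) in_own_span[OF A(2)] submod] by blast
  note hom = finite_rank_hom[OF P(1)]
  have "submodule (scalar_ring K) {x \<in> carrier X. P x = x} X"
  proof (rule submodule.intro)
    show "module (scalar_ring K) X" using vectorspace_X by (simp add: vectorspace_def)
    show "\<zero> \<in> {x \<in> carrier X. P x = x}"
      using module_hom_zero[OF vectorspace_X vectorspace_X hom] by simp
  qed (use hom in \<open>auto simp: module_hom_iff\<close>)
  moreover have "A \<subseteq> {x \<in> carrier X. P x = x}" using A(2) P(3) by auto
  ultimately have "span A \<subseteq> {x \<in> carrier X. P x = x}" by (intro span_is_subset)
  moreover obtain C where "0 \<le> C" "\<forall>x \<in> carrier X. nrm X (P x) \<le> C * nrm X x"
    using finite_rank_bound[OF P(1)] by blast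
  ultimately show ?thesis using hom P(2) by blast
qed

end

text \<open>By continuity at 0. The slack \<open>\<delta>\<close> pays for replacing each projective
  norm by the value of a nearly optimal representation.\<close>

lemma sum_squares_perturb:
  fixes f :: "nat \<Rightarrow> real"
  assumes "sqrt (\<Sum>k<m. (f k)\<^sup>2) * B < c"
  obtains \<delta> where "0 < \<delta>" "sqrt (\<Sum>k<m. (f k + \<delta>)\<^sup>2) * B < c"
proof -
  have "((\<lambda>\<delta>. sqrt (\<Sum>k<m. (f k + \<delta>)\<^sup>2) * B) \<longlongrightarrow> sqrt (\<Sum>k<m. (f k + 0)\<^sup>2) * B) (at_right 0)"
    by (intro tendsto_intros)
  then have "\<forall>\<^sub>F \<delta> in at_right 0. sqrt (\<Sum>k<m. (f k + \<delta>)\<^sup>2) * B < c"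
    by (rule order_tendstoD) (use assms in simp)
  then have "\<forall>\<^sub>F \<delta> in at_right (0 :: real). 0 < \<delta> \<and> sqrt (\<Sum>k<m. (f k + \<delta>)\<^sup>2) * B < c"
    using eventually_at_right_less by eventually_elim auto
  then show ?thesis
    using that eventually_happens[of _ "at_right (0 :: real)"] by force
qed

lemma fd_subspace_subset: "fd_subspace K E V \<Longrightarrow> E \<subseteq> carrier V"
  by (simp add: fd_subspace_def VectorSpace.subspace_def submodule_def)

lemma (in tensor_factors) tensor_factors_restr:
  assumes "\<And>i. fd_subspace K (E i) (X i)"
  shows "tensor_factors K (restr X E)"
proof -
  have "normed_space K (restr X E i)" for i
    using scalar_normed_space.normed_subspace[OF factor, of "E i" i] assms[of i]
    by (simp add: restr_def fd_subspace_def)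
  then show ?thesis
    using scalar_field_axioms by (simp add: tensor_factors_def tensor_factors_axioms_def)
qed

section \<open>Tensor products of subspaces\<close>

context tensor_pair
begin

lemma tensor_pair_restr:
  assumes "\<And>i. fd_subspace K (E i) (X i)" "fd_subspace K F Y"
  shows "tensor_pair K (restr X E) (Y\<lparr>carrier := F\<rparr>)"
  using tensor_factors_restr[OF assms(1)] Y.normed_subspace[of F] assms(2)
  by (simp add: tensor_pair_def tensor_pair_axioms_def fd_subspace_def)

lemma tuples_restr:
  assumes "\<And>i. fd_subspace K (E i) (X i)"
  shows "x \<in> tuples (restr X E) \<Longrightarrow> x \<in> tuples X"
  using fd_subspace_subset[OF assms] by (auto simp: tuples_def restr_def)

text \<open>The canonical multilinear map of the large space, restricted to tuples from the
  subspaces, has constant 1 because an elementary tensor is its own one-term representation.\<close>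

lemma tensor_map_incl:
  assumes E: "\<And>i. fd_subspace K (E i) (X i)" and F: "fd_subspace K F Y"
  shows "tensor_map K (restr X E) (Y\<lparr>carrier := F\<rparr>) X Y (etens K X) id 1 1"
proof -
  interpret E: tensor_pair K "restr X E" "Y\<lparr>carrier := F\<rparr>"
    by (rule tensor_pair_restr[OF E F])
  show ?thesis
  proof
    show "multilinear K (restr X E) (ptensor K X) (etens K X)"
      unfolding E.multilinear_iff[OF vectorspace_ptensor]
    proof (intro ballI allI)
      fix x i assume x: "x \<in> tuples (restr X E)"
      have "t \<in> carrier (X i)" if "t \<in> E i" for t
        using fd_subspace_subset[OF E] that by auto
      then show "(\<lambda>t. etens K X (x(i := t))) \<in> module_hom (scalar_ring K) (restr X E i) (ptensor K X)"
        using multilinear_hom[OF multilinear_etens tuples_restr[OF E x], of i]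
        by (simp add: module_hom_iff restr_def del: ptensor_simps)
    qed
    fix x assume x: "x \<in> tuples (restr X E)"
    show "etens K X x \<in> decomp K X" using tuples_restr[OF E x] by auto
    show "proj_norm K X (etens K X x) \<le> 1 * (\<Prod>i\<in>UNIV. nrm (restr X E i) (x i))"
      using proj_norm_le[of 1 "\<lambda>_. x" "etens K X x"] tuples_restr[OF E x] by (simp add: restr_def)
  next
    show "id \<in> module_hom (scalar_ring K) (Y\<lparr>carrier := F\<rparr>) Y"
      using fd_subspace_subset[OF F] by (auto simp: module_hom_iff)
  qed auto
qed

text \<open>For \<open>r = etens K X\<close> the pullback of a form is the form itself, so
  \<open>lift\<close> is \<open>push\<close> along the identity.\<close>

lemma tensor_incl_eq_tmap:
  assumes E: "\<And>i. fd_subspace K (E i) (X i)" and F: "fd_subspace K F Y"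
  shows "tensor_incl K X Y v = tensor_map.tmap K X Y (etens K X) id v"
proof -
  interpret tensor_map K "restr X E" "Y\<lparr>carrier := F\<rparr>" X Y "etens K X" id 1 1
    by (rule tensor_map_incl[OF E F])
  have "(\<lambda>z. etens K X z \<phi>) = \<phi>" if "\<phi> \<in> mforms K X" for \<phi>
    using that by (simp add: etens_apply)
  then have "push (mforms K X) id = lift"
    by (auto simp: lift_def push_def fun_eq_iff)
  then show ?thesis
    unfolding tensor_incl_def
    by (intro ext) (simp add: push_def[of "bforms K (ptensor K X) Y"] tmap_def o_def map_prod_def case_prod_unfold)
qed

lemma gamma_le_restr:
  assumes E: "\<And>i. fd_subspace K (E i) (X i)" and F: "fd_subspace K F Y"
    and v: "v \<in> carrier (gtensor K (restr X E) (Y\<lparr>carrier := F\<rparr>))"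
  shows "gamma K X Y (tensor_incl K X Y v) \<le> gamma K (restr X E) (Y\<lparr>carrier := F\<rparr>) v"
proof -
  interpret tensor_map K "restr X E" "Y\<lparr>carrier := F\<rparr>" X Y "etens K X" id 1 1
    by (rule tensor_map_incl[OF E F])
  show ?thesis
    using gamma_tmap_le[of v] v by (simp add: tensor_incl_eq_tmap[OF E F])
qed

text \<open>
  The retractions \<open>P i\<close> of \<open>X i\<close> onto \<open>E i\<close> extend every multilinear form on the \<open>E i\<close> to one on the
  \<open>X i\<close>, so that equations and inequalities between tensors over the \<open>X i\<close> descend to the \<open>E i\<close>.
\<close>

lemma gamma_restr_approx:
  assumes u: "u \<in> GT" and c: "gamma K X Y u < c"
  obtains E F v where "\<forall>i. fd_subspace K (E i) (X i)" "fd_subspace K F Y"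
    "v \<in> carrier (gtensor K (restr X E) (Y\<lparr>carrier := F\<rparr>))" "tensor_incl K X Y v = u"
    "gamma K (restr X E) (Y\<lparr>carrier := F\<rparr>) v < c"
proof -
  obtain m p q a b y where rep: "gamma_rep K X Y u m p q a b y" and cost: "gamma_cost K X Y m a b y < c"
    by (rule gamma_approx_rep[OF u c])
  \<comment> \<open>Reserved for the nearly optimal representations of the differences
    \<open>a k - b k\<close>.\<close>
  obtain \<delta> where \<delta>: "0 < \<delta>"
    "sqrt (\<Sum>k<m. (proj_norm K X (a k - b k) + \<delta>)\<^sup>2) * sqrt (\<Sum>k<m. (nrm Y (y k))\<^sup>2) < c"
    using cost unfolding gamma_cost_def by (rule sum_squares_perturb)
  have in_decomp: "p k \<in> decomp K X" "q k \<in> decomp K X" "a k \<in> decomp K X" "b k \<in> decomp K X"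
    "y k \<in> carrier Y" if "k < m" for k
    using rep that by (auto simp: gamma_rep_def)
  have choose: "\<exists>x. \<forall>k<m. x k \<in> tuples X \<and> d k = etens K X (x k)"
    if "\<And>k. k < m \<Longrightarrow> d k \<in> decomp K X" for d :: "nat \<Rightarrow> ('i, 'a) tensor"
  proof (intro exI allI impI)
    fix k assume "k < m"
    then have "\<exists>x. x \<in> tuples X \<and> d k = etens K X x" using that by (auto simp: decomp_def)
    then show "(SOME x. x \<in> tuples X \<and> d k = etens K X x) \<in> tuples X \<and>
        d k = etens K X (SOME x. x \<in> tuples X \<and> d k = etens K X x)"
      by (rule someI_ex)
  qed
  obtain xp where xp: "\<forall>k<m. xp k \<in> tuples X \<and> p k = etens K X (xp k)"
    using choose[of p] in_decomp by blast
  obtain xq where xq: "\<forall>k<m. xq k \<in> tuples X \<and> q k = etens K X (xq k)"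
    using choose[of q] in_decomp by blast
  obtain xa where xa: "\<forall>k<m. xa k \<in> tuples X \<and> a k = etens K X (xa k)"
    using choose[of a] in_decomp by blast
  obtain xb where xb: "\<forall>k<m. xb k \<in> tuples X \<and> b k = etens K X (xb k)"
    using choose[of b] in_decomp by blast
  \<comment> \<open>For each \<open>k\<close> a pair consisting of the number of terms and the
    tuples, so that one choice delivers both.\<close>
  have "\<exists>nw :: nat \<times> (nat \<Rightarrow> 'i \<Rightarrow> 'a). k < m \<longrightarrow> (\<forall>j<fst nw. snd nw j \<in> tuples X) \<and>
      a k - b k = (\<Sum>j<fst nw. etens K X (snd nw j)) \<and>
      (\<Sum>j<fst nw. \<Prod>i\<in>UNIV. nrm (X i) (snd nw j i)) < proj_norm K X (a k - b k) + \<delta>" for k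
  proof (cases "k < m")
    case True
    obtain n :: nat and w where "\<forall>j<n. w j \<in> tuples X" "a k - b k = (\<Sum>j<n. etens K X (w j))"
      "(\<Sum>j<n. \<Prod>i\<in>UNIV. nrm (X i) (w j i)) < proj_norm K X (a k - b k) + \<delta>"
      by (rule proj_norm_approx[OF decomp_diff_in[OF in_decomp(3,4)[OF True]],
            of "proj_norm K X (a k - b k) + \<delta>"]) (use \<delta>(1) in simp)
    then show ?thesis by (intro exI[of _ "(n, w)"]) simp
  qed simp
  then have "\<exists>nw :: nat \<Rightarrow> nat \<times> (nat \<Rightarrow> 'i \<Rightarrow> 'a). \<forall>k. k < m \<longrightarrow> (\<forall>j<fst (nw k). snd (nw k) j \<in> tuples X) \<and>
      a k - b k = (\<Sum>j<fst (nw k). etens K X (snd (nw k) j)) \<and>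
      (\<Sum>j<fst (nw k). \<Prod>i\<in>UNIV. nrm (X i) (snd (nw k) j i)) < proj_norm K X (a k - b k) + \<delta>"
    by (intro choice allI)
  then obtain nw :: "nat \<Rightarrow> nat \<times> (nat \<Rightarrow> 'i \<Rightarrow> 'a)" where
    nw: "\<forall>k. k < m \<longrightarrow> (\<forall>j<fst (nw k). snd (nw k) j \<in> tuples X) \<and>
      a k - b k = (\<Sum>j<fst (nw k). etens K X (snd (nw k) j)) \<and>
      (\<Sum>j<fst (nw k). \<Prod>i\<in>UNIV. nrm (X i) (snd (nw k) j i)) < proj_norm K X (a k - b k) + \<delta>" ..
  define n where "n k = fst (nw k)" for k
  define w where "w k = snd (nw k)" for k
  have w: "w k j \<in> tuples X" if "k < m" "j < n k" for k j
    using nw that by (auto simp: n_def w_def)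
  have ab: "a k - b k = (\<Sum>j<n k. etens K X (w k j))"
    and w_cost: "(\<Sum>j<n k. \<Prod>i\<in>UNIV. nrm (X i) (w k j i)) < proj_norm K X (a k - b k) + \<delta>" if "k < m" for k
    using nw that by (auto simp: n_def w_def)
  \<comment> \<open>The tuples \<open>w k j\<close> are included because a projective norm computed
    in subspaces may exceed the original one; with them the nearly optimal sums remain available
    there.\<close>
  define V where "V = (\<Union>k<m. {xp k, xq k, xa k, xb k} \<union> w k ` {..<n k})"
  have V: "finite V" "V \<subseteq> tuples X"
    using xp xq xa xb w by (auto simp: V_def)
  define A where "A i = (\<lambda>x. x i) ` V" for i
  have A: "finite (A i)" "A i \<subseteq> carrier (X i)" for i
    using V by (auto simp: A_def tuples_def)
  define E where "E i = module.span (scalar_ring K) (X i) (A i)" for i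
  define F where "F = Y.span (y ` {..<m})"
  have yF: "y ` {..<m} \<subseteq> carrier Y" using in_decomp(5) by auto
  have E: "fd_subspace K (E i) (X i)" for i
    unfolding E_def by (rule scalar_normed_space.fd_subspace_span[OF factor A])
  have F: "fd_subspace K F Y"
    unfolding F_def by (rule Y.fd_subspace_span[OF _ yF]) simp
  have V_E: "x \<in> tuples (restr X E)" if "x \<in> V" for x
  proof -
    have "x i \<in> E i" for i
    proof -
      interpret Xi: scalar_normed_space K "X i" by (rule factor)
      show ?thesis
        using Xi.in_own_span[OF A(2)] that by (auto simp: E_def A_def)
    qed
    then show ?thesis by (simp add: tuples_def restr_def)
  qed
  have y_F: "y k \<in> F" if "k < m" for k
    using Y.in_own_span[OF yF] that by (auto simp: F_def)
  have "\<exists>PC. \<forall>i. fst (PC i) \<in> module_hom (scalar_ring K) (X i) (X i) \<and>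
      (\<forall>x \<in> carrier (X i). fst (PC i) x \<in> E i) \<and> (\<forall>x \<in> E i. fst (PC i) x = x) \<and>
      0 \<le> snd (PC i) \<and> (\<forall>x \<in> carrier (X i). nrm (X i) (fst (PC i) x) \<le> snd (PC i) * nrm (X i) x)"
    using scalar_normed_space.bounded_retraction_onto_span[OF factor A]
    by (intro choice allI) (simp add: E_def split_paired_Ex)
  then obtain PC where PC: "\<And>i. fst (PC i) \<in> module_hom (scalar_ring K) (X i) (X i) \<and>
      (\<forall>x \<in> carrier (X i). fst (PC i) x \<in> E i) \<and> (\<forall>x \<in> E i. fst (PC i) x = x) \<and>
      0 \<le> snd (PC i) \<and> (\<forall>x \<in> carrier (X i). nrm (X i) (fst (PC i) x) \<le> snd (PC i) * nrm (X i) x)"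
    by blast
  define P where "P i = fst (PC i)" for i
  define D where "D i = snd (PC i)" for i
  have P_hom: "P i \<in> module_hom (scalar_ring K) (X i) (X i)" for i using PC by (simp add: P_def)
  have P_E: "x \<in> carrier (X i) \<Longrightarrow> P i x \<in> E i" for i x using PC by (simp add: P_def)
  have P_id: "x \<in> E i \<Longrightarrow> P i x = x" for i x using PC by (simp add: P_def)
  have D: "0 \<le> D i" "x \<in> carrier (X i) \<Longrightarrow> nrm (X i) (P i x) \<le> D i * nrm (X i) x" for i x
    using PC by (simp_all add: P_def D_def)
  interpret tensor_map K "restr X E" "Y\<lparr>carrier := F\<rparr>" X Y "etens K X" id 1 1
    by (rule tensor_map_incl[OF E F])
  have PE: "(\<lambda>i. P i (x i)) \<in> tuples (restr X E)" if "x \<in> tuples X" for x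
    using that P_E by (auto simp: tuples_def restr_def)
  have PE_id: "(\<lambda>i. P i (x i)) = x" if "x \<in> tuples (restr X E)" for x
    using that P_id by (auto simp: tuples_def restr_def)
  \<comment> \<open>Precomposition with the retractions extends a form from the subspaces to the
    whole spaces.\<close>
  define ext where "ext \<psi> x = \<psi> (\<lambda>i. P i (x i))" for \<psi> :: "('i \<Rightarrow> 'a) \<Rightarrow> complex" and x
  have ext_form: "ext \<psi> \<in> mforms K X" if \<psi>: "\<psi> \<in> mforms K (restr X E)" for \<psi>
    unfolding mforms_iff
  proof (intro ballI allI)
    fix x j assume x: "x \<in> tuples X"
    have upd: "(\<lambda>i. P i ((x(j := t)) i)) = (\<lambda>i. P i (x i))(j := P j t)" for t by auto
    have "(\<lambda>t. \<psi> ((\<lambda>i. P i (x i))(j := t))) \<in> module_hom (scalar_ring K) (restr X E j) (scalar_space K)"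
      using \<psi> PE[OF x] by (simp add: src.mforms_iff)
    then show "(\<lambda>t. ext \<psi> (x(j := t))) \<in> module_hom (scalar_ring K) (X j) (scalar_space K)"
      unfolding ext_def upd using P_hom[of j] P_E[of _ j] by (simp add: module_hom_iff restr_def)
  qed
  \<comment> \<open>The product of the constants \<open>D i\<close> may be large, which does no
    harm: the comparison quantifies over bounded forms without regard to their norms.\<close>
  have ext_bounded: "bounded_multilinear K X (scalar_space K) (ext \<psi>)"
    if \<psi>: "bounded_multilinear K (restr X E) (scalar_space K) \<psi>" for \<psi>
  proof (rule bounded_multilinearI)
    show "multilinear K X (scalar_space K) (ext \<psi>)"
      using ext_form[OF src.bounded_form_mform[OF \<psi>]] by (simp add: mforms_def)
    fix x assume x: "x \<in> tuples X"
    let ?B = "multi_norm (restr X E) (scalar_space K) \<psi>"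
    have "cmod (ext \<psi> x) \<le> ?B * (\<Prod>i\<in>UNIV. nrm (X i) (P i (x i)))"
      using src.multi_norm_bound[OF \<psi> normed_scalar_space PE[OF x]] by (simp add: ext_def restr_def)
    also have "\<dots> \<le> ?B * (\<Prod>i\<in>UNIV. D i * nrm (X i) (x i))"
    proof (intro mult_left_mono prod_mono conjI)
      show "0 \<le> ?B" by (rule src.multi_norm_nonneg[OF \<psi> normed_scalar_space])
      show "nrm (X i) (P i (x i)) \<le> D i * nrm (X i) (x i)" for i by (rule D(2)[OF tuples_in[OF x]])
      show "0 \<le> nrm (X i) (P i (x i))" for i
        using P_hom[of i] tuples_in[OF x] normed_space.nrm_nonneg[OF normed_X] by (auto simp: module_hom_iff)
    qed
    finally show "nrm (scalar_space K) (ext \<psi> x) \<le> (?B * (\<Prod>i\<in>UNIV. D i)) * (\<Prod>i\<in>UNIV. nrm (X i) (x i))"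
      by (simp add: prod.distrib mult.assoc)
  qed
  have lift_ext: "lift v (ext \<psi>) = v \<psi>" if v: "v \<in> src.PT" and \<psi>: "\<psi> \<in> mforms K (restr X E)" for v \<psi>
  proof -
    obtain l :: nat and z where z: "\<forall>k<l. z k \<in> tuples (restr X E)" "v = (\<Sum>k<l. etens K (restr X E) (z k))"
      by (rule src.ptensor_sumE[OF v])
    have "lift v (ext \<psi>) = (\<Sum>k<l. etens K X (z k) (ext \<psi>))"
      unfolding z(2) lift_sum fun_sum_apply using z(1) by (intro sum.cong) (auto simp: lift_etens)
    also have "\<dots> = (\<Sum>k<l. \<psi> (z k))"
      using z(1) ext_form[OF \<psi>] by (intro sum.cong) (auto simp: etens_apply ext_def PE_id)
    also have "\<dots> = v \<psi>" using \<psi> by (simp add: z(2) fun_sum_apply src.etens_apply)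
    finally show ?thesis .
  qed
  \<comment> \<open>Injectivity of the inclusion: a form on the subspaces extends, so its value at
    \<open>v\<close> can be read off from \<open>lift v\<close>; off the forms both tensors are
    0.\<close>
  have lift_inj: "v = v'" if v: "v \<in> src.PT" "v' \<in> src.PT" and eq: "lift v = lift v'" for v v'
  proof
    fix \<psi>
    have outside: "t \<psi> = 0" if "t \<in> src.PT" "\<psi> \<notin> mforms K (restr X E)" for t
      using that(1)
    proof induction
      case (add t s)
      then show ?case using that(2) by (auto simp: decomp_def src.etens_apply)
    qed simp
    show "v \<psi> = v' \<psi>"
      using lift_ext[OF v(1)] lift_ext[OF v(2)] eq outside v
      by (cases "\<psi> \<in> mforms K (restr X E)") metis+
  qed
  define e where "e = etens K (restr X E)"
  have in_V: "xp k \<in> V" "xq k \<in> V" "xa k \<in> V" "xb k \<in> V" "j < n k \<Longrightarrow> w k j \<in> V" if "k < m" for k j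
    using that by (auto simp: V_def)
  have e_decomp: "e x \<in> decomp K (restr X E)" if "x \<in> V" for x
    using V_E[OF that] by (auto simp: e_def)
  have lift_e: "lift (e x) = etens K X x" if "x \<in> V" for x
    using lift_etens[OF V_E[OF that]] by (simp add: e_def)
  define v where "v = (\<Sum>k<m. src.tensor_vec (e (xp k) - e (xq k)) (y k))"
  \<comment> \<open>Testing with \<open>\<psi>\<close> on the subspaces equals testing the original
    data with \<open>ext \<psi>\<close>.\<close>
  have "le_pi K (restr X E) m (\<lambda>k. e (xp k)) (\<lambda>k. e (xq k)) m (\<lambda>k. e (xa k)) (\<lambda>k. e (xb k))"
    unfolding le_pi_def
  proof (intro allI impI)
    fix \<psi> assume \<psi>: "bounded_multilinear K (restr X E) (scalar_space K) \<psi>"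
    have eq: "f_form \<psi> (e x) = f_form (ext \<psi>) (etens K X x)" if "x \<in> V" for x
      using lift_ext[OF finite_sums_base[OF e_decomp[OF that]] src.bounded_form_mform[OF \<psi>]] lift_e[OF that]
      by (simp add: f_form_def)
    show "(\<Sum>k<m. (cmod (f_form \<psi> (e (xp k)) - f_form \<psi> (e (xq k))))\<^sup>2)
        \<le> (\<Sum>k<m. (cmod (f_form \<psi> (e (xa k)) - f_form \<psi> (e (xb k))))\<^sup>2)"
      using rep ext_bounded[OF \<psi>] xp xq xa xb in_V by (simp add: eq gamma_rep_def le_pi_def)
  qed
  then have rep_E: "gamma_rep K (restr X E) (Y\<lparr>carrier := F\<rparr>) v m
      (\<lambda>k. e (xp k)) (\<lambda>k. e (xq k)) (\<lambda>k. e (xa k)) (\<lambda>k. e (xb k)) y"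
    using in_V e_decomp y_F by (simp add: gamma_rep_def v_def)
  have v_in: "v \<in> src.GT"
    unfolding v_def
    by (intro finite_sums_sum src.etens2_in src.decomp_diff_in e_decomp in_V) (use y_F in auto)
  have "tmap v = (\<Sum>k<m. (p k - q k) \<otimes>\<^sub>t y k)"
    unfolding v_def tmap_sum tmap_etens2 lift_diff
    using xp xq in_V by (intro sum.cong) (auto simp: lift_e)
  also have "\<dots> = u" using rep by (simp add: gamma_rep_def)
  finally have incl: "tensor_incl K X Y v = u" by (simp add: tensor_incl_eq_tmap[OF E F])
  \<comment> \<open>The nearly optimal representation is an identity over the large spaces;
    \<open>lift_inj\<close> carries it down to the subspaces, where the vectors have the same
    norms.\<close>
  have pn: "proj_norm K (restr X E) (e (xa k) - e (xb k)) \<le> proj_norm K X (a k - b k) + \<delta>" if k: "k < m" for k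
  proof -
    have "e (xa k) - e (xb k) = (\<Sum>j<n k. e (w k j))"
    proof (rule lift_inj)
      show "e (xa k) - e (xb k) \<in> src.PT" using in_V k by (intro src.decomp_diff_in e_decomp) auto
      show "(\<Sum>j<n k. e (w k j)) \<in> src.PT"
        using in_V k by (intro finite_sums_sum finite_sums_base e_decomp) auto
      have "lift (\<Sum>j<n k. e (w k j)) = (\<Sum>j<n k. etens K X (w k j))"
        unfolding lift_sum using in_V k by (intro sum.cong) (auto simp: lift_e)
      then show "lift (e (xa k) - e (xb k)) = lift (\<Sum>j<n k. e (w k j))"
        using ab[OF k] xa xb k in_V by (simp add: lift_diff lift_e)
    qed
    then have "proj_norm K (restr X E) (e (xa k) - e (xb k))
        \<le> (\<Sum>j<n k. \<Prod>i\<in>UNIV. nrm (restr X E i) (w k j i))"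
      unfolding e_def using in_V k V_E by (intro src.proj_norm_le) auto
    then show ?thesis using w_cost[OF k] by (simp add: restr_def)
  qed
  have "gamma K (restr X E) (Y\<lparr>carrier := F\<rparr>) v
      \<le> gamma_cost K (restr X E) (Y\<lparr>carrier := F\<rparr>) m (\<lambda>k. e (xa k)) (\<lambda>k. e (xb k)) y"
    by (rule gamma_le[OF rep_E])
  also have "\<dots> \<le> sqrt (\<Sum>k<m. (proj_norm K X (a k - b k) + \<delta>)\<^sup>2) * sqrt (\<Sum>k<m. (nrm Y (y k))\<^sup>2)"
    unfolding gamma_cost_def
  proof (intro mult_mono real_sqrt_le_mono sum_mono power_mono)
    show "0 \<le> proj_norm K (restr X E) (e (xa k) - e (xb k))" if "k \<in> {..<m}" for k
      using that in_V by (intro src.proj_norm_nonneg src.decomp_diff_in e_decomp) auto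
  qed (use pn Y.nrm_nonneg in_decomp(5) in \<open>auto simp: sum_nonneg\<close>)
  also note \<delta>(2)
  finally have less: "gamma K (restr X E) (Y\<lparr>carrier := F\<rparr>) v < c" .
  show ?thesis
    by (rule that[of E F v]) (use E F v_in incl less in \<open>simp_all add: src.gtensor_simps\<close>)
qed

theorem gamma_eq_Inf_restr:
  assumes u: "u \<in> carrier (gtensor K X Y)"
  shows "gamma K X Y u =
    Inf {gamma K (restr X E) (Y\<lparr>carrier := F\<rparr>) v | E F v.
      (\<forall>i. fd_subspace K (E i) (X i)) \<and> fd_subspace K F Y \<and>
      v \<in> carrier (gtensor K (restr X E) (Y\<lparr>carrier := F\<rparr>)) \<and> tensor_incl K X Y v = u}"
    (is "_ = Inf ?G")
proof (rule antisym)
  have lower: "gamma K X Y u \<le> g" if "g \<in> ?G" for g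
  proof -
    from that obtain E F v where g: "g = gamma K (restr X E) (Y\<lparr>carrier := F\<rparr>) v"
      and EF: "\<forall>i. fd_subspace K (E i) (X i)" "fd_subspace K F Y"
      and v: "v \<in> carrier (gtensor K (restr X E) (Y\<lparr>carrier := F\<rparr>))" "tensor_incl K X Y v = u"
      unfolding mem_Collect_eq by (elim exE conjE)
    show ?thesis
      using gamma_le_restr[OF EF(1)[rule_format] EF(2) v(1)] by (simp add: g v(2))
  qed
  \<comment> \<open>Used twice: it shows that the set is nonempty, and it bounds the infimum from
    above.\<close>
  have approx: "\<exists>g \<in> ?G. g < c" if c: "gamma K X Y u < c" for c
  proof -
    have uGT: "u \<in> GT" using u by simp
    obtain E F v where "\<forall>i. fd_subspace K (E i) (X i)" "fd_subspace K F Y"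
      "v \<in> carrier (gtensor K (restr X E) (Y\<lparr>carrier := F\<rparr>))" "tensor_incl K X Y v = u"
      "gamma K (restr X E) (Y\<lparr>carrier := F\<rparr>) v < c"
      by (rule gamma_restr_approx[OF uGT c])
    then show ?thesis
      by (intro bexI[of _ "gamma K (restr X E) (Y\<lparr>carrier := F\<rparr>) v"] CollectI exI[of _ E] exI[of _ F]
          exI[of _ v]) simp_all
  qed
  have "?G \<noteq> {}" using approx[of "gamma K X Y u + 1"] by auto
  then show "gamma K X Y u \<le> Inf ?G" using lower by (rule cInf_greatest)
  show "Inf ?G \<le> gamma K X Y u"
  proof (rule field_le_epsilon)
    fix \<epsilon> :: real assume "0 < \<epsilon>"
    then obtain g where g: "g \<in> ?G" "g < gamma K X Y u + \<epsilon>"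
      using approx[of "gamma K X Y u + \<epsilon>"] by auto
    have "Inf ?G \<le> g" using lower by (intro cInf_lower[OF g(1)] bdd_belowI)
    then show "Inf ?G \<le> gamma K X Y u + \<epsilon>" using g(2) by simp
  qed
qed

end

theorem proposition4p3:
  fixes K :: "complex set"
    and X :: "'n::finite \<Rightarrow> 'a nspace"
    and Y :: "'b nspace"
  assumes K: "K = \<real> \<or> K = UNIV"
    and X: "\<And>i. banach_space K (X i)"
    and Y: "banach_space K Y"
  shows
    "normed_space K (gtensor K X Y) \<and>
     (\<forall>p \<in> decomp K X. \<forall>q \<in> decomp K X. \<forall>y \<in> carrier Y.
       gamma K X Y (etens2 K (ptensor K X) Y (p - q) y) \<le> proj_norm K X (p - q) * nrm Y y) \<and>
     (\<forall>\<phi> ys. bounded_multilinear K X (scalar_space K) \<phi> \<longrightarrow>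
       bounded_op K Y (scalar_space K) ys \<longrightarrow>
       (let is_functional = (\<lambda>T.
              linear_map (scalar_ring K) (gtensor K X Y) (scalar_space K) T \<and>
              (\<forall>x \<in> tuples X. \<forall>y \<in> carrier Y.
                 T (etens2 K (ptensor K X) Y (etens K X x) y) = \<phi> x * ys y))
        in \<exists>T. is_functional T \<and>
              (\<forall>T'. is_functional T' \<longrightarrow> (\<forall>u \<in> carrier (gtensor K X Y). T' u = T u)) \<and>
              bounded_op K (gtensor K X Y) (scalar_space K) T \<and>
              op_norm (gtensor K X Y) (scalar_space K) T
                \<le> multi_norm X (scalar_space K) \<phi> * op_norm Y (scalar_space K) ys)) \<and>
     (\<forall>(Z :: 'm::finite \<Rightarrow> 'c nspace) (W :: 'd nspace) (C :: 'e nspace) \<iota> R S.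
       (\<forall>i. banach_space K (Z i)) \<longrightarrow>
       banach_space K W \<longrightarrow>
       is_completion K (ptensor K X) C \<iota> \<longrightarrow>
       bounded_multilinear K Z C R \<longrightarrow>
       R ` tuples Z \<subseteq> \<iota> ` decomp K X \<longrightarrow>
       bounded_op K W Y S \<longrightarrow>
       (let is_tensor_map = (\<lambda>T.
              linear_map (scalar_ring K) (gtensor K Z W) (gtensor K X Y) T \<and>
              (\<forall>z \<in> tuples Z. \<forall>w \<in> carrier W. \<forall>p \<in> decomp K X. \<iota> p = R z \<longrightarrow>
                 T (etens2 K (ptensor K Z) W (etens K Z z) w) = etens2 K (ptensor K X) Y p (S w)))
        in \<exists>T. is_tensor_map T \<and>
              (\<forall>T'. is_tensor_map T' \<longrightarrow> (\<forall>u \<in> carrier (gtensor K Z W). T' u = T u)) \<and>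
              bounded_op K (gtensor K Z W) (gtensor K X Y) T \<and>
              op_norm (gtensor K Z W) (gtensor K X Y) T \<le> multi_norm Z C R * op_norm W Y S)) \<and>
     (\<forall>u \<in> carrier (gtensor K X Y).
       gamma K X Y u =
         Inf {gamma K (restr X E) (Y\<lparr>carrier := F\<rparr>) v | E F v.
           (\<forall>i. fd_subspace K (E i) (X i)) \<and> fd_subspace K F Y \<and>
           v \<in> carrier (gtensor K (restr X E) (Y\<lparr>carrier := F\<rparr>)) \<and>
           tensor_incl K X Y v = u})"
proof -
  have normed: "banach_space K V \<Longrightarrow> normed_space K V" for V
    by (simp add: banach_space_def)
  interpret tensor_pair K X Y
    using K X Y
    by (simp add: tensor_pair_def tensor_pair_axioms_def tensor_factors_def tensor_factors_axioms_def
        scalar_field_def banach_space_def)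
  show ?thesis
    unfolding Let_def
    by (intro conjI normed_gtensor ballI allI impI gamma_simple_le form_tensor_functional
        multilinear_tensor_operator gamma_eq_Inf_restr normed) simp_all
qed

end
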